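(* Let $D=\prod_{i\in I}D_i$ be a product of feathered Abelian topological groups. Then the group $PD$ is reflexive.
   Context: Topological groups are assumed Hausdorff. A topological group $G$ is feathered (equivalently, almost metrizable) if it contains a nonempty compact set $K$ with a countable neighbourhood base in $G$. $\mathbb T=\{z\in\mathbb C:|z|=1\}$ is the circle group. For a topological Abelian group $G$, $G^\wedge$ is the group of continuous characters (continuous homomorphisms $G\to\mathbb T$) with the topology of uniform convergence on compact subsets of $G$. $G$ is reflexive if the evaluation homomorphism $\alpha_G:G\to G^{\wedge\wedge}$, $\alpha_G(x)(\chi)=\chi(x)$, is a topological isomorphism of $G$ onto $G^{\wedge\wedge}=(G^\wedge)^\wedge$. For a topological group $H$, $PH$ ($P$-modification) is the same group with the finer group topology whose base consists of all $G_\delta$-sets of $H$. $D=\prod_{i\in I}D_i$ carries the Tychonoff product topology, and $PD$ is the $P$-modification of this product. *)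

theory Defs
  imports "HOL-Analysis.Analysis" "HOL-Algebra.Product_Groups"
begin

text \<open>
  A topological group is given by a group structure \<open>G\<close> with an explicit carrier and a
  topology \<open>T\<close> on that carrier; the Hausdorff axiom is part of the definition.
\<close>

definition topological_group :: "'a monoid \<Rightarrow> 'a topology \<Rightarrow> bool" where
  "topological_group G T \<longleftrightarrow>
     group G \<and> topspace T = carrier G \<and> Hausdorff_space T \<and>
     continuous_map (prod_topology T T) T (\<lambda>(x, y). x \<otimes>\<^bsub>G\<^esub> y) \<and>
     continuous_map T T (\<lambda>x. inv\<^bsub>G\<^esub> x)"

definition topological_abelian_group :: "'a monoid \<Rightarrow> 'a topology \<Rightarrow> bool" where
  "topological_abelian_group G T \<longleftrightarrow> topological_group G T \<and> comm_group G"

definition feathered_group :: "'a monoid \<Rightarrow> 'a topology \<Rightarrow> bool" where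
  "feathered_group G T \<longleftrightarrow>
     topological_group G T \<and>
     (\<exists>K. compactin T K \<and> K \<noteq> {} \<and>
        (\<exists>\<B>. countable \<B> \<and> (\<forall>U\<in>\<B>. openin T U \<and> K \<subseteq> U) \<and>
             (\<forall>V. openin T V \<and> K \<subseteq> V \<longrightarrow> (\<exists>U\<in>\<B>. U \<subseteq> V))))"

definition circle_group :: "complex monoid" where
  "circle_group = \<lparr>carrier = sphere 0 1, monoid.mult = (*), one = 1\<rparr>"

text \<open>
  Characters are taken to be extensional (equal to \<open>undefined\<close> outside the carrier), so that
  equality of characters as HOL functions is equality on the group.
\<close>

definition characters :: "'a monoid \<Rightarrow> 'a topology \<Rightarrow> ('a \<Rightarrow> complex) set" where
  "characters G T =
     {\<phi> \<in> extensional (carrier G).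
        \<phi> \<in> hom G circle_group \<and> continuous_map T (top_of_set (sphere 0 1)) \<phi>}"

definition dual_group :: "'a monoid \<Rightarrow> 'a topology \<Rightarrow> ('a \<Rightarrow> complex) monoid" where
  "dual_group G T =
     \<lparr>carrier = characters G T,
      monoid.mult = (\<lambda>\<phi> \<psi>. \<lambda>x\<in>carrier G. \<phi> x * \<psi> x),
      one = (\<lambda>x\<in>carrier G. 1)\<rparr>"

definition dual_topology :: "'a monoid \<Rightarrow> 'a topology \<Rightarrow> ('a \<Rightarrow> complex) topology" where
  "dual_topology G T = topology (\<lambda>U. U \<subseteq> characters G T \<and>
     (\<forall>\<phi>\<in>U. \<exists>K e. compactin T K \<and> e > 0 \<and>
        {\<psi> \<in> characters G T. \<forall>x\<in>K. dist (\<psi> x) (\<phi> x) < e} \<subseteq> U))"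

lemma istopology_dual:
  "istopology (\<lambda>U. U \<subseteq> characters G T \<and>
     (\<forall>\<phi>\<in>U. \<exists>K e. compactin T K \<and> e > (0::real) \<and>
        {\<psi> \<in> characters G T. \<forall>x\<in>K. dist (\<psi> x) (\<phi> x) < e} \<subseteq> U))"
  (is "istopology ?P")
proof -
  have int: "?P (S \<inter> R)" if S: "?P S" and R: "?P R" for S R
  proof (intro conjI ballI)
    show "S \<inter> R \<subseteq> characters G T" using S by blast
  next
    fix \<phi> assume "\<phi> \<in> S \<inter> R"
    then obtain K e L d where
      K: "compactin T K" "e > 0" "{\<psi> \<in> characters G T. \<forall>x\<in>K. dist (\<psi> x) (\<phi> x) < e} \<subseteq> S" and
      L: "compactin T L" "d > 0" "{\<psi> \<in> characters G T. \<forall>x\<in>L. dist (\<psi> x) (\<phi> x) < d} \<subseteq> R"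
      using S R by (meson IntD1 IntD2)
    have "{\<psi> \<in> characters G T. \<forall>x\<in>K \<union> L. dist (\<psi> x) (\<phi> x) < min e d} \<subseteq> S \<inter> R"
      using K(3) L(3) by auto
    moreover have "compactin T (K \<union> L)" "min e d > 0"
      using K L by (auto intro: compactin_Un)
    ultimately show "\<exists>K e. compactin T K \<and> e > 0 \<and>
        {\<psi> \<in> characters G T. \<forall>x\<in>K. dist (\<psi> x) (\<phi> x) < e} \<subseteq> S \<inter> R"
      by blast
  qed
  have un: "?P (\<Union>\<K>)" if \<K>: "\<forall>S\<in>\<K>. ?P S" for \<K>
  proof (intro conjI ballI)
    show "\<Union>\<K> \<subseteq> characters G T" using \<K> by blast
  next
    fix \<phi> assume "\<phi> \<in> \<Union>\<K>"
    then obtain S where S: "S \<in> \<K>" "\<phi> \<in> S" by blast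
    then obtain K e where
      "compactin T K" "e > 0" "{\<psi> \<in> characters G T. \<forall>x\<in>K. dist (\<psi> x) (\<phi> x) < e} \<subseteq> S"
      using \<K> by meson
    with S(1) show "\<exists>K e. compactin T K \<and> e > 0 \<and>
        {\<psi> \<in> characters G T. \<forall>x\<in>K. dist (\<psi> x) (\<phi> x) < e} \<subseteq> \<Union>\<K>"
      by (meson Union_upper subset_trans)
  qed
  show ?thesis
    unfolding istopology_def using int un by blast
qed

lemma openin_dual_topology:
  "openin (dual_topology G T) U \<longleftrightarrow> U \<subseteq> characters G T \<and>
     (\<forall>\<phi>\<in>U. \<exists>K e. compactin T K \<and> e > 0 \<and>
        {\<psi> \<in> characters G T. \<forall>x\<in>K. dist (\<psi> x) (\<phi> x) < e} \<subseteq> U)"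
  unfolding dual_topology_def topology_inverse'[OF istopology_dual] ..

lemma topspace_dual_topology: "topspace (dual_topology G T) = characters G T"
proof -
  have "openin (dual_topology G T) (characters G T)"
    unfolding openin_dual_topology
    using compactin_empty[of T] zero_less_one[where 'a = real] by blast
  then show ?thesis
    by (meson openin_dual_topology openin_subset openin_topspace subset_antisym)
qed

abbreviation bidual_group ::
    "'a monoid \<Rightarrow> 'a topology \<Rightarrow> (('a \<Rightarrow> complex) \<Rightarrow> complex) monoid" where
  "bidual_group G T \<equiv> dual_group (dual_group G T) (dual_topology G T)"

abbreviation bidual_topology ::
    "'a monoid \<Rightarrow> 'a topology \<Rightarrow> (('a \<Rightarrow> complex) \<Rightarrow> complex) topology" where
  "bidual_topology G T \<equiv> dual_topology (dual_group G T) (dual_topology G T)"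

definition evaluation :: "'a monoid \<Rightarrow> 'a topology \<Rightarrow> 'a \<Rightarrow> ('a \<Rightarrow> complex) \<Rightarrow> complex" where
  "evaluation G T x = (\<lambda>\<phi>\<in>carrier (dual_group G T). \<phi> x)"

definition reflexive_group :: "'a monoid \<Rightarrow> 'a topology \<Rightarrow> bool" where
  "reflexive_group G T \<longleftrightarrow>
     topological_abelian_group G T \<and>
     evaluation G T \<in> iso G (bidual_group G T) \<and>
     homeomorphic_map T (bidual_topology G T) (evaluation G T)"

definition P_modification :: "'a topology \<Rightarrow> 'a topology" where
  "P_modification T = topology (arbitrary union_of gdelta_in T)"

lemma openin_P_modification:
  "openin (P_modification T) U \<longleftrightarrow> (arbitrary union_of gdelta_in T) U"
  unfolding P_modification_def
  by (simp add: istopology_base gdelta_in_Int topology_inverse')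

lemma topspace_P_modification: "topspace (P_modification T) = topspace T"
proof
  show "topspace (P_modification T) \<subseteq> topspace T"
    using openin_topspace[of "P_modification T"]
    unfolding openin_P_modification union_of_def
    by (metis (no_types, lifting) Sup_least gdelta_in_subset mem_Collect_eq subsetD)
  have "openin (P_modification T) (topspace T)"
    unfolding openin_P_modification
    by (simp add: arbitrary_def open_imp_gdelta_in union_of_inc)
  then show "topspace T \<subseteq> topspace (P_modification T)"
    by (rule openin_subset)
qed

end

theory Submission
  imports Defs "HOL-Algebra.FiniteProduct"
begin

text \<open>
  Every feathered group has arbitrarily small compact subgroups that are intersections of sequences
  of open sets, so the P-modification of the product has a base of open subgroups, the boxes with
  countably many proper factors, each of them such a compact subgroup. Compact subsets of a P-group
  are finite, hence the dual carries the topology of pointwise convergence. Surjectivity of the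
  evaluation map is the Comfort--Ross theorem, and it is open onto its image because annihilators of
  open subgroups are compact and characters of discrete Abelian groups separate points.
  What remains is continuity: a compact set \<open>C\<close> of characters must annihilate an open subgroup.
  Otherwise a recursion of length \<open>\<omega>\<^sub>1\<close> produces characters in \<open>C\<close> and a point of the product,
  glued from compact cosets, at which these characters avoid their own accumulation point.
\<close>

section \<open>Characters and averages\<close>

text \<open>The obstacle behind the last step is that countably many base subgroups have a common
  lower bound, whereas an uncountable chain in general has none. Two properties of compact subgroups
  compensate for this. A decreasing chain of their cosets, however long, still has a common point,
  so corrections made at different stages fit together to one element. And every character of the
  recursion is trivial on the intersection of the chain, hence so is an accumulation point of them;
  that point is continuous and thus trivial on some base subgroup \<open>M\<close>, and compactness
  puts a member of the chain inside the product of \<open>M\<close> with the intersection. This last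
  claim needs countably many stages to be bounded by a later one, which is why the recursion runs
  along \<omega>1 and not along \<omega>. The same bound carries the claim from the factors to the
  product, where only countably many coordinates of \<open>M\<close> are restricted.\<close>

lemma hom_circleD:
  assumes "f \<in> hom H circle_group"
  shows "a \<in> carrier H \<Longrightarrow> b \<in> carrier H \<Longrightarrow> f (a \<otimes>\<^bsub>H\<^esub> b) = f a * f b"
    and "a \<in> carrier H \<Longrightarrow> norm (f a) = 1"
  using assms by (auto simp: hom_def circle_group_def)

lemma hom_circleI:
  assumes "\<And>a b. a \<in> carrier H \<Longrightarrow> b \<in> carrier H \<Longrightarrow> f (a \<otimes>\<^bsub>H\<^esub> b) = f a * f b"
    and "\<And>a. a \<in> carrier H \<Longrightarrow> norm (f a) = 1"
  shows "f \<in> hom H circle_group"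
  using assms by (auto simp: hom_def circle_group_def)

lemma hom_circle_mult:
  assumes "f \<in> hom H circle_group" "g \<in> hom H circle_group"
  shows "(\<lambda>h. f h * g h) \<in> hom H circle_group"
  by (rule hom_circleI) (use assms in \<open>simp_all add: hom_circleD norm_mult\<close>)

lemma hom_circle_cnj:
  assumes "f \<in> hom H circle_group"
  shows "(\<lambda>h. cnj (f h)) \<in> hom H circle_group"
  using assms by (auto simp: hom_def circle_group_def)

lemma hom_circle_prod_power:
  assumes "finite X" "\<And>i. i \<in> X \<Longrightarrow> f i \<in> hom H circle_group"
  shows "(\<lambda>h. \<Prod>i\<in>X. f i h ^ k i) \<in> hom H circle_group"
proof (rule hom_circleI)
  fix a b assume "a \<in> carrier H" "b \<in> carrier H"
  then show "(\<Prod>i\<in>X. f i (a \<otimes>\<^bsub>H\<^esub> b) ^ k i) = (\<Prod>i\<in>X. f i a ^ k i) * (\<Prod>i\<in>X. f i b ^ k i)"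
    using assms by (simp add: hom_circleD power_mult_distrib flip: prod.distrib)
qed (auto simp: hom_circleD(2)[OF assms(2)] norm_power simp flip: prod_norm intro!: prod.neutral)

lemma hom_circle_one:
  assumes "group H" "f \<in> hom H circle_group"
  shows "f \<one>\<^bsub>H\<^esub> = 1"
proof -
  interpret group H by fact
  have "f \<one>\<^bsub>H\<^esub> * f \<one>\<^bsub>H\<^esub> = f \<one>\<^bsub>H\<^esub>" "norm (f \<one>\<^bsub>H\<^esub>) = 1"
    using hom_circleD[OF assms(2)] by (metis one_closed r_one, simp)
  then show ?thesis by auto
qed

lemma hom_circle_pow:
  assumes "group H" "f \<in> hom H circle_group" "a \<in> carrier H"
  shows "f (a [^]\<^bsub>H\<^esub> (n::nat)) = f a ^ n"
proof -
  interpret group H by fact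
  show ?thesis
    by (induction n) (use assms hom_circle_one in \<open>auto simp: hom_circleD\<close>)
qed

lemma hom_circle_inv:
  assumes "group H" "f \<in> hom H circle_group" "a \<in> carrier H"
  shows "f (inv\<^bsub>H\<^esub> a) = inverse (f a)"
proof -
  interpret group H by fact
  have "f (inv\<^bsub>H\<^esub> a) * f a = 1"
    using assms hom_circleD(1)[OF assms(2), of "inv\<^bsub>H\<^esub> a" a] hom_circle_one[OF assms(1,2)] by simp
  then show ?thesis by (metis inverse_unique mult.commute)
qed

lemma hom_circle_int_pow:
  assumes "group H" "f \<in> hom H circle_group" "a \<in> carrier H"
  shows "f (a [^]\<^bsub>H\<^esub> (n::int)) = f a powi n"
proof -
  interpret group H by fact
  show ?thesis
  proof (cases "n \<ge> 0")
    case True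
    then show ?thesis
      using hom_circle_pow[OF assms] by (metis int_nat_eq int_pow_int power_int_of_nat)
  next
    case False
    define m where "m = nat (- n)"
    have "n = - int m" using False by (simp add: m_def)
    then show ?thesis
      using hom_circle_pow[OF assms, of m] hom_circle_inv[OF assms(1,2), of "a [^]\<^bsub>H\<^esub> m"] assms(3)
      by (simp only: int_pow_neg_int power_int_minus power_int_of_nat nat_pow_closed)
  qed
qed

text \<open>The circle has no small subgroups. This is how estimates become equalities: a character
  that stays within distance 1 of 1 on a subgroup is trivial there, and any value other than 1 has a
  power at distance at least 1 from 1.\<close>

lemma unit_circle_no_small_subgroups:
  fixes z :: complex
  assumes "norm z = 1" "\<And>n::nat. norm (z ^ n - 1) < 1"
  shows "z = 1"
proof (rule ccontr)
  assume "z \<noteq> 1"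
  define d where "d = norm (z - 1)"
  have d: "d > 0" using \<open>z \<noteq> 1\<close> d_def by simp
  \<comment> \<open>While Re w > 1/2, squaring multiplies the distance to 1 by norm (w + 1) > 3/2.\<close>
  have "norm (z ^ (2 ^ n) - 1) \<ge> (3/2) ^ n * d" for n :: nat
  proof (induction n)
    case (Suc n)
    define w where "w = z ^ (2 ^ n)"
    have w: "norm w = 1" "norm (w - 1) < 1" using assms by (simp_all add: w_def norm_power)
    have "(norm (w - 1))\<^sup>2 + (norm (w + 1))\<^sup>2 = 4"
    proof -
      have "(norm w)\<^sup>2 = 1" using w by simp
      then show ?thesis
        unfolding cmod_power2 by (simp add: power2_eq_square algebra_simps)
    qed
    moreover have "(norm (w - 1))\<^sup>2 < 1" using w(2) by (simp add: power_less_one_iff abs_square_less_1)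
    ultimately have "(norm (w + 1))\<^sup>2 > (3/2)\<^sup>2" by (simp add: power2_eq_square)
    then have "norm (w + 1) \<ge> 3/2"
      by (metis norm_ge_zero not_less order_less_imp_le power_mono)
    then have "norm (w - 1) * norm (w + 1) \<ge> ((3/2) ^ n * d) * (3/2)"
      using Suc d by (intro mult_mono) (auto simp: w_def)
    moreover have "z ^ (2 ^ Suc n) - 1 = (w - 1) * (w + 1)"
      by (simp add: w_def algebra_simps flip: power_add mult_2)
    ultimately show ?case by (simp add: norm_mult mult_ac)
  qed (simp add: d_def)
  moreover obtain n where "(3/2::real) ^ n > 1 / d"
    using real_arch_pow[of "3/2" "1/d"] by auto
  then have "(3/2) ^ n * d > 1" using d by (simp add: divide_less_eq)
  ultimately show False
    using assms(2)[of "2 ^ n"] by (metis less_le_trans less_asym)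
qed

text \<open>Averages over finite lists of group elements play the role of an invariant mean.\<close>

definition list_mean :: "'h list \<Rightarrow> ('h \<Rightarrow> complex) \<Rightarrow> complex" where
  "list_mean L f = sum_list (map f L) / of_nat (length L)"

lemma list_mean_sum:
  "list_mean L (\<lambda>h. \<Sum>k\<in>K. f k h) = (\<Sum>k\<in>K. list_mean L (f k))"
proof -
  have "sum_list (map (\<lambda>h. \<Sum>k\<in>K. f k h) L) = (\<Sum>k\<in>K. sum_list (map (f k) L))"
    by (induction L) (simp_all add: sum.distrib)
  then show ?thesis by (simp add: list_mean_def sum_divide_distrib)
qed

lemma list_mean_cmult: "list_mean L (\<lambda>h. c * f h) = c * list_mean L f"
  by (simp add: list_mean_def sum_list_const_mult)

lemma list_mean_diff: "list_mean L (\<lambda>h. f h - g h) = list_mean L f - list_mean L g"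
  by (simp add: list_mean_def sum_list_subtractf diff_divide_distrib)

lemma list_mean_cong: "(\<And>h. h \<in> set L \<Longrightarrow> f h = g h) \<Longrightarrow> list_mean L f = list_mean L g"
  by (simp add: list_mean_def cong: map_cong)

lemma list_mean_const: "L \<noteq> [] \<Longrightarrow> list_mean L (\<lambda>h. c) = c"
  by (simp add: list_mean_def sum_list_replicate map_replicate_const)

lemma norm_list_mean_le:
  assumes "L \<noteq> []" "\<And>h. h \<in> set L \<Longrightarrow> norm (f h) \<le> g h"
  shows "norm (list_mean L f) \<le> Re (list_mean L (\<lambda>h. of_real (g h)))"
proof -
  have "norm (sum_list (map f L)) \<le> sum_list (map g L)"
    using assms(2) by (induction L) (auto intro!: norm_triangle_le add_mono)
  moreover have "sum_list (map (\<lambda>h. complex_of_real (g h)) L) = of_real (sum_list (map g L))"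
    by (induction L) auto
  ultimately show ?thesis
    by (simp add: list_mean_def norm_divide divide_right_mono)
qed

lemma norm_list_mean_hom_le_1:
  assumes "f \<in> hom H circle_group" "set L \<subseteq> carrier H"
  shows "norm (list_mean L f) \<le> 1"
proof (cases "L = []")
  case False
  have "norm (list_mean L f) \<le> Re (list_mean L (\<lambda>h. of_real 1))"
    by (rule norm_list_mean_le[OF False]) (use assms hom_circleD(2) in \<open>fastforce\<close>)
  then show ?thesis using False by (simp add: list_mean_const)
qed (simp add: list_mean_def)

text \<open>A character turns the double sum over all products into a product of sums. As means of
  characters have norm at most 1, a mean that is already small stays small when lists are
  multiplied.\<close>

lemma list_mean_hom_product:
  assumes "f \<in> hom H circle_group" "set L \<subseteq> carrier H" "set M \<subseteq> carrier H"
  shows "list_mean (map (\<lambda>(a, b). a \<otimes>\<^bsub>H\<^esub> b) (List.product L M)) f = list_mean L f * list_mean M f"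
proof -
  have aux: "sum_list (map (\<lambda>b. f (a \<otimes>\<^bsub>H\<^esub> b)) M) = f a * sum_list (map f M)" if "a \<in> carrier H" for a
    using assms(3) that by (induction M) (auto simp: hom_circleD[OF assms(1)] algebra_simps)
  have "sum_list (map f (map (\<lambda>(a, b). a \<otimes>\<^bsub>H\<^esub> b) (List.product L M))) = sum_list (map f L) * sum_list (map f M)"
    using assms(2) by (induction L) (auto simp: aux o_def algebra_simps)
  then show ?thesis by (simp add: list_mean_def)
qed

text \<open>A single nontrivial character is averaged out over the powers of an element where its
  value is not 1, since geometric sums stay bounded. Product lists then combine these
  averages.\<close>

lemma list_mean_kills_nontrivial:
  assumes "group H" "finite B" "e > 0"
    and "\<And>b. b \<in> B \<Longrightarrow> b \<in> hom H circle_group \<and> (\<exists>h\<in>carrier H. b h \<noteq> 1)"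
  shows "\<exists>L. L \<noteq> [] \<and> set L \<subseteq> carrier H \<and> (\<forall>b\<in>B. norm (list_mean L b) \<le> e)"
  using assms(2,4)
proof (induction B rule: finite_induct)
  case empty
  interpret group H by fact
  show ?case by (rule exI[of _ "[\<one>\<^bsub>H\<^esub>]"]) auto
next
  case (insert b B)
  interpret group H by fact
  obtain L where L: "L \<noteq> []" "set L \<subseteq> carrier H" "\<forall>b\<in>B. norm (list_mean L b) \<le> e"
    using insert by auto
  obtain h where b: "b \<in> hom H circle_group" and h: "h \<in> carrier H" "b h \<noteq> 1"
    using insert.prems by auto
  \<comment> \<open>The numerator \<open>1 - b h ^ n\<close> of the geometric sum has norm at most
    2, so this \<open>n\<close> brings the mean of \<open>b\<close> down to
    \<open>e\<close>.\<close>
  obtain n :: nat where n: "real n > 2 / (norm (1 - b h) * e)" using reals_Archimedean2 by blast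
  have pos: "norm (1 - b h) * e > 0" using h \<open>e > 0\<close> by simp
  then have n0: "n > 0" using n \<open>e > 0\<close> by (cases n) (auto simp: divide_less_0_iff mult_less_0_iff)
  define M where "M = map (\<lambda>k. h [^]\<^bsub>H\<^esub> k) [0..<n]"
  have M: "M \<noteq> []" "set M \<subseteq> carrier H" using n0 h by (auto simp: M_def)
  have "list_mean M b = (\<Sum>k<n. b h ^ k) / of_nat n"
    using hom_circle_pow[OF assms(1) b h(1)]
    by (simp add: M_def list_mean_def o_def interv_sum_list_conv_sum_set_nat atLeast0LessThan)
  also have "\<dots> = (1 - b h ^ n) / ((1 - b h) * of_nat n)"
    using h by (simp add: sum_gp_strict)
  finally have "norm (list_mean M b) = norm (1 - b h ^ n) / (norm (1 - b h) * n)"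
    by (simp add: norm_divide norm_mult)
  also have "\<dots> \<le> 2 / (norm (1 - b h) * n)"
  proof (rule divide_right_mono)
    have "norm (b h ^ n) = 1" using hom_circleD(2)[OF b h(1)] by (simp add: norm_power)
    then show "norm (1 - b h ^ n) \<le> 2" using norm_triangle_ineq4[of 1 "b h ^ n"] by simp
  qed simp
  also have "\<dots> \<le> e" using n pos n0 h by (simp add: field_simps)
  finally have Mb: "norm (list_mean M b) \<le> e" .
  let ?P = "map (\<lambda>(a, b). a \<otimes>\<^bsub>H\<^esub> b) (List.product L M)"
  have "norm (list_mean ?P c) \<le> e" if c: "c \<in> insert b B" for c
  proof -
    have chom: "c \<in> hom H circle_group" using insert.prems c by auto
    have "norm (list_mean ?P c) = norm (list_mean L c) * norm (list_mean M c)"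
      by (simp add: list_mean_hom_product[OF chom L(2) M(2)] norm_mult)
    also have "\<dots> \<le> e"
    proof (cases "c = b")
      case True
      have "norm (list_mean L c) * norm (list_mean M c) \<le> 1 * e"
        by (intro mult_mono) (use True Mb norm_list_mean_hom_le_1[OF chom L(2)] in auto)
      then show ?thesis by simp
    next
      case False
      have "norm (list_mean L c) * norm (list_mean M c) \<le> e * 1"
        by (intro mult_mono) (use False c L \<open>e > 0\<close> norm_list_mean_hom_le_1[OF chom M(2)] in auto)
      then show ?thesis by simp
    qed
    finally show ?thesis .
  qed
  moreover have "?P \<noteq> []" using L M by (cases L; cases M) auto
  moreover have "set ?P \<subseteq> carrier H" using L M by auto
  ultimately show ?case by blast
qed

section \<open>The Comfort--Ross theorem\<close>

text \<open>Writing \<open>r = exp (- c)\<close> compares a power with the exponential at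
  \<open>c * (real N + 1)\<close>. The limit supplies an exponent for which the decay of the kernel
  below beats the polynomial lower bound for its mean.\<close>

lemma poly_times_geometric_tendsto_0:
  fixes r :: real
  assumes "0 < r" "r < 1"
  shows "(\<lambda>N. (real N + 1) ^ n * r ^ N) \<longlonglongrightarrow> 0"
proof -
  define c where "c = - ln r"
  have c: "c > 0" using assms by (simp add: c_def)
  have "filterlim (\<lambda>N::nat. c * (real N + 1)) at_top sequentially"
    using c filterlim_tendsto_pos_mult_at_top[OF tendsto_const, of c]
      filterlim_tendsto_add_at_top[OF tendsto_const filterlim_real_sequentially, of 1]
    by (auto simp: add.commute)
  with tendsto_power_div_exp_0[of n]
  have "(\<lambda>N::nat. (c * (real N + 1)) ^ n / exp (c * (real N + 1))) \<longlonglongrightarrow> 0"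
    by (rule filterlim_compose)
  \<comment> \<open>The constant cancels \<open>c ^ n\<close> and the one surplus factor
    \<open>r\<close> caused by \<open>N + 1\<close> in the exponent.\<close>
  then have "(\<lambda>N::nat. (1 / (c ^ n * r)) * ((c * (real N + 1)) ^ n / exp (c * (real N + 1)))) \<longlonglongrightarrow> 0"
    by (rule tendsto_mult_right_zero)
  moreover have "(1 / (c ^ n * r)) * ((c * (real N + 1)) ^ n / exp (c * (real N + 1))) = (real N + 1) ^ n * r ^ N" for N
  proof -
    have "exp (c * (real N + 1)) = inverse (r ^ Suc N)"
      using exp_of_nat_mult[of "Suc N" c] assms
      by (simp add: c_def exp_minus power_inverse algebra_simps)
    moreover have "r * (inverse r * inverse (r ^ N)) = inverse (r ^ N)" using assms by simp
    ultimately show ?thesis using c assms by (simp add: power_mult_distrib divide_inverse) (simp add: field_simps)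
  qed
  ultimately show ?thesis by simp
qed

text \<open>Comfort--Ross: the Fejer-type kernel \<open>norm (\<Prod>i. ((1 + f i h) / 2) ^ N) ^ 2\<close> has mean at least
  \<open>1 / (N + 1) ^ card X\<close> but is exponentially small unless all \<open>f i h\<close> are close to 1. If \<open>\<psi>\<close> were not a
  product of powers of the \<open>f i\<close>, multiplying the kernel by \<open>cnj \<psi>\<close> would annihilate its mean, although
  \<open>\<psi>\<close> is close to 1 where the kernel is concentrated.\<close>

theorem character_dominated_by_finitely_many:
  fixes f :: "'i \<Rightarrow> 'h \<Rightarrow> complex"
  assumes H: "group H" and X: "finite X"
    and f: "\<And>i. i \<in> X \<Longrightarrow> f i \<in> hom H circle_group" and \<psi>: "\<psi> \<in> hom H circle_group" and "e > 0"
    and close: "\<And>h. h \<in> carrier H \<Longrightarrow> (\<forall>i\<in>X. norm (f i h - 1) < e) \<Longrightarrow> norm (\<psi> h - 1) \<le> 1 / 2"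
  shows "\<exists>k::'i \<Rightarrow> int. \<forall>h\<in>carrier H. \<psi> h = (\<Prod>i\<in>X. f i h powi k i)"
proof (rule ccontr)
  assume no: "\<nexists>k::'i \<Rightarrow> int. \<forall>h\<in>carrier H. \<psi> h = (\<Prod>i\<in>X. f i h powi k i)"
  interpret group H by fact
  define n where "n = card X"
  define d where "d = min e 1"
  \<comment> \<open>On the unit circle \<open>(norm ((1 + z) / 2))\<^sup>2 = 1 - (norm (z -
    1))\<^sup>2 / 4\<close>, so a single \<open>f i h\<close> at distance at least \<open>d\<close>
    from 1 forces the kernel down to at most \<open>\<rho> ^ N\<close>. Cutting \<open>d\<close> off
    at 1 keeps \<open>\<rho>\<close> positive.\<close>
  define \<rho> where "\<rho> = 1 - d\<^sup>2 / 4"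
  have d: "0 < d" "d \<le> 1" "d \<le> e" using \<open>e > 0\<close> by (auto simp: d_def)
  then have "d\<^sup>2 \<le> 1" by (simp add: power_le_one)
  with d have \<rho>: "0 < \<rho>" "\<rho> < 1" by (auto simp: \<rho>_def)
  \<comment> \<open>The bound 1/8 is chosen against the final inequality
    \<open>1 / 2 \<le> 4 * ((real N + 1) ^ n * \<rho> ^ N)\<close>.\<close>
  have "eventually (\<lambda>N. (real N + 1) ^ n * \<rho> ^ N < 1 / 8) sequentially"
    using poly_times_geometric_tendsto_0[OF \<rho>] by (rule order_tendstoD) simp
  then obtain N where N: "(real N + 1) ^ n * \<rho> ^ N < 1 / 8"
    by (auto simp: eventually_sequentially)
  \<comment> \<open>By the binomial theorem the product under the norm is a convex combination of
    the characters \<open>a k\<close> with exponents at most \<open>N\<close>. The number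
    \<open>(N + 1) ^ n\<close> of exponent vectors is the source of the polynomial factor.\<close>
  define J where "J = PiE X (\<lambda>_. {..N})"
  have J: "finite J" "card J = (N + 1) ^ n" "J \<noteq> {}"
    using X by (auto simp: J_def n_def card_PiE PiE_eq_empty_iff intro!: finite_PiE)
  define a where "a = (\<lambda>(k::'i \<Rightarrow> nat) h. \<Prod>i\<in>X. f i h ^ k i)"
  define c where "c = (\<lambda>k::'i \<Rightarrow> nat. \<Prod>i\<in>X. real (N choose k i) / 2 ^ N)"
  have c0: "c k \<ge> 0" for k by (auto simp: c_def intro!: prod_nonneg)
  have a: "a k \<in> hom H circle_group" for k
    unfolding a_def by (rule hom_circle_prod_power[OF X f])
  have binom: "((1 + z) / 2) ^ N = (\<Sum>j\<le>N. of_real (real (N choose j) / 2 ^ N) * z ^ j)" for z :: complex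
    using binomial_ring[of z 1 N] by (simp add: power_divide add.commute sum_divide_distrib)
  have expand: "(\<Prod>i\<in>X. ((1 + z i) / 2) ^ N) = (\<Sum>k\<in>J. of_real (c k) * (\<Prod>i\<in>X. z i ^ k i))" for z :: "'i \<Rightarrow> complex"
    unfolding J_def binom by (subst prod_sum_PiE[OF X]) (simp_all add: c_def flip: prod.distrib)
  have "(\<Sum>k\<in>J. complex_of_real (c k)) = 1"
    using expand[of "\<lambda>_. 1"] by simp
  then have c1: "(\<Sum>k\<in>J. c k) = 1"
    by (metis of_real_sum of_real_eq_1_iff)
  define P where "P = (\<lambda>h. (norm (\<Prod>i\<in>X. ((1 + f i h) / 2) ^ N))\<^sup>2)"
  \<comment> \<open>Being a squared modulus, the kernel is a convex combination of the characters
    \<open>a k * cnj (a l)\<close>, whose diagonal terms are constantly 1 on the carrier.\<close>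
  define b where "b = (\<lambda>p h. a (fst p) h * cnj (a (snd p) h))"
  define w where "w = (\<lambda>p. c (fst p) * c (snd p))"
  have w0: "w p \<ge> 0" for p by (simp add: w_def c0)
  have w1: "(\<Sum>p\<in>J \<times> J. w p) = 1"
    using c1 by (simp add: w_def sum.cartesian_product' flip: sum_product)
  have P: "of_real (P h) = (\<Sum>p\<in>J \<times> J. of_real (w p) * b p h)" for h
  proof -
    have "of_real (P h) = (\<Sum>k\<in>J. of_real (c k) * a k h) * cnj (\<Sum>k\<in>J. of_real (c k) * a k h)"
      unfolding P_def expand a_def by (rule complex_norm_square)
    also have "\<dots> = (\<Sum>p\<in>J \<times> J. of_real (w p) * b p h)"
      by (simp add: w_def b_def sum_product sum.cartesian_product' mult_ac)
    finally show ?thesis .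
  qed
  have b: "b p \<in> hom H circle_group" for p
    unfolding b_def by (intro hom_circle_mult hom_circle_cnj a)
  \<comment> \<open>\<open>B1\<close> collects the nontrivial characters in the kernel,
    \<open>B2\<close> all characters in the kernel multiplied by \<open>cnj \<psi>\<close>. By the
    assumption \<open>no\<close> the family \<open>B2\<close> contains no trivial character, so one
    list makes the means of both families small.\<close>
  define B1 where "B1 = {b p |p. p \<in> J \<times> J \<and> (\<exists>h\<in>carrier H. b p h \<noteq> 1)}"
  define B2 where "B2 = {\<lambda>h. b p h * cnj (\<psi> h) |p. p \<in> J \<times> J}"
  have unit: "norm (\<psi> h) = 1" "norm (a k h) = 1" "norm (b p h) = 1" if "h \<in> carrier H" for h k p
    using that hom_circleD(2)[OF \<psi>] hom_circleD(2)[OF a] hom_circleD(2)[OF b] by blast+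
  have B2_nontrivial: "\<exists>h\<in>carrier H. b p h * cnj (\<psi> h) \<noteq> 1" for p
  proof (rule ccontr)
    assume "\<not> ?thesis"
    then have *: "b p h * cnj (\<psi> h) = 1" if "h \<in> carrier H" for h using that by blast
    have "\<psi> h = (\<Prod>i\<in>X. f i h powi (int (fst p i) - int (snd p i)))" if h: "h \<in> carrier H" for h
    proof -
      have "cnj (\<psi> h) * \<psi> h = 1"
        using unit(1)[OF h] by (simp add: complex_norm_square[symmetric] mult.commute)
      then have "\<psi> h = b p h" using *[OF h] by (metis mult.assoc mult.commute mult.right_neutral)
      also have "\<dots> = (\<Prod>i\<in>X. f i h ^ fst p i * cnj (f i h) ^ snd p i)"
        by (simp add: b_def a_def prod.distrib)
      also have "\<dots> = (\<Prod>i\<in>X. f i h powi (int (fst p i) - int (snd p i)))"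
      proof (rule prod.cong)
        fix i assume "i \<in> X"
        then have 1: "norm (f i h) = 1" using hom_circleD(2)[OF f h] by simp
        then have "f i h \<noteq> 0" by auto
        moreover have "cnj (f i h) = inverse (f i h)"
          using 1 by (simp add: inverse_complex_def complex_eq_iff cmod_power2[symmetric])
        ultimately show "f i h ^ fst p i * cnj (f i h) ^ snd p i = f i h powi (int (fst p i) - int (snd p i))"
          by (simp add: power_int_diff power_inverse divide_inverse)
      qed simp
      finally show ?thesis .
    qed
    then show False using no[unfolded not_ex, rule_format, of "\<lambda>i. int (fst p i) - int (snd p i)"] by simp
  qed
  \<comment> \<open>With the factor 6, the term \<open>3 * \<epsilon>\<close> at the end uses up
    exactly half of the lower bound \<open>1 / (real N + 1) ^ n\<close>.\<close>
  define \<epsilon> where "\<epsilon> = 1 / (6 * (real N + 1) ^ n)"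
  have \<epsilon>: "\<epsilon> > 0" by (simp add: \<epsilon>_def)
  have "finite (B1 \<union> B2)"
  proof -
    have "B1 \<subseteq> b ` (J \<times> J)" "B2 \<subseteq> (\<lambda>p h. b p h * cnj (\<psi> h)) ` (J \<times> J)"
      by (auto simp: B1_def B2_def)
    then show ?thesis using J(1) by (meson finite_SigmaI finite_UnI finite_imageI finite_subset)
  qed
  moreover have "g \<in> hom H circle_group \<and> (\<exists>h\<in>carrier H. g h \<noteq> 1)" if "g \<in> B1 \<union> B2" for g
    using that b B2_nontrivial hom_circle_mult[OF b hom_circle_cnj[OF \<psi>]] unfolding B1_def B2_def by blast
  ultimately obtain L where L: "L \<noteq> []" "set L \<subseteq> carrier H" "\<forall>g\<in>B1 \<union> B2. norm (list_mean L g) \<le> \<epsilon>"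
    using list_mean_kills_nontrivial[OF H _ \<epsilon>] by blast
  define S where "S = list_mean L (\<lambda>h. of_real (P h))"
  define S' where "S' = list_mean L (\<lambda>h. of_real (P h) * cnj (\<psi> h))"
  have "S = (\<Sum>p\<in>J \<times> J. of_real (w p) * list_mean L (b p))"
    by (simp add: S_def P list_mean_sum list_mean_cmult)
  then have "Re S = (\<Sum>p\<in>J \<times> J. w p * Re (list_mean L (b p)))"
    by simp
  \<comment> \<open>Diagonal pairs contribute their full weight. An off-diagonal pair may also give
    the trivial character, which only helps; otherwise its mean costs at most
    \<open>\<epsilon>\<close>.\<close>
  moreover have "\<dots> \<ge> (\<Sum>p\<in>J \<times> J. (if fst p = snd p then w p else 0) - \<epsilon> * w p)"
  proof (rule sum_mono)
    fix p assume p: "p \<in> J \<times> J"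
    have triv: "list_mean L (b p) = 1" if "\<forall>h\<in>carrier H. b p h = 1"
      using list_mean_cong[of L "b p" "\<lambda>_. 1"] that L by (auto simp: list_mean_const)
    have "- \<epsilon> \<le> Re (list_mean L (b p))"
    proof (cases "\<forall>h\<in>carrier H. b p h = 1")
      case True
      then show ?thesis using triv \<epsilon> by simp
    next
      case False
      then have "b p \<in> B1" using p by (auto simp: B1_def)
      then have "norm (list_mean L (b p)) \<le> \<epsilon>" using L by blast
      then show ?thesis using abs_Re_le_cmod[of "list_mean L (b p)"] by linarith
    qed
    moreover have "Re (list_mean L (b p)) = 1" if "fst p = snd p"
    proof -
      have "b p h = 1" if "h \<in> carrier H" for h
        using unit(2)[OF that] \<open>fst p = snd p\<close> by (simp add: b_def complex_norm_square[symmetric])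
      then show ?thesis using triv by simp
    qed
    ultimately show "(if fst p = snd p then w p else 0) - \<epsilon> * w p \<le> w p * Re (list_mean L (b p))"
      using w0[of p] \<epsilon> mult_left_mono[of "- \<epsilon>" "Re (list_mean L (b p))" "w p"] by (auto simp: mult.commute)
  qed
  moreover have "(\<Sum>p\<in>J \<times> J. (if fst p = snd p then w p else 0) - \<epsilon> * w p) = (\<Sum>k\<in>J. (c k)\<^sup>2) - \<epsilon>"
  proof -
    have "(\<Sum>p\<in>J \<times> J. (if fst p = snd p then w p else 0)) = (\<Sum>k\<in>J. \<Sum>l\<in>J. if k = l then c k * c l else 0)"
      unfolding w_def sum.cartesian_product' by (simp cong: if_cong)
    also have "\<dots> = (\<Sum>k\<in>J. (c k)\<^sup>2)"
      using J(1) by (simp add: power2_eq_square)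
    finally show ?thesis using w1 by (simp add: sum_subtractf flip: sum_distrib_left)
  qed
  \<comment> \<open>This is Cauchy--Schwarz for \<open>(N + 1) ^ n\<close> weights of total
    1.\<close>
  moreover have "(\<Sum>k\<in>J. (c k)\<^sup>2) \<ge> 1 / (real N + 1) ^ n"
    using sum_squared_le_sum_of_squares[of c J] c1 J by (simp add: divide_le_eq add.commute)
  ultimately have lower: "Re S \<ge> 1 / (real N + 1) ^ n - \<epsilon>" by linarith
  have "S' = (\<Sum>p\<in>J \<times> J. of_real (w p) * list_mean L (\<lambda>h. b p h * cnj (\<psi> h)))"
    by (simp add: S'_def P sum_distrib_right list_mean_sum list_mean_cmult mult.assoc)
  then have "norm S' \<le> (\<Sum>p\<in>J \<times> J. w p * norm (list_mean L (\<lambda>h. b p h * cnj (\<psi> h))))"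
    by (auto intro!: order_trans[OF norm_sum] simp: norm_mult abs_of_nonneg[OF w0])
  also have "\<dots> \<le> (\<Sum>p\<in>J \<times> J. w p * \<epsilon>)"
    using L(3) by (intro sum_mono mult_left_mono w0) (auto simp: B2_def)
  also have "\<dots> = \<epsilon>" using w1 by (simp flip: sum_distrib_right)
  finally have S': "norm S' \<le> \<epsilon>" .
  \<comment> \<open>Where all \<open>f i h\<close> are near 1, the factor
    \<open>1 - cnj (\<psi> h)\<close> has norm at most 1/2; elsewhere its norm is at most 2 and the
    kernel is at most \<open>\<rho> ^ N\<close>. The sum of the two bounds covers both
    cases.\<close>
  have "norm (S - S') = norm (list_mean L (\<lambda>h. of_real (P h) * (1 - cnj (\<psi> h))))"
    by (simp add: S_def S'_def algebra_simps flip: list_mean_diff)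
  also have "\<dots> \<le> Re (list_mean L (\<lambda>h. of_real (P h / 2 + 2 * \<rho> ^ N)))"
  proof (rule norm_list_mean_le[OF L(1)])
    fix h assume "h \<in> set L"
    then have h: "h \<in> carrier H" using L by auto
    have P0: "P h \<ge> 0" by (simp add: P_def)
    have norm\<psi>: "norm (1 - cnj (\<psi> h)) = norm (\<psi> h - 1)"
      by (metis complex_cnj_diff complex_cnj_one complex_mod_cnj norm_minus_commute)
    define u where "u = (\<lambda>i. (norm ((1 + f i h) / 2))\<^sup>2)"
    have Pu: "P h = (\<Prod>i\<in>X. u i) ^ N"
      by (simp add: P_def u_def norm_power flip: prod_norm prod_power_distrib power_mult add: mult.commute)
    have u: "u i = 1 - (norm (f i h - 1))\<^sup>2 / 4" if "i \<in> X" for i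
    proof -
      have "(norm (f i h))\<^sup>2 = 1" using hom_circleD(2)[OF f[OF that] h] by simp
      then show ?thesis
        unfolding u_def norm_divide power_divide cmod_power2 by (simp add: power2_eq_square algebra_simps) (simp add: field_simps)
    qed
    show "norm (of_real (P h) * (1 - cnj (\<psi> h))) \<le> P h / 2 + 2 * \<rho> ^ N"
    proof (cases "\<forall>i\<in>X. norm (f i h - 1) < e")
      case True
      then have "norm (\<psi> h - 1) \<le> 1 / 2" using close h by blast
      then have "P h * norm (\<psi> h - 1) \<le> P h * (1 / 2)" using P0 by (rule mult_left_mono)
      then show ?thesis using \<rho> P0 by (simp add: norm_mult norm\<psi> add_increasing2)
    next
      case False
      then obtain i where i: "i \<in> X" "norm (f i h - 1) \<ge> e" by force
      have u01: "0 \<le> u j \<and> u j \<le> 1" if "j \<in> X" for j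
      proof
        show "0 \<le> u j" by (simp add: u_def)
        show "u j \<le> 1" by (simp add: u[OF that])
      qed
      have "(\<Prod>j\<in>X. u j) = u i * (\<Prod>j\<in>X - {i}. u j)" using i X by (simp add: prod.remove)
      also have "\<dots> \<le> u i * 1"
        using u01 i by (intro mult_left_mono prod_le_1) auto
      also have "u i \<le> \<rho>"
        using i d by (simp add: u \<rho>_def power_mono)
      finally have "(\<Prod>j\<in>X. u j) \<le> \<rho>" by simp
      moreover have "0 \<le> (\<Prod>j\<in>X. u j)" using u01 by (intro prod_nonneg) auto
      ultimately have "P h \<le> \<rho> ^ N" unfolding Pu by (rule power_mono)
      moreover have "norm (\<psi> h - 1) \<le> 2"
        using norm_triangle_ineq4[of "\<psi> h" 1] unit(1)[OF h] by simp
      ultimately have "P h * norm (\<psi> h - 1) \<le> \<rho> ^ N * 2"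
        using \<rho> by (intro mult_mono) auto
      then show ?thesis using P0 by (simp add: norm_mult norm\<psi>)
    qed
  qed
  also have "\<dots> = Re S / 2 + 2 * \<rho> ^ N"
  proof -
    have "list_mean L (\<lambda>h. of_real (P h / 2 + 2 * \<rho> ^ N)) = list_mean L (\<lambda>h. (1/2) * of_real (P h) - (- of_real (2 * \<rho> ^ N)))"
      by (rule list_mean_cong) simp
    also have "\<dots> = (1/2) * S - (- of_real (2 * \<rho> ^ N))"
      unfolding list_mean_diff list_mean_cmult S_def list_mean_const[OF L(1)] ..
    finally show ?thesis by simp
  qed
  finally have "norm S \<le> Re S / 2 + 2 * \<rho> ^ N + \<epsilon>"
    using S' norm_triangle_ineq2[of S S'] by linarith
  then have "Re S \<le> 4 * \<rho> ^ N + 2 * \<epsilon>"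
    using complex_Re_le_cmod[of S] by linarith
  with lower have "1 / (real N + 1) ^ n \<le> 4 * \<rho> ^ N + 3 * \<epsilon>" by linarith
  then have "1 / 2 \<le> 4 * ((real N + 1) ^ n * \<rho> ^ N)"
    by (simp add: \<epsilon>_def field_simps)
  with N show False by linarith
qed

section \<open>Separation of points by characters\<close>

text \<open>The last condition makes the subgroup \<open>R\<close> of the product the graph of a function.\<close>

definition partial_character :: "('a, 'b) monoid_scheme \<Rightarrow> ('a \<times> complex) set \<Rightarrow> bool" where
  "partial_character G R \<longleftrightarrow>
     R \<subseteq> carrier G \<times> sphere 0 1 \<and> (\<one>\<^bsub>G\<^esub>, 1) \<in> R \<and>
     (\<forall>x z y w. (x, z) \<in> R \<longrightarrow> (y, w) \<in> R \<longrightarrow> (x \<otimes>\<^bsub>G\<^esub> y, z * w) \<in> R) \<and>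
     (\<forall>x z. (x, z) \<in> R \<longrightarrow> (inv\<^bsub>G\<^esub> x, inverse z) \<in> R) \<and>
     (\<forall>z. (\<one>\<^bsub>G\<^esub>, z) \<in> R \<longrightarrow> z = 1)"

text \<open>The angle \<open>Arg w + 2 * pi\<close> lies above \<open>pi\<close> and is at most
  \<open>3 * pi\<close>, so dividing it by \<open>m \<ge> 2\<close> lands strictly between 0 and
  \<open>2 * pi\<close>. The principal angle would give the root 1 when
  \<open>w = 1\<close>.\<close>

lemma unit_circle_root_neq_1:
  fixes w :: complex
  assumes "norm w = 1" "m \<ge> (2::nat)"
  obtains z where "norm z = 1" "z ^ m = w" "z \<noteq> 1"
proof
  define t where "t = (Arg w + 2 * pi) / real m"
  show "norm (cis t) = 1" by simp
  have "real m * t = Arg w + 2 * pi" using assms(2) by (simp add: t_def)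
  then have "cis t ^ m = cis (Arg w + 2 * pi)" by (simp add: Complex.DeMoivre)
  also have "\<dots> = w" using assms(1) rcis_cmod_Arg[of w] by (simp add: rcis_def flip: cis_mult)
  finally show "cis t ^ m = w" .
  have t: "0 < t" "t < 2 * pi"
  proof -
    have *: "pi < Arg w + 2 * pi" "Arg w + 2 * pi \<le> 3 * pi" using Arg_bounded[of w] by auto
    then show "0 < t" using assms(2) pi_gt_zero by (simp add: t_def)
    have "3 * pi < 2 * pi * 2" by simp
    also have "2 * pi * 2 \<le> 2 * pi * real m" using assms(2) by (intro mult_left_mono) auto
    finally have "Arg w + 2 * pi < 2 * pi * real m" using * by linarith
    then show "t < 2 * pi" using assms(2) by (simp add: t_def divide_less_eq)
  qed
  show "cis t \<noteq> 1"
  proof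
    assume "cis t = 1"
    then have "cos t = 1" by (metis cis.sel(1) one_complex.sel(1))
    then obtain j :: int where j: "t = real_of_int j * 2 * pi" using cos_one_2pi_int by auto
    then have "0 < real_of_int j" "real_of_int j < 1"
      using t pi_gt_zero by (simp_all add: zero_less_mult_iff)
    then show False by simp
  qed
qed

text \<open>A value \<open>z\<close> at \<open>g\<close> is consistent precisely when
  \<open>z powi k = v\<close> whenever \<open>g [^] k\<close> already has the value
  \<open>v\<close>. The exponents in question are multiples of the least positive one, if there is
  one; it is at least 2 because \<open>g\<close> lies outside the domain, and this leaves a root
  \<open>z \<noteq> 1\<close>. Without a positive exponent any \<open>z\<close> works, and
  \<open>-1\<close> is taken.\<close>

lemma (in comm_group) partial_character_extend:
  assumes R: "partial_character G R" and g: "g \<in> carrier G" and "g \<notin> Domain R"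
  shows "\<exists>R' z. partial_character G R' \<and> R \<subseteq> R' \<and> (g, z) \<in> R' \<and> z \<noteq> 1"
proof -
  have Rsub: "x \<in> carrier G" "norm z = 1" if "(x, z) \<in> R" for x z
    using R that by (auto simp: partial_character_def)
  have R1: "(\<one>, 1) \<in> R" and Rm: "\<And>x z y w. (x, z) \<in> R \<Longrightarrow> (y, w) \<in> R \<Longrightarrow> (x \<otimes> y, z * w) \<in> R"
    and Ri: "\<And>x z. (x, z) \<in> R \<Longrightarrow> (inv x, inverse z) \<in> R"
    and Rf: "\<And>z. (\<one>, z) \<in> R \<Longrightarrow> z = 1"
    using R by (auto simp: partial_character_def)
  have Rnat: "(x [^] n, z ^ n) \<in> R" if "(x, z) \<in> R" for x z and n :: nat
  proof (induction n)
    case (Suc n)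
    then show ?case using Rm[OF Suc that] by (simp add: mult.commute)
  qed (simp add: R1)
  have Rint: "(x [^] k, z powi k) \<in> R" if "(x, z) \<in> R" for x z and k :: int
  proof (cases k)
    case (nonneg n)
    then show ?thesis using Rnat[OF that, of n] by (simp add: int_pow_int)
  next
    case (neg n)
    then show ?thesis
      using Ri[OF Rnat[OF that, of "Suc n"]] Rsub(1)[OF that]
      by (simp only: int_pow_neg_int power_int_minus power_int_of_nat)
  qed
  have negI: "g [^] (- k) \<in> Domain R" if "g [^] k \<in> Domain R" for k :: int
  proof -
    from that obtain v where "(g [^] k, v) \<in> R" by auto
    then show ?thesis using Ri g by (force simp: int_pow_neg)
  qed
  have "\<exists>z. norm z = 1 \<and> z \<noteq> 1 \<and> (\<forall>k::int. \<forall>v. (g [^] k, v) \<in> R \<longrightarrow> v = z powi k)"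
  proof (cases "\<exists>n::nat. n > 0 \<and> g [^] n \<in> Domain R")
    case False
    have "k = 0" if "g [^] k \<in> Domain R" for k :: int
    proof (rule ccontr)
      assume "k \<noteq> 0"
      have "\<exists>n::nat. n > 0 \<and> g [^] n \<in> Domain R"
      proof (cases k)
        case (nonneg n)
        then have "g [^] n \<in> Domain R" using that by (simp only: int_pow_int)
        then show ?thesis using nonneg \<open>k \<noteq> 0\<close> by auto
      next
        case (neg n)
        then have "g [^] Suc n \<in> Domain R"
          using negI[OF that]
          by (simp only: minus_minus int_pow_int)
        then show ?thesis by blast
      qed
      with False show False by blast
    qed
    then have "v = (- 1) powi k" if "(g [^] k, v) \<in> R" for v and k :: int
      using that Rf by fastforce
    then show ?thesis by (intro exI[of _ "-1"]) auto
  next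
    case True
    define m where "m = (LEAST n::nat. n > 0 \<and> g [^] n \<in> Domain R)"
    have m: "m > 0" "g [^] m \<in> Domain R" using LeastI_ex[OF True] by (auto simp: m_def)
    have least: "n \<ge> m" if "n > 0" "g [^] n \<in> Domain R" for n :: nat
      using Least_le[of "\<lambda>n::nat. n > 0 \<and> g [^] n \<in> Domain R" n] that by (simp add: m_def)
    have "m \<noteq> 1" using m(2) \<open>g \<notin> Domain R\<close> g by auto
    then have "m \<ge> 2" using m(1) by linarith
    from m(2) obtain w where w: "(g [^] m, w) \<in> R" by auto
    obtain z where z: "norm z = 1" "z ^ m = w" "z \<noteq> 1"
      using unit_circle_root_neq_1[OF Rsub(2)[OF w] \<open>m \<ge> 2\<close>] by blast
    have "v = z powi k" if kv: "(g [^] k, v) \<in> R" for v and k :: int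
    proof -
      define q where "q = k div int m"
      define r where "r = nat (k mod int m)"
      have k: "k = int m * q + int r" and r: "r < m" using m(1) by (simp_all add: q_def r_def nat_less_iff)
      have z0: "z \<noteq> 0" using z(1) by auto
      have gm: "g [^] (int m * (- q)) = (g [^] m) [^] (- q)"
        using g by (simp add: int_pow_pow flip: int_pow_int)
      have "(g [^] k \<otimes> (g [^] m) [^] (- q), v * w powi (- q)) \<in> R"
        by (rule Rm[OF kv Rint[OF w]])
      moreover have "g [^] k \<otimes> (g [^] m) [^] (- q) = g [^] r"
      proof -
        have "g [^] k \<otimes> (g [^] m) [^] (- q) = g [^] (k + int m * (- q))"
          unfolding gm[symmetric] using g by (simp only: int_pow_mult)
        also have "k + int m * (- q) = int r" using k by simp
        finally show ?thesis by (simp only: int_pow_int)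
      qed
      ultimately have *: "(g [^] r, v * w powi (- q)) \<in> R" by simp
      have "r = 0"
      proof (rule ccontr)
        assume "r \<noteq> 0"
        then show False using least[of r] * r by auto
      qed
      with * have "v * w powi (- q) = 1" using Rf by simp
      then have "v = w powi q" using Rsub(2)[OF w] by (simp add: power_int_minus field_simps)
      then show ?thesis using k \<open>r = 0\<close> z(2) by (simp add: power_int_mult)
    qed
    then show ?thesis using z by blast
  qed
  then obtain z where z: "norm z = 1" "z \<noteq> 1" and gz: "\<And>k::int. \<And>v. (g [^] k, v) \<in> R \<Longrightarrow> v = z powi k"
    by blast
  have z0: "z \<noteq> 0" using z by auto
  define R' where "R' = {(x \<otimes> g [^] k, y * z powi k) |x y (k::int). (x, y) \<in> R}"
  have R'I: "(x \<otimes> g [^] k, y * z powi k) \<in> R'" if "(x, y) \<in> R" for x y and k :: int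
    using that by (auto simp: R'_def)
  have R'E: "\<exists>x y. \<exists>k::int. (x, y) \<in> R \<and> u = x \<otimes> g [^] k \<and> v = y * z powi k" if "(u, v) \<in> R'" for u v
    using that by (auto simp: R'_def)
  have "partial_character G R'"
    unfolding partial_character_def
  proof (intro conjI allI impI)
    show "R' \<subseteq> carrier G \<times> sphere 0 1"
      using Rsub z g by (auto simp: R'_def norm_mult norm_power_int)
    show "(\<one>, 1) \<in> R'" using R'I[OF R1, of 0] by simp
  next
    fix u v u' v' assume "(u, v) \<in> R'" "(u', v') \<in> R'"
    then obtain x y x' y' and k k' :: int where *: "(x, y) \<in> R" "(x', y') \<in> R"
      "u = x \<otimes> g [^] k" "v = y * z powi k" "u' = x' \<otimes> g [^] k'" "v' = y' * z powi k'"
      using R'E by meson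
    have "u \<otimes> u' = (x \<otimes> x') \<otimes> g [^] (k + k')"
      using * Rsub g by (simp add: int_pow_mult m_ac)
    moreover have "v * v' = (y * y') * z powi (k + k')"
      using * z0 by (simp add: power_int_add)
    ultimately show "(u \<otimes> u', v * v') \<in> R'" using R'I[OF Rm[OF *(1,2)]] by simp
  next
    fix u v assume "(u, v) \<in> R'"
    then obtain x y and k :: int where *: "(x, y) \<in> R" "u = x \<otimes> g [^] k" "v = y * z powi k"
      using R'E by meson
    have "inv u = inv x \<otimes> g [^] (- k)" using * Rsub g by (simp add: int_pow_neg inv_mult)
    moreover have "inverse v = inverse y * z powi (- k)" using * by (simp add: power_int_minus)
    ultimately show "(inv u, inverse v) \<in> R'" using R'I[OF Ri[OF *(1)]] by simp
  next
    fix v assume "(\<one>, v) \<in> R'"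
    then obtain x y and k :: int where *: "(x, y) \<in> R" "\<one> = x \<otimes> g [^] k" "v = y * z powi k"
      using R'E by meson
    have "g [^] k = inv x" using *(2) Rsub(1)[OF *(1)] g inv_equality[of "g [^] k" x] m_comm[of x "g [^] k"] by simp
    then have "inverse y = z powi k" using Ri[OF *(1)] gz by simp
    moreover have "y \<noteq> 0" using Rsub(2)[OF *(1)] by auto
    ultimately show "v = 1" using *(3) by (metis right_inverse)
  qed
  moreover have "R \<subseteq> R'" using R'I[of _ _ 0] Rsub by auto
  moreover have "(g, z) \<in> R'" using R'I[OF R1, of 1] g by simp
  ultimately show ?thesis using z(2) by blast
qed

text \<open>The value at \<open>x\<close> is settled before Zorn's lemma is applied: one extension
  of the trivial character on \<open>N\<close> reaches \<open>x\<close> with a value other than 1,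
  and every larger partial character inherits it. A maximal one is defined everywhere because the
  extension step is always available.\<close>

theorem (in comm_group) separating_character:
  assumes N: "subgroup N G" and x: "x \<in> carrier G" "x \<notin> N"
  obtains \<phi> where "\<phi> \<in> hom G circle_group" "\<And>n. n \<in> N \<Longrightarrow> \<phi> n = 1" "\<phi> x \<noteq> 1"
proof -
  interpret N: subgroup N G by fact
  have "partial_character G (N \<times> {1})"
    using N.subset by (auto simp: partial_character_def)
  then obtain R z where R: "partial_character G R" "N \<times> {1} \<subseteq> R" "(x, z) \<in> R" "z \<noteq> 1"
    using partial_character_extend[of "N \<times> {1}" x] x by auto
  define \<A> where "\<A> = {S. partial_character G S \<and> R \<subseteq> S}"
  have "\<exists>M\<in>\<A>. \<forall>S\<in>\<A>. M \<subseteq> S \<longrightarrow> S = M"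
  proof (rule subset_Zorn_nonempty)
    show "\<A> \<noteq> {}" using R by (auto simp: \<A>_def)
    fix \<C> assume \<C>: "\<C> \<noteq> {}" "subset.chain \<A> \<C>"
    then have pc: "partial_character G S" "R \<subseteq> S" if "S \<in> \<C>" for S
      using that by (auto simp: \<A>_def subset.chain_def)
    have two: "\<exists>S\<in>\<C>. p \<in> S \<and> q \<in> S" if "p \<in> \<Union>\<C>" "q \<in> \<Union>\<C>" for p q
      using that \<C>(2) by (meson UnionE subsetD subset_chain_def)
    have "partial_character G (\<Union>\<C>)"
      unfolding partial_character_def
    proof (intro conjI allI impI)
      show "\<Union>\<C> \<subseteq> carrier G \<times> sphere 0 1"
        using pc(1) unfolding partial_character_def by blast
      show "(\<one>, 1) \<in> \<Union>\<C>" using \<C>(1) pc(1) unfolding partial_character_def by blast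
    next
      fix u v u' v' assume "(u, v) \<in> \<Union>\<C>" "(u', v') \<in> \<Union>\<C>"
      then obtain S where "S \<in> \<C>" "(u, v) \<in> S" "(u', v') \<in> S" using two by blast
      then show "(u \<otimes> u', v * v') \<in> \<Union>\<C>" using pc(1) unfolding partial_character_def by blast
    next
      fix u v assume "(u, v) \<in> \<Union>\<C>"
      then show "(inv u, inverse v) \<in> \<Union>\<C>" using pc(1) unfolding partial_character_def by blast
    next
      fix v assume "(\<one>, v) \<in> \<Union>\<C>"
      then show "v = 1" using pc(1) unfolding partial_character_def by blast
    qed
    then show "\<Union>\<C> \<in> \<A>" using pc(2) \<C>(1) by (auto simp: \<A>_def)
  qed
  then obtain M where M\<A>: "M \<in> \<A>" "\<forall>S\<in>\<A>. M \<subseteq> S \<longrightarrow> S = M" by (rule bexE)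
  then have M: "partial_character G M" "R \<subseteq> M" by (simp_all add: \<A>_def)
  have max: "S = M" if "partial_character G S" "M \<subseteq> S" for S
    using that M\<A>(2) M(2) by (simp add: \<A>_def)
  have dom: "g \<in> Domain M" if g: "g \<in> carrier G" for g
  proof (rule ccontr)
    assume "g \<notin> Domain M"
    then obtain S z where "partial_character G S" "M \<subseteq> S" "(g, z) \<in> S"
      using partial_character_extend[OF M(1) g] by blast
    then show False using max \<open>g \<notin> Domain M\<close> by blast
  qed
  have sub: "y \<in> carrier G" "norm v = 1" if "(y, v) \<in> M" for y v
    using M that by (auto simp: partial_character_def)
  have uniq: "v = v'" if "(y, v) \<in> M" "(y, v') \<in> M" for y v v'
  proof -
    have "(y \<otimes> inv y, v * inverse v') \<in> M" using that M(1) unfolding partial_character_def by blast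
    then have "v * inverse v' = 1" using sub(1)[OF that(1)] M(1) by (simp add: partial_character_def)
    moreover have "v' \<noteq> 0" using sub(2)[OF that(2)] by auto
    ultimately show ?thesis by (simp add: field_simps)
  qed
  define \<phi> where "\<phi> = (\<lambda>y. THE v. (y, v) \<in> M)"
  have eq: "\<phi> y = v" if "(y, v) \<in> M" for y v
    unfolding \<phi>_def using that uniq by blast
  have in_M: "(y, \<phi> y) \<in> M" if "y \<in> carrier G" for y
    using dom[OF that] eq by auto
  have "\<phi> \<in> hom G circle_group"
  proof (rule hom_circleI)
    fix a b assume "a \<in> carrier G" "b \<in> carrier G"
    then have "(a \<otimes> b, \<phi> a * \<phi> b) \<in> M" using in_M M(1) unfolding partial_character_def by blast
    then show "\<phi> (a \<otimes> b) = \<phi> a * \<phi> b" by (rule eq)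
  qed (use in_M sub in blast)
  moreover have "\<phi> n = 1" if "n \<in> N" for n
    by (rule eq) (use that R M in blast)
  moreover have "\<phi> x \<noteq> 1" using eq[of x z] R M by blast
  ultimately show thesis using that by blast
qed

section \<open>Groups with a base of open subgroups\<close>

text \<open>The duality argument is isolated from products here. Lower bounds are asked for instead
  of closure under countable intersections, since a countable intersection of boxes is only seen to
  contain a box; \<open>separated\<close> is the Hausdorff axiom for a base of subgroups.\<close>

locale linear_P_group = comm_group G for G :: "'a monoid" (structure) +
  fixes T :: "'a topology" and \<N> :: "'a set set"
  assumes base_subgroup: "N \<in> \<N> \<Longrightarrow> subgroup N G"
    and openin_iff: "openin T U \<longleftrightarrow> U \<subseteq> carrier G \<and> (\<forall>x\<in>U. \<exists>N\<in>\<N>. \<forall>h\<in>N. x \<otimes> h \<in> U)"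
    and countable_lower: "\<lbrakk>countable \<A>; \<A> \<subseteq> \<N>\<rbrakk> \<Longrightarrow> \<exists>N\<in>\<N>. \<forall>M\<in>\<A>. N \<subseteq> M"
    and separated: "\<lbrakk>x \<in> carrier G; \<And>N. N \<in> \<N> \<Longrightarrow> x \<in> N\<rbrakk> \<Longrightarrow> x = \<one>"
begin

section \<open>The topology given by the base subgroups\<close>

lemma base_mem:
  assumes "N \<in> \<N>"
  shows "N \<subseteq> carrier G" "\<one> \<in> N" "x \<in> N \<Longrightarrow> y \<in> N \<Longrightarrow> x \<otimes> y \<in> N" "x \<in> N \<Longrightarrow> inv x \<in> N"
  using base_subgroup[OF assms] by (auto dest: subgroup.subset subgroup.one_closed subgroup.m_closed subgroup.m_inv_closed)

lemma base_lower2: "\<lbrakk>M \<in> \<N>; N \<in> \<N>\<rbrakk> \<Longrightarrow> \<exists>K\<in>\<N>. K \<subseteq> M \<and> K \<subseteq> N"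
  using countable_lower[of "{M, N}"] by auto

lemma topspace_carrier: "topspace T = carrier G"
proof (rule antisym)
  show "topspace T \<subseteq> carrier G" using openin_iff[of "topspace T"] by simp
  obtain N where "N \<in> \<N>" using countable_lower[of "{}"] by auto
  then have "openin T (carrier G)" unfolding openin_iff using base_mem(1) by blast
  then show "carrier G \<subseteq> topspace T" by (rule openin_subset)
qed

definition coset :: "'a \<Rightarrow> 'a set \<Rightarrow> 'a set" where
  "coset x N = {y \<in> carrier G. inv x \<otimes> y \<in> N}"

lemma openin_coset:
  assumes "N \<in> \<N>" "x \<in> carrier G"
  shows "openin T (coset x N)"
  unfolding openin_iff
proof (intro conjI ballI bexI)
  fix y h assume "y \<in> coset x N" "h \<in> N"
  then have "y \<in> carrier G" "h \<in> carrier G" "(inv x \<otimes> y) \<otimes> h \<in> N"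
    using base_mem[OF assms(1)] by (auto simp: coset_def)
  then show "y \<otimes> h \<in> coset x N" using assms(2) by (simp add: coset_def m_assoc)
qed (use assms in \<open>auto simp: coset_def\<close>)

lemma mem_coset_self: "\<lbrakk>N \<in> \<N>; x \<in> carrier G\<rbrakk> \<Longrightarrow> x \<in> coset x N"
  by (simp add: coset_def base_mem)

lemma coset_eq_mult:
  assumes "N \<in> \<N>" "x \<in> carrier G" "y \<in> coset x N"
  obtains h where "h \<in> N" "y = x \<otimes> h"
proof
  show "inv x \<otimes> y \<in> N" using assms(3) by (simp add: coset_def)
  show "y = x \<otimes> (inv x \<otimes> y)" using assms by (simp add: coset_def flip: m_assoc)
qed

lemma Hausdorff: "Hausdorff_space T"
  unfolding Hausdorff_space_def topspace_carrier
proof (intro allI impI)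
  fix x y assume *: "x \<in> carrier G \<and> y \<in> carrier G \<and> x \<noteq> y"
  then have "inv x \<otimes> y \<noteq> \<one>" by (metis inv_closed inv_equality inv_inv)
  then obtain N where N: "N \<in> \<N>" "inv x \<otimes> y \<notin> N" using separated[of "inv x \<otimes> y"] * by auto
  have "z \<notin> coset y N" if "z \<in> coset x N" for z
  proof
    assume "z \<in> coset y N"
    then have z: "z \<in> carrier G" "inv x \<otimes> z \<in> N" "inv (inv y \<otimes> z) \<in> N"
      using that base_mem[OF N(1)] by (auto simp: coset_def)
    then have "(inv x \<otimes> z) \<otimes> inv (inv y \<otimes> z) \<in> N" using base_mem[OF N(1)] by blast
    moreover have "(inv x \<otimes> z) \<otimes> inv (inv y \<otimes> z) = inv x \<otimes> y"
      using * z(1) by (simp add: inv_mult_group m_assoc) (simp flip: m_assoc)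
    ultimately show False using N(2) by simp
  qed
  then show "\<exists>U V. openin T U \<and> openin T V \<and> x \<in> U \<and> y \<in> V \<and> disjnt U V"
    using openin_coset[OF N(1)] mem_coset_self[OF N(1)] * by (metis disjnt_iff)
qed

lemma topological_abelian_group: "topological_abelian_group G T"
  unfolding topological_abelian_group_def topological_group_def
proof (intro conjI Hausdorff topspace_carrier)
  show "continuous_map (prod_topology T T) T (\<lambda>(x, y). x \<otimes> y)"
    unfolding continuous_map_def
  proof (intro conjI allI impI)
    show "(\<lambda>(x, y). x \<otimes> y) \<in> topspace (prod_topology T T) \<rightarrow> topspace T"
      by (auto simp: topspace_carrier)
    fix U assume U: "openin T U"
    show "openin (prod_topology T T) {p \<in> topspace (prod_topology T T). (case p of (x, y) \<Rightarrow> x \<otimes> y) \<in> U}"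
      unfolding openin_prod_topology_alt
    proof (intro allI impI)
      fix x y assume "(x, y) \<in> {p \<in> topspace (prod_topology T T). (case p of (x, y) \<Rightarrow> x \<otimes> y) \<in> U}"
      then have xy: "x \<in> carrier G" "y \<in> carrier G" "x \<otimes> y \<in> U" by (auto simp: topspace_carrier)
      then obtain N where N: "N \<in> \<N>" "\<forall>h\<in>N. (x \<otimes> y) \<otimes> h \<in> U" using U openin_iff by meson
      have "a \<otimes> b \<in> U" if ab: "a \<in> coset x N" "b \<in> coset y N" for a b
      proof -
        obtain h k where hk: "h \<in> N" "a = x \<otimes> h" "k \<in> N" "b = y \<otimes> k"
          using coset_eq_mult[OF N(1) xy(1) ab(1)] coset_eq_mult[OF N(1) xy(2) ab(2)] by metis
        moreover have "h \<in> carrier G" "k \<in> carrier G" using hk base_mem[OF N(1)] by auto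
        ultimately have "a \<otimes> b = (x \<otimes> y) \<otimes> (h \<otimes> k)" using xy by (simp add: m_ac)
        then show ?thesis using N(2) hk base_mem[OF N(1)] by simp
      qed
      then have "coset x N \<times> coset y N \<subseteq> {p \<in> topspace (prod_topology T T). (case p of (x, y) \<Rightarrow> x \<otimes> y) \<in> U}"
        by (auto simp: topspace_carrier coset_def)
      then show "\<exists>V W. openin T V \<and> openin T W \<and> x \<in> V \<and> y \<in> W \<and>
          V \<times> W \<subseteq> {p \<in> topspace (prod_topology T T). (case p of (x, y) \<Rightarrow> x \<otimes> y) \<in> U}"
        using openin_coset[OF N(1)] mem_coset_self[OF N(1)] xy(1,2) by blast
    qed
  qed
  show "continuous_map T T (\<lambda>x. inv x)"
    unfolding continuous_map_def
  proof (intro conjI allI impI)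
    show "(\<lambda>x. inv x) \<in> topspace T \<rightarrow> topspace T" by (auto simp: topspace_carrier)
    fix U assume U: "openin T U"
    show "openin T {x \<in> topspace T. inv x \<in> U}"
      unfolding openin_iff topspace_carrier
    proof (intro conjI ballI)
      fix x assume "x \<in> {x \<in> carrier G. inv x \<in> U}"
      then have x: "x \<in> carrier G" "inv x \<in> U" by auto
      then obtain N where N: "N \<in> \<N>" "\<forall>h\<in>N. inv x \<otimes> h \<in> U" using U openin_iff by meson
      have "x \<otimes> h \<in> {x \<in> carrier G. inv x \<in> U}" if "h \<in> N" for h
        using base_mem[OF N(1)] N(2) x that by (auto simp: inv_mult)
      then show "\<exists>N\<in>\<N>. \<forall>h\<in>N. x \<otimes> h \<in> {x \<in> carrier G. inv x \<in> U}" using N(1) by blast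
    qed auto
  qed
qed (rule is_group, rule comm_group_axioms)

text \<open>An infinite set contains a sequence, whose countably many quotients are kept away from
  the identity by a single base subgroup \<open>N\<close>. Each coset of \<open>N\<close> then holds
  at most one term, so finitely many cosets cannot cover the sequence.\<close>

lemma compactin_imp_finite:
  assumes "compactin T K"
  shows "finite K"
proof (rule ccontr)
  assume "infinite K"
  then obtain f :: "nat \<Rightarrow> 'a" where f: "inj f" "range f \<subseteq> K"
    using infinite_countable_subset by blast
  have K: "K \<subseteq> carrier G" using assms compactin_subset_topspace topspace_carrier by blast
  then have fc: "f i \<in> carrier G" for i using f by blast
  have "\<exists>N\<in>\<N>. inv (f i) \<otimes> f j \<notin> N" if "i \<noteq> j" for i j
  proof -
    have "f i \<noteq> f j" using f(1) that by (simp add: inj_eq)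
    then have "inv (f i) \<otimes> f j \<noteq> \<one>" using fc by (metis inv_closed inv_equality inv_inv)
    then show ?thesis using separated[of "inv (f i) \<otimes> f j"] fc by auto
  qed
  then obtain S where S: "\<And>i j. i \<noteq> j \<Longrightarrow> S i j \<in> \<N> \<and> inv (f i) \<otimes> f j \<notin> S i j" by metis
  have "countable {S i j |i j. i \<noteq> j}"
  proof -
    have "{S i j |i j. i \<noteq> j} \<subseteq> (\<lambda>(i, j). S i j) ` UNIV" by auto
    then show ?thesis by (rule countable_subset) simp
  qed
  moreover have "{S i j |i j. i \<noteq> j} \<subseteq> \<N>" using S by blast
  ultimately have "\<exists>N\<in>\<N>. \<forall>M\<in>{S i j |i j. i \<noteq> j}. N \<subseteq> M" by (rule countable_lower)
  then obtain N where N: "N \<in> \<N>" "\<And>i j. i \<noteq> j \<Longrightarrow> N \<subseteq> S i j" by blast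
  have "\<And>U. U \<in> (\<lambda>x. coset x N) ` K \<Longrightarrow> openin T U" "K \<subseteq> \<Union>((\<lambda>x. coset x N) ` K)"
    using openin_coset[OF N(1)] mem_coset_self[OF N(1)] K by auto
  from compactinD[OF assms this]
  have "\<exists>\<F>. finite \<F> \<and> \<F> \<subseteq> (\<lambda>x. coset x N) ` K \<and> K \<subseteq> \<Union>\<F>" by blast
  then obtain F where F: "finite F" "F \<subseteq> K" "K \<subseteq> (\<Union>x\<in>F. coset x N)"
    by (metis finite_subset_image)
  have "\<forall>i. \<exists>x\<in>F. f i \<in> coset x N" using F(3) f(2) by blast
  then obtain g where g: "\<And>i. g i \<in> F \<and> f i \<in> coset (g i) N" by metis
  have "\<not> inj g" using F(1) g by (metis finite_subset image_subsetI infinite_UNIV_nat finite_imageD)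
  then obtain i j where ij: "i \<noteq> j" "g i = g j" by (auto simp: inj_def)
  let ?x = "g i"
  have x: "?x \<in> carrier G" using g F K by blast
  have "inv (inv ?x \<otimes> f i) \<otimes> (inv ?x \<otimes> f j) \<in> N"
    using g[of i] g[of j] ij base_mem[OF N(1)] by (auto simp: coset_def)
  moreover have "inv (inv ?x \<otimes> f i) \<otimes> (inv ?x \<otimes> f j) = inv (f i) \<otimes> f j"
    using x fc by (simp add: inv_mult_group m_assoc) (simp flip: m_assoc)
  ultimately show False using N(2)[OF ij(1)] S[OF ij(1)] by auto
qed

text \<open>Near the identity the values stay within distance 1 of 1; on a base subgroup they form a
  subgroup of the circle and hence are all 1. Continuous characters are therefore those that factor
  through a discrete quotient, the converse being \<open>trivial_on_base_character\<close>.\<close>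

lemma character_trivial_on_base:
  assumes "\<phi> \<in> characters G T"
  shows "\<exists>N\<in>\<N>. \<forall>n\<in>N. \<phi> n = 1"
proof -
  have \<phi>: "\<phi> \<in> hom G circle_group" "continuous_map T (top_of_set (sphere 0 1)) \<phi>"
    using assms by (auto simp: characters_def)
  have "openin (top_of_set (sphere 0 1)) (sphere 0 1 \<inter> ball (1::complex) 1)"
    by (simp add: openin_open_Int)
  then have "openin T {x \<in> carrier G. \<phi> x \<in> sphere 0 1 \<inter> ball 1 1}"
    using openin_continuous_map_preimage[OF \<phi>(2)] topspace_carrier by metis
  moreover have "\<one> \<in> {x \<in> carrier G. \<phi> x \<in> sphere 0 1 \<inter> ball 1 1}"
    using hom_circle_one[OF is_group \<phi>(1)] by simp
  ultimately obtain N where N: "N \<in> \<N>" "\<forall>h\<in>N. \<one> \<otimes> h \<in> {x \<in> carrier G. \<phi> x \<in> sphere 0 1 \<inter> ball 1 1}"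
    unfolding openin_iff by meson
  have "\<phi> n = 1" if n: "n \<in> N" for n
  proof (rule unit_circle_no_small_subgroups)
    have nc: "n \<in> carrier G" using base_mem[OF N(1)] n by blast
    show "norm (\<phi> n) = 1" using hom_circleD(2)[OF \<phi>(1) nc] .
    fix k :: nat
    have "n [^] k \<in> N" using n base_mem[OF N(1)] by (induction k) auto
    then have "\<phi> (n [^] k) \<in> ball 1 1" using N(2) base_mem(1)[OF N(1)] by force
    then show "norm (\<phi> n ^ k - 1) < 1"
      by (simp add: hom_circle_pow[OF is_group \<phi>(1) nc] dist_norm norm_minus_commute)
  qed
  then show ?thesis using N(1) by blast
qed

text \<open>The preimage of any set whatsoever is a union of cosets of \<open>N\<close>. Purely
  algebraic constructions thus produce continuous characters.\<close>

lemma trivial_on_base_character: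
  assumes "\<phi> \<in> extensional (carrier G)" "\<phi> \<in> hom G circle_group" "N \<in> \<N>" "\<And>n. n \<in> N \<Longrightarrow> \<phi> n = 1"
  shows "\<phi> \<in> characters G T"
proof -
  have "continuous_map T (top_of_set (sphere 0 1)) \<phi>"
    unfolding continuous_map_def
  proof (intro conjI allI impI)
    show "\<phi> \<in> topspace T \<rightarrow> topspace (top_of_set (sphere 0 1))"
      using hom_circleD(2)[OF assms(2)] by (auto simp: topspace_carrier)
    fix U
    have "\<phi> (x \<otimes> h) = \<phi> x" "x \<otimes> h \<in> carrier G" if "x \<in> carrier G" "h \<in> N" for x h
      using that base_mem(1)[OF assms(3)] assms(4) hom_circleD(1)[OF assms(2)] by auto
    then have "\<forall>h\<in>N. x \<otimes> h \<in> {x \<in> carrier G. \<phi> x \<in> U}" if "x \<in> {x \<in> carrier G. \<phi> x \<in> U}" for x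
      using that by simp
    then show "openin T {x \<in> topspace T. \<phi> x \<in> U}"
      unfolding openin_iff topspace_carrier using assms(3) by blast
  qed
  then show ?thesis using assms by (simp add: characters_def)
qed

lemma character_hom: "\<phi> \<in> characters G T \<Longrightarrow> \<phi> \<in> hom G circle_group"
  by (simp add: characters_def)

lemma character_mult_inv:
  assumes "\<phi> \<in> characters G T" "\<psi> \<in> characters G T"
  shows "(\<lambda>x\<in>carrier G. \<phi> x * \<psi> x) \<in> characters G T"
    and "(\<lambda>x\<in>carrier G. cnj (\<phi> x)) \<in> characters G T"
proof -
  obtain M where M: "M \<in> \<N>" "\<And>n. n \<in> M \<Longrightarrow> \<phi> n = 1" using character_trivial_on_base[OF assms(1)] by blast
  obtain N where N: "N \<in> \<N>" "\<And>n. n \<in> N \<Longrightarrow> \<psi> n = 1" using character_trivial_on_base[OF assms(2)] by blast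
  obtain K where K: "K \<in> \<N>" "K \<subseteq> M" "K \<subseteq> N" using base_lower2[OF M(1) N(1)] by blast
  note \<phi> = character_hom[OF assms(1)] and \<psi> = character_hom[OF assms(2)]
  show "(\<lambda>x\<in>carrier G. \<phi> x * \<psi> x) \<in> characters G T"
  proof (rule trivial_on_base_character[OF _ _ K(1)])
    show "(\<lambda>x\<in>carrier G. \<phi> x * \<psi> x) \<in> hom G circle_group"
      by (rule hom_circleI) (simp_all add: hom_circleD[OF \<phi>] hom_circleD[OF \<psi>] norm_mult)
    fix n assume "n \<in> K"
    then show "(\<lambda>x\<in>carrier G. \<phi> x * \<psi> x) n = 1" using K(2,3) M(2) N(2) base_mem(1)[OF K(1)] by (simp add: subset_iff)
  qed simp
  show "(\<lambda>x\<in>carrier G. cnj (\<phi> x)) \<in> characters G T"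
  proof (rule trivial_on_base_character[OF _ _ M(1)])
    show "(\<lambda>x\<in>carrier G. cnj (\<phi> x)) \<in> hom G circle_group"
      by (rule hom_circleI) (simp_all add: hom_circleD[OF \<phi>])
    fix n assume "n \<in> M"
    then show "(\<lambda>x\<in>carrier G. cnj (\<phi> x)) n = 1" using M base_mem(1)[OF M(1)] by auto
  qed simp
qed

section \<open>The dual group and the evaluation map\<close>

lemma carrier_dual [simp]: "carrier (dual_group G T) = characters G T"
  by (simp add: dual_group_def)

lemma one_character: "(\<lambda>x\<in>carrier G. 1) \<in> characters G T"
proof -
  obtain N where N: "N \<in> \<N>" using countable_lower[of "{}"] by auto
  show ?thesis
  proof (rule trivial_on_base_character[OF _ _ N])
    show "(\<lambda>x\<in>carrier G. 1) \<in> hom G circle_group" by (rule hom_circleI) auto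
    show "(\<lambda>x\<in>carrier G. 1) n = 1" if "n \<in> N" for n using that base_mem(1)[OF N] by auto
  qed simp
qed

lemma group_dual: "group (dual_group G T)"
proof (rule groupI)
  fix \<phi> \<psi> \<eta> assume "\<phi> \<in> carrier (dual_group G T)" "\<psi> \<in> carrier (dual_group G T)" "\<eta> \<in> carrier (dual_group G T)"
  then have *: "\<phi> \<in> characters G T" "\<psi> \<in> characters G T" "\<eta> \<in> characters G T" by auto
  show "\<phi> \<otimes>\<^bsub>dual_group G T\<^esub> \<psi> \<in> carrier (dual_group G T)"
    using character_mult_inv(1)[OF *(1,2)] by (simp add: dual_group_def)
  show "\<phi> \<otimes>\<^bsub>dual_group G T\<^esub> \<psi> \<otimes>\<^bsub>dual_group G T\<^esub> \<eta> = \<phi> \<otimes>\<^bsub>dual_group G T\<^esub> (\<psi> \<otimes>\<^bsub>dual_group G T\<^esub> \<eta>)"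
    by (auto simp: dual_group_def)
  have ext: "\<phi> \<in> extensional (carrier G)" using *(1) by (simp add: characters_def)
  show "\<one>\<^bsub>dual_group G T\<^esub> \<otimes>\<^bsub>dual_group G T\<^esub> \<phi> = \<phi>"
    using ext by (auto simp: dual_group_def extensional_def restrict_def)
  have "cnj (\<phi> x) * \<phi> x = 1" if "x \<in> carrier G" for x
    using hom_circleD(2)[OF character_hom[OF *(1)] that] complex_norm_square[of "\<phi> x"] by (simp add: mult.commute)
  then show "\<exists>\<psi>\<in>carrier (dual_group G T). \<psi> \<otimes>\<^bsub>dual_group G T\<^esub> \<phi> = \<one>\<^bsub>dual_group G T\<^esub>"
    by (intro bexI[of _ "\<lambda>x\<in>carrier G. cnj (\<phi> x)"])
       (use character_mult_inv(2)[OF *(1,1)] in \<open>auto simp: dual_group_def cong: restrict_cong\<close>)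
next
  show "\<one>\<^bsub>dual_group G T\<^esub> \<in> carrier (dual_group G T)" using one_character by (simp add: dual_group_def)
qed

lemma separating_continuous_character:
  assumes "N \<in> \<N>" "x \<in> carrier G" "x \<notin> N"
  obtains \<phi> where "\<phi> \<in> characters G T" "\<And>n. n \<in> N \<Longrightarrow> \<phi> n = 1" "\<phi> x \<noteq> 1"
proof -
  obtain \<phi> where \<phi>: "\<phi> \<in> hom G circle_group" "\<And>n. n \<in> N \<Longrightarrow> \<phi> n = 1" "\<phi> x \<noteq> 1"
    using separating_character[OF base_subgroup[OF assms(1)] assms(2,3)] by blast
  let ?\<phi> = "restrict \<phi> (carrier G)"
  have N: "N \<subseteq> carrier G" using base_mem(1)[OF assms(1)] .
  have triv: "?\<phi> n = 1" if "n \<in> N" for n using that N \<phi>(2) by auto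
  have "?\<phi> \<in> characters G T"
  proof (rule trivial_on_base_character[OF restrict_extensional _ assms(1) triv])
    show "?\<phi> \<in> hom G circle_group" by (rule hom_circleI) (simp_all add: hom_circleD[OF \<phi>(1)])
  qed auto
  then show thesis using that triv \<phi>(3) assms(2) by auto
qed

lemma evaluation_apply: "\<phi> \<in> characters G T \<Longrightarrow> evaluation G T x \<phi> = \<phi> x"
  by (simp add: evaluation_def)

lemma evaluation_character:
  assumes x: "x \<in> carrier G"
  shows "evaluation G T x \<in> characters (dual_group G T) (dual_topology G T)"
proof -
  have "evaluation G T x \<in> hom (dual_group G T) circle_group"
  proof (rule hom_circleI)
    fix \<phi> \<psi> assume *: "\<phi> \<in> carrier (dual_group G T)" "\<psi> \<in> carrier (dual_group G T)"
    then have "\<phi> \<otimes>\<^bsub>dual_group G T\<^esub> \<psi> \<in> characters G T" using group_dual by (metis carrier_dual group.is_monoid monoid.m_closed)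
    then show "evaluation G T x (\<phi> \<otimes>\<^bsub>dual_group G T\<^esub> \<psi>) = evaluation G T x \<phi> * evaluation G T x \<psi>"
      using * x by (simp add: evaluation_apply) (simp add: dual_group_def)
  next
    fix \<phi> assume "\<phi> \<in> carrier (dual_group G T)"
    then show "norm (evaluation G T x \<phi>) = 1"
      using x by (simp add: evaluation_apply hom_circleD(2)[OF character_hom])
  qed
  moreover have "continuous_map (dual_topology G T) (top_of_set (sphere 0 1)) (evaluation G T x)"
    unfolding continuous_map_def
  proof (intro conjI allI impI)
    show "evaluation G T x \<in> topspace (dual_topology G T) \<rightarrow> topspace (top_of_set (sphere 0 1))"
      using x by (auto simp: topspace_dual_topology evaluation_apply hom_circleD(2)[OF character_hom])
    fix U :: "complex set" assume "openin (top_of_set (sphere 0 1)) U"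
    then obtain V where V: "open V" "U = sphere 0 1 \<inter> V" by (auto simp: openin_open)
    show "openin (dual_topology G T) {\<phi> \<in> topspace (dual_topology G T). evaluation G T x \<phi> \<in> U}"
      unfolding openin_dual_topology topspace_dual_topology
    proof (intro conjI ballI)
      fix \<phi> assume "\<phi> \<in> {\<phi> \<in> characters G T. evaluation G T x \<phi> \<in> U}"
      then have "\<phi> x \<in> V" using V by (auto simp: evaluation_apply)
      then obtain e where e: "e > 0" "ball (\<phi> x) e \<subseteq> V" using V(1) open_contains_ball by blast
      have "{\<psi> \<in> characters G T. \<forall>y\<in>{x}. dist (\<psi> y) (\<phi> y) < e} \<subseteq> {\<phi> \<in> characters G T. evaluation G T x \<phi> \<in> U}"
        using e V x by (auto simp: evaluation_apply dist_commute hom_circleD(2)[OF character_hom])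
      moreover have "compactin T {x}" using x by (simp add: topspace_carrier)
      ultimately show "\<exists>K e. compactin T K \<and> 0 < e \<and> {\<psi> \<in> characters G T. \<forall>x\<in>K. dist (\<psi> x) (\<phi> x) < e}
          \<subseteq> {\<phi> \<in> characters G T. evaluation G T x \<phi> \<in> U}" using e(1) by blast
    qed auto
  qed
  moreover have "evaluation G T x \<in> extensional (carrier (dual_group G T))"
    by (simp add: evaluation_def)
  ultimately show ?thesis by (simp add: characters_def)
qed

lemma evaluation_mult:
  assumes "x \<in> carrier G" "y \<in> carrier G"
  shows "evaluation G T (x \<otimes> y) = evaluation G T x \<otimes>\<^bsub>bidual_group G T\<^esub> evaluation G T y"
proof
  fix \<phi>
  show "evaluation G T (x \<otimes> y) \<phi> = (evaluation G T x \<otimes>\<^bsub>bidual_group G T\<^esub> evaluation G T y) \<phi>"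
    using assms hom_circleD(1)[OF character_hom, of \<phi> x y]
    by (cases "\<phi> \<in> characters G T") (simp_all add: evaluation_def dual_group_def[of "dual_group G T"])
qed

lemma evaluation_inj: "inj_on (evaluation G T) (carrier G)"
proof (rule inj_onI, rule ccontr)
  fix x y assume *: "x \<in> carrier G" "y \<in> carrier G" "evaluation G T x = evaluation G T y" "x \<noteq> y"
  then have "inv x \<otimes> y \<noteq> \<one>" by (metis inv_closed inv_equality inv_inv)
  then obtain N where N: "N \<in> \<N>" "inv x \<otimes> y \<notin> N" using separated[of "inv x \<otimes> y"] * by auto
  then obtain \<phi> where \<phi>: "\<phi> \<in> characters G T" "\<phi> (inv x \<otimes> y) \<noteq> 1"
    using separating_continuous_character[of N "inv x \<otimes> y"] * by auto
  have "\<phi> x = \<phi> y" using *(3) \<phi>(1) by (metis evaluation_apply)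
  moreover have "\<phi> (inv x \<otimes> y) = inverse (\<phi> x) * \<phi> y"
    using * by (simp add: hom_circleD(1)[OF character_hom[OF \<phi>(1)]] hom_circle_inv[OF is_group character_hom[OF \<phi>(1)]])
  moreover have "\<phi> y \<noteq> 0" using hom_circleD(2)[OF character_hom[OF \<phi>(1)] *(2)] by auto
  ultimately show False using \<phi>(2) by simp
qed

text \<open>Continuity at the trivial character controls \<open>\<psi>\<close> by the values of
  characters on a compact, hence finite, set \<open>K\<close>. With the dual group as
  \<open>H\<close> and the points of \<open>K\<close> acting on it as characters, Comfort--Ross
  writes \<open>\<psi>\<close> as a product of powers of evaluations, which is the evaluation at one
  group element.\<close>

lemma evaluation_surj:
  assumes "\<psi> \<in> characters (dual_group G T) (dual_topology G T)"
  shows "\<exists>x\<in>carrier G. \<psi> = evaluation G T x"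
proof -
  let ?H = "dual_group G T"
  have \<psi>: "\<psi> \<in> hom ?H circle_group" "continuous_map (dual_topology G T) (top_of_set (sphere 0 1)) \<psi>"
    "\<psi> \<in> extensional (characters G T)"
    using assms by (auto simp: characters_def[of ?H])
  have one: "\<one>\<^bsub>?H\<^esub> = (\<lambda>x\<in>carrier G. 1)" by (simp add: dual_group_def)
  \<comment> \<open>The radius 1/2 is the tolerance in
    \<open>character_dominated_by_finitely_many\<close>.\<close>
  have "openin (top_of_set (sphere 0 1)) (sphere 0 1 \<inter> ball (1::complex) (1/2))"
    by (simp add: openin_open_Int)
  then have "openin (dual_topology G T) {\<phi> \<in> characters G T. \<psi> \<phi> \<in> sphere 0 1 \<inter> ball 1 (1/2)}"
    using openin_continuous_map_preimage[OF \<psi>(2)] topspace_dual_topology by metis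
  moreover have "\<one>\<^bsub>?H\<^esub> \<in> {\<phi> \<in> characters G T. \<psi> \<phi> \<in> sphere 0 1 \<inter> ball 1 (1/2)}"
    using hom_circle_one[OF group_dual \<psi>(1)] one_character one by simp
  ultimately obtain K e where K: "compactin T K" "e > 0"
    "{\<phi> \<in> characters G T. \<forall>x\<in>K. dist (\<phi> x) (\<one>\<^bsub>?H\<^esub> x) < e} \<subseteq> {\<phi> \<in> characters G T. \<psi> \<phi> \<in> sphere 0 1 \<inter> ball 1 (1/2)}"
    unfolding openin_dual_topology by meson
  have Kc: "K \<subseteq> carrier G" using K(1) compactin_subset_topspace topspace_carrier by blast
  have "\<exists>k::'a \<Rightarrow> int. \<forall>\<phi>\<in>carrier ?H. \<psi> \<phi> = (\<Prod>x\<in>K. \<phi> x powi k x)"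
  proof (rule character_dominated_by_finitely_many[OF group_dual compactin_imp_finite[OF K(1)] _ \<psi>(1) K(2)])
    fix x assume x: "x \<in> K"
    show "(\<lambda>\<phi>. \<phi> x) \<in> hom ?H circle_group"
    proof (rule hom_circleI)
      show "norm (\<phi> x) = 1" if "\<phi> \<in> carrier ?H" for \<phi>
        using that x Kc by (simp add: hom_circleD(2)[OF character_hom] subset_iff)
    qed (use x Kc in \<open>auto simp: dual_group_def\<close>)
  next
    fix \<phi> assume \<phi>: "\<phi> \<in> carrier ?H" "\<forall>x\<in>K. norm (\<phi> x - 1) < e"
    then have "\<phi> \<in> {\<phi> \<in> characters G T. \<forall>x\<in>K. dist (\<phi> x) (\<one>\<^bsub>?H\<^esub> x) < e}"
      using Kc by (auto simp: one dist_norm subset_iff)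
    then have "\<psi> \<phi> \<in> ball 1 (1/2)" using K(3) by blast
    then show "norm (\<psi> \<phi> - 1) \<le> 1 / 2" by (simp add: dist_norm norm_minus_commute)
  qed
  then obtain k :: "'a \<Rightarrow> int" where k: "\<And>\<phi>. \<phi> \<in> characters G T \<Longrightarrow> \<psi> \<phi> = (\<Prod>x\<in>K. \<phi> x powi k x)"
    by auto
  define g where "g = finprod G (\<lambda>x. x [^] k x) K"
  have g: "g \<in> carrier G" unfolding g_def using Kc by (intro finprod_closed) auto
  have "\<phi> g = (\<Prod>x\<in>K. \<phi> x powi k x)" if \<phi>: "\<phi> \<in> characters G T" for \<phi>
    unfolding g_def using compactin_imp_finite[OF K(1)] Kc
  proof (induction K rule: finite_induct)
    case empty
    show ?case using hom_circle_one[OF is_group character_hom[OF \<phi>]] by simp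
  next
    case (insert x K)
    have "finprod G (\<lambda>x. x [^] k x) (insert x K) = x [^] k x \<otimes> finprod G (\<lambda>x. x [^] k x) K"
      by (rule finprod_insert) (use insert in auto)
    moreover have "finprod G (\<lambda>x. x [^] k x) K \<in> carrier G" using insert by (intro finprod_closed) auto
    ultimately show ?case using insert
      by (simp add: hom_circleD(1)[OF character_hom[OF \<phi>]] hom_circle_int_pow[OF is_group character_hom[OF \<phi>]])
  qed
  then have "\<psi> = evaluation G T g"
    using k \<psi>(3) by (auto simp: evaluation_def extensional_def fun_eq_iff)
  with g show ?thesis by blast
qed

text \<open>Multiplicativity and triviality on \<open>N\<close> are closed conditions in a compact
  product of circles, and triviality on \<open>N\<close> already gives continuity. So the
  annihilator is compact in the product topology.\<close>

lemma compactin_annihilator: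
  assumes N: "N \<in> \<N>"
  shows "compactin (dual_topology G T) {\<phi> \<in> characters G T. \<forall>n\<in>N. \<phi> n = 1}" (is "compactin _ ?A")
proof -
  define Z where "Z = product_topology (\<lambda>_. top_of_set (sphere 0 (1::real) :: complex set)) (carrier G)"
  have topZ: "topspace Z = (\<Pi>\<^sub>E x\<in>carrier G. sphere 0 1)" by (simp add: Z_def)
  have cont: "continuous_map Z euclidean (\<lambda>\<phi>. \<phi> x)" if "x \<in> carrier G" for x
  proof -
    have "continuous_map Z (top_of_set (sphere 0 1)) (\<lambda>\<phi>. \<phi> x)"
      unfolding Z_def using that by (intro continuous_map_product_projection)
    then show ?thesis by (rule continuous_map_into_fulltopology)
  qed
  have contm: "continuous_map Z euclidean (\<lambda>\<phi>. \<phi> x * \<phi> y)" if "x \<in> carrier G" "y \<in> carrier G" for x y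
    using cont[OF that(1)] cont[OF that(2)] by (simp add: continuous_map_atin tendsto_mult)
  define \<C> where "\<C> = {{\<phi> \<in> topspace Z. \<phi> (x \<otimes> y) = \<phi> x * \<phi> y} |x y. x \<in> carrier G \<and> y \<in> carrier G}
     \<union> {{\<phi> \<in> topspace Z. \<phi> n = 1} |n. n \<in> N}"
  have Nc: "N \<subseteq> carrier G" using base_mem(1)[OF N] .
  have "closedin Z C" if "C \<in> \<C>" for C
    using that unfolding \<C>_def
  proof (elim UnE CollectE exE conjE)
    fix x y assume *: "C = {\<phi> \<in> topspace Z. \<phi> (x \<otimes> y) = \<phi> x * \<phi> y}" "x \<in> carrier G" "y \<in> carrier G"
    show ?thesis unfolding *(1)
      by (rule closedin_continuous_maps_eq[OF Hausdorff_space_euclidean cont contm]) (use * in auto)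
  next
    fix n assume *: "C = {\<phi> \<in> topspace Z. \<phi> n = 1}" "n \<in> N"
    show ?thesis unfolding *(1)
      by (rule closedin_continuous_maps_eq[OF Hausdorff_space_euclidean cont]) (use * Nc in auto)
  qed
  then have "closedin Z (topspace Z \<inter> \<Inter>\<C>)"
    by (cases "\<C> = {}") (auto intro!: closedin_Int closedin_Inter)
  moreover have "topspace Z \<inter> \<Inter>\<C> = ?A"
  proof (intro equalityI subsetI)
    fix \<phi> assume \<phi>: "\<phi> \<in> topspace Z \<inter> \<Inter>\<C>"
    have 1: "\<phi> (x \<otimes> y) = \<phi> x * \<phi> y" if "x \<in> carrier G" "y \<in> carrier G" for x y
    proof -
      have "{\<phi> \<in> topspace Z. \<phi> (x \<otimes> y) = \<phi> x * \<phi> y} \<in> \<C>" using that unfolding \<C>_def by blast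
      then show ?thesis using \<phi> by blast
    qed
    have 2: "\<phi> n = 1" if "n \<in> N" for n
    proof -
      have "{\<phi> \<in> topspace Z. \<phi> n = 1} \<in> \<C>" using that unfolding \<C>_def by blast
      then show ?thesis using \<phi> by blast
    qed
    have "\<phi> \<in> hom G circle_group"
      by (rule hom_circleI) (use 1 \<phi> in \<open>auto simp: topZ PiE_iff\<close>)
    then show "\<phi> \<in> ?A" using trivial_on_base_character[OF _ _ N 2] 2 \<phi> by (auto simp: topZ PiE_iff)
  next
    fix \<phi> assume "\<phi> \<in> ?A"
    then show "\<phi> \<in> topspace Z \<inter> \<Inter>\<C>"
      by (auto simp: topZ PiE_iff \<C>_def characters_def hom_circleD)
  qed
  moreover have "compact_space Z"
    unfolding Z_def by (simp add: compact_space_product_topology compact_space_subtopology)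
  ultimately have "compactin Z ?A" using closedin_compact_space by metis
  then have "compactin (subtopology Z ?A) ?A" by (simp add: compactin_subtopology)
  \<comment> \<open>Compact sets \<open>K\<close> in the group are finite, so a basic neighbourhood
    of the dual topology restricts only finitely many coordinates.\<close>
  moreover have "continuous_map (subtopology Z ?A) (dual_topology G T) (\<lambda>\<phi>. \<phi>)"
    unfolding continuous_map_def
  proof (intro conjI allI impI)
    show "(\<lambda>\<phi>. \<phi>) \<in> topspace (subtopology Z ?A) \<rightarrow> topspace (dual_topology G T)"
      by (auto simp: topspace_dual_topology)
    fix U assume U: "openin (dual_topology G T) U"
    show "openin (subtopology Z ?A) {\<phi> \<in> topspace (subtopology Z ?A). \<phi> \<in> U}"
    proof (subst openin_subopen, intro ballI)
      fix \<phi> assume "\<phi> \<in> {\<phi> \<in> topspace (subtopology Z ?A). \<phi> \<in> U}"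
      then have \<phi>: "\<phi> \<in> topspace Z" "\<phi> \<in> ?A" "\<phi> \<in> U" by auto
      then obtain K e where K: "compactin T K" "e > 0" "{\<psi> \<in> characters G T. \<forall>x\<in>K. dist (\<psi> x) (\<phi> x) < e} \<subseteq> U"
        using U unfolding openin_dual_topology by meson
      define W where "W = topspace Z \<inter> (\<Inter>x\<in>K. {\<psi> \<in> topspace Z. \<psi> x \<in> ball (\<phi> x) e})"
      have "openin Z W"
      proof -
        have "openin Z {\<psi> \<in> topspace Z. \<psi> x \<in> ball (\<phi> x) e}" if "x \<in> K" for x
        proof (rule openin_continuous_map_preimage[OF cont])
          show "x \<in> carrier G" using that K(1) compactin_subset_topspace topspace_carrier by blast
        qed simp
        then show ?thesis unfolding W_def using compactin_imp_finite[OF K(1)]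
          by (cases "K = {}") (auto intro!: openin_Int openin_Inter)
      qed
      then have "openin (subtopology Z ?A) (W \<inter> ?A)" by (auto simp: openin_subtopology)
      moreover have "\<phi> \<in> W \<inter> ?A" using \<phi> K(2) by (auto simp: W_def)
      moreover have "W \<inter> ?A \<subseteq> {\<phi> \<in> topspace (subtopology Z ?A). \<phi> \<in> U}"
        using K(3) by (auto simp: W_def dist_commute)
      ultimately show "\<exists>V. openin (subtopology Z ?A) V \<and> \<phi> \<in> V \<and> V \<subseteq> {\<phi> \<in> topspace (subtopology Z ?A). \<phi> \<in> U}"
        by blast
    qed
  qed
  ultimately have "compactin (dual_topology G T) ((\<lambda>\<phi>. \<phi>) ` ?A)" by (rule image_compactin)
  then show ?thesis by (simp only: image_ident)
qed

text \<open>If \<open>N\<close> is annihilated by \<open>C\<close>, the values on \<open>C\<close>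
  do not change at all along a coset of \<open>N\<close>, so the whole coset is mapped into the
  neighbourhood tested on \<open>C\<close>.\<close>

theorem reflexive_if_compacts_equicontinuous:
  assumes equi: "\<And>C. compactin (dual_topology G T) C \<Longrightarrow> \<exists>N\<in>\<N>. \<forall>\<phi>\<in>C. \<forall>n\<in>N. \<phi> n = 1"
  shows "reflexive_group G T"
proof -
  let ?ev = "evaluation G T"
  have carrier_bidual: "carrier (bidual_group G T) = characters (dual_group G T) (dual_topology G T)"
    by (simp add: dual_group_def)
  have image: "?ev ` carrier G = characters (dual_group G T) (dual_topology G T)"
    using evaluation_character evaluation_surj by blast
  have iso: "?ev \<in> iso G (bidual_group G T)"
    unfolding iso_def bij_betw_def hom_def
    using evaluation_inj image evaluation_mult evaluation_character by (auto simp: carrier_bidual)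
  have "continuous_map T (bidual_topology G T) ?ev"
    unfolding continuous_map_def
  proof (intro conjI allI impI)
    show "?ev \<in> topspace T \<rightarrow> topspace (bidual_topology G T)"
      using evaluation_character by (auto simp: topspace_dual_topology topspace_carrier)
    fix U assume U: "openin (bidual_topology G T) U"
    show "openin T {x \<in> topspace T. ?ev x \<in> U}"
      unfolding openin_iff topspace_carrier
    proof (intro conjI ballI)
      fix x assume "x \<in> {x \<in> carrier G. ?ev x \<in> U}"
      then have x: "x \<in> carrier G" "?ev x \<in> U" by auto
      then obtain C e where C: "compactin (dual_topology G T) C" "e > 0"
        "{\<psi> \<in> characters (dual_group G T) (dual_topology G T). \<forall>\<phi>\<in>C. dist (\<psi> \<phi>) (?ev x \<phi>) < e} \<subseteq> U"
        using U unfolding openin_dual_topology[of "dual_group G T"] by meson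
      obtain N where N: "N \<in> \<N>" "\<forall>\<phi>\<in>C. \<forall>n\<in>N. \<phi> n = 1" using equi[OF C(1)] by blast
      have "?ev (x \<otimes> h) \<in> U" if h: "h \<in> N" for h
      proof -
        have hc: "h \<in> carrier G" using h base_mem(1)[OF N(1)] by blast
        have "?ev (x \<otimes> h) \<phi> = ?ev x \<phi>" if "\<phi> \<in> C" for \<phi>
        proof -
          have \<phi>: "\<phi> \<in> characters G T"
            using that C(1) compactin_subset_topspace topspace_dual_topology by blast
          then show ?thesis
            using N(2) h that x(1) hc by (simp add: evaluation_apply hom_circleD(1)[OF character_hom[OF \<phi>]])
        qed
        then show ?thesis using C(2,3) evaluation_character[of "x \<otimes> h"] x(1) hc by auto
      qed
      then show "\<exists>N\<in>\<N>. \<forall>h\<in>N. x \<otimes> h \<in> {x \<in> carrier G. ?ev x \<in> U}"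
        using N(1) x(1) base_mem(1)[OF N(1)] by auto
    qed auto
  qed
  moreover have "open_map T (bidual_topology G T) ?ev"
    unfolding open_map_def
  proof (intro allI impI)
    fix U assume U: "openin T U"
    show "openin (bidual_topology G T) (?ev ` U)"
      unfolding openin_dual_topology[of "dual_group G T"]
    proof (intro conjI ballI)
      show "?ev ` U \<subseteq> characters (dual_group G T) (dual_topology G T)"
        using U evaluation_character openin_iff by blast
      fix \<psi> assume "\<psi> \<in> ?ev ` U"
      then obtain x where x: "x \<in> U" "\<psi> = ?ev x" "x \<in> carrier G" using U openin_iff by blast
      then obtain N where N: "N \<in> \<N>" "\<forall>h\<in>N. x \<otimes> h \<in> U" using U openin_iff by meson
      let ?A = "{\<phi> \<in> characters G T. \<forall>n\<in>N. \<phi> n = 1}"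
      have "\<eta> \<in> ?ev ` U" if \<eta>: "\<eta> \<in> characters (dual_group G T) (dual_topology G T)"
        "\<forall>\<phi>\<in>?A. dist (\<eta> \<phi>) (\<psi> \<phi>) < 1" for \<eta>
      proof -
        obtain y where y: "y \<in> carrier G" "\<eta> = ?ev y" using evaluation_surj[OF \<eta>(1)] by blast
        define z where "z = inv x \<otimes> y"
        have z: "z \<in> carrier G" using x y by (simp add: z_def)
        have "z \<in> N"
        proof (rule ccontr)
          assume "z \<notin> N"
          then obtain \<phi> where \<phi>: "\<phi> \<in> characters G T" "\<And>n. n \<in> N \<Longrightarrow> \<phi> n = 1" "\<phi> z \<noteq> 1"
            using separating_continuous_character[OF N(1) z] by blast
          have hom: "\<phi> \<in> hom G circle_group" using character_hom[OF \<phi>(1)] .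
          \<comment> \<open>The annihilator is closed under powers, so closeness on it applies to
            all powers of \<open>\<phi>\<close> at once and forces \<open>\<phi> z = 1\<close>. This
            is why the fixed radius 1 suffices.\<close>
          have "norm (\<phi> z ^ k - 1) < 1" for k :: nat
          proof -
            let ?\<phi>k = "\<lambda>x\<in>carrier G. \<phi> x ^ k"
            have triv: "?\<phi>k n = 1" if "n \<in> N" for n
              using that \<phi>(2) base_mem(1)[OF N(1)] by auto
            have homk: "?\<phi>k \<in> hom G circle_group"
              by (rule hom_circleI) (simp_all add: hom_circleD[OF hom] norm_power power_mult_distrib)
            have "?\<phi>k \<in> characters G T"
              by (rule trivial_on_base_character[OF restrict_extensional homk N(1) triv])
            then have "dist (?\<phi>k y) (?\<phi>k x) < 1"
              using \<eta>(2) triv x(2) y(2) by (auto simp: evaluation_apply)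
            moreover have "y = x \<otimes> z" using x y by (simp add: z_def flip: m_assoc)
            then have "\<phi> y = \<phi> x * \<phi> z" using hom_circleD(1)[OF hom x(3) z] by simp
            ultimately have "norm (\<phi> x ^ k * (\<phi> z ^ k - 1)) < 1"
              using x(3) y(1) by (simp add: dist_norm power_mult_distrib algebra_simps)
            then show ?thesis using hom_circleD(2)[OF hom x(3)] by (simp add: norm_mult norm_power)
          qed
          then show False using \<phi>(3) unit_circle_no_small_subgroups hom_circleD(2)[OF hom z] by blast
        qed
        then have "x \<otimes> z \<in> U" using N(2) by blast
        moreover have "x \<otimes> z = y" using x y by (simp add: z_def flip: m_assoc)
        ultimately show ?thesis using y(2) by blast
      qed
      then show "\<exists>K e. compactin (dual_topology G T) K \<and> 0 < e \<and>
          {\<eta> \<in> characters (dual_group G T) (dual_topology G T). \<forall>\<phi>\<in>K. dist (\<eta> \<phi>) (\<psi> \<phi>) < e} \<subseteq> ?ev ` U"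
        using compactin_annihilator[OF N(1)] zero_less_one[where 'a = real] by blast
    qed
  qed
  ultimately have "homeomorphic_map T (bidual_topology G T) ?ev"
    by (rule bijective_open_imp_homeomorphic_map)
       (use image evaluation_inj in \<open>auto simp: topspace_carrier topspace_dual_topology\<close>)
  with iso topological_abelian_group show ?thesis by (simp add: reflexive_group_def)
qed

end

section \<open>Equicontinuity of compact sets of characters\<close>

text \<open>The first uncountable ordinal, made into a type so that recursion can be indexed by a
  \<open>wellorder\<close>. Its later use rests on the countability of proper initial segments and
  the strict boundedness of countable subsets.\<close>

typedef omega1 = "Field (cardSuc natLeq)"
  using Field_cardSuc_not_empty[OF natLeq_Card_order] by blast

lemma omega1_Well_order: "Well_order (cardSuc natLeq)"
  using cardSuc_Card_order[OF natLeq_Card_order] card_order_on_well_order_on by blast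

instantiation omega1 :: linorder
begin

definition less_eq_omega1 :: "omega1 \<Rightarrow> omega1 \<Rightarrow> bool" where
  "(a::omega1) \<le> b \<longleftrightarrow> (Rep_omega1 a, Rep_omega1 b) \<in> cardSuc natLeq"

definition less_omega1 :: "omega1 \<Rightarrow> omega1 \<Rightarrow> bool" where
  "(a::omega1) < b \<longleftrightarrow> a \<le> b \<and> \<not> b \<le> a"

instance
proof -
  have lin: "refl_on (Field (cardSuc natLeq)) (cardSuc natLeq)" "trans (cardSuc natLeq)"
    "antisym (cardSuc natLeq)" "total_on (Field (cardSuc natLeq)) (cardSuc natLeq)"
    using omega1_Well_order
    by (auto simp: well_order_on_def linear_order_on_def partial_order_on_def preorder_on_def)
  show "OFCLASS(omega1, linorder_class)"
  proof
    fix a b c :: omega1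
    show "(a < b) = (a \<le> b \<and> \<not> b \<le> a)" by (simp add: less_omega1_def)
    show refl: "a \<le> a" for a :: omega1 using lin(1) Rep_omega1[of a] by (simp add: less_eq_omega1_def refl_on_def)
    show "a \<le> c" if "a \<le> b" "b \<le> c" using that lin(2) by (auto simp: less_eq_omega1_def dest: transD)
    show "a = b" if "a \<le> b" "b \<le> a"
      using that lin(3) by (auto simp: less_eq_omega1_def Rep_omega1_inject dest: antisymD)
    show "a \<le> b \<or> b \<le> a"
    proof (cases "a = b")
      case False
      then have "Rep_omega1 a \<noteq> Rep_omega1 b" by (simp add: Rep_omega1_inject)
      then show ?thesis
        using lin(4) Rep_omega1[of a] Rep_omega1[of b] by (auto simp: less_eq_omega1_def total_on_def)
    qed (simp add: refl)
  qed
qed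

end

lemma less_omega1_iff: "a < b \<longleftrightarrow> (Rep_omega1 a, Rep_omega1 b) \<in> cardSuc natLeq - Id"
  by (auto simp: less_le less_eq_omega1_def Rep_omega1_inject)

instance omega1 :: wellorder
proof
  fix P :: "omega1 \<Rightarrow> bool" and a
  assume step: "\<And>x. (\<And>y. y < x \<Longrightarrow> P y) \<Longrightarrow> P x"
  have "wf (inv_image (cardSuc natLeq - Id) Rep_omega1)"
    using omega1_Well_order by (intro wf_inv_image) (simp add: well_order_on_def)
  moreover have "inv_image (cardSuc natLeq - Id) Rep_omega1 = {(x, y). x < y}"
    by (auto simp: inv_image_def less_omega1_iff)
  ultimately have "wf {(x, y :: omega1). x < y}" by simp
  then show "P a" by (rule wf_induct_rule) (use step in auto)
qed

lemma countable_iff_ordLeq_natLeq: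
  includes cardinal_syntax
  shows "countable A \<longleftrightarrow> |A| \<le>o natLeq"
  using card_of_ordLeq[of A "UNIV :: nat set"] card_of_nat ordLeq_ordIso_trans ordIso_symmetric
  unfolding countable_def by (metis subset_UNIV)

lemma countable_lessThan_omega1:
  includes cardinal_syntax
  shows "countable {..<a :: omega1}"
proof -
  have "|underS (cardSuc natLeq) (Rep_omega1 a)| <o cardSuc natLeq"
    by (rule card_of_underS[OF cardSuc_Card_order[OF natLeq_Card_order] Rep_omega1])
  then have "|underS (cardSuc natLeq) (Rep_omega1 a)| \<le>o natLeq"
    using cardSuc_ordLeq_ordLess[OF natLeq_Card_order card_of_Card_order] by blast
  then have "countable (underS (cardSuc natLeq) (Rep_omega1 a))"
    by (simp add: countable_iff_ordLeq_natLeq)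
  moreover have "Rep_omega1 ` {..<a} \<subseteq> underS (cardSuc natLeq) (Rep_omega1 a)"
    by (auto simp: underS_def less_omega1_iff)
  ultimately have "countable (Rep_omega1 ` {..<a})" by (rule countable_subset[rotated])
  then show ?thesis
    by (rule countable_image_inj_on) (simp add: inj_on_def Rep_omega1_inject)
qed

lemma uncountable_omega1:
  includes cardinal_syntax
  shows "uncountable (UNIV :: omega1 set)"
proof
  assume "countable (UNIV :: omega1 set)"
  then have "countable (range Rep_omega1)" by simp
  then have "|Field (cardSuc natLeq)| \<le>o natLeq"
    by (simp add: type_definition.Rep_range[OF type_definition_omega1] countable_iff_ordLeq_natLeq)
  moreover have "|Field (cardSuc natLeq)| =o cardSuc natLeq"
    by (rule card_of_Field_ordIso[OF cardSuc_Card_order[OF natLeq_Card_order]])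
  ultimately have "cardSuc natLeq \<le>o natLeq" using ordIso_ordLeq_trans ordIso_symmetric by blast
  then show False using cardSuc_greater[OF natLeq_Card_order] not_ordLess_ordLeq by blast
qed

text \<open>An unbounded countable set would present the whole type as a countable union of
  countable initial segments.\<close>

lemma countable_bounded_omega1:
  assumes "countable (A :: omega1 set)"
  shows "\<exists>b. \<forall>a\<in>A. a < b"
proof (rule ccontr)
  assume "\<not> ?thesis"
  then have "UNIV = (\<Union>a\<in>A. insert a {..<a})"
    by (auto simp: not_less le_less)
  then show False
    using assms countable_lessThan_omega1 uncountable_omega1 by (metis countable_UN countable_insert)
qed

lemma wellorder_dependent_choice:
  fixes P :: "('w::wellorder \<Rightarrow> 'b) \<Rightarrow> 'w \<Rightarrow> 'b \<Rightarrow> bool"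
  assumes "\<And>f g x r. (\<And>z. z < x \<Longrightarrow> f z = g z) \<Longrightarrow> P f x r = P g x r"
    and "\<And>x f. (\<And>y. y < x \<Longrightarrow> P f y (f y)) \<Longrightarrow> \<exists>r. P f x r"
  shows "\<exists>f. \<forall>x. P f x (f x)"
proof (rule dependent_wf_choice)
  show "wf {(x :: 'w, y). x < y}" by (rule wf)
  show "P f x r = P g x r" if "\<And>z. (z, x) \<in> {(x, y). x < y} \<Longrightarrow> f z = g z" for f g x r
    by (rule assms(1)) (use that in simp)
  show "\<exists>r. P f x r" if "\<And>y. (y, x) \<in> {(x, y). x < y} \<Longrightarrow> P f y (f y)" for f x
    by (rule assms(2)) (use that in simp)
qed

section \<open>Accumulation points of long families of characters, and equicontinuity\<close>

context linear_P_group
begin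

text \<open>Otherwise each \<open>\<psi>\<close> in \<open>C\<close> has a neighbourhood that the
  family avoids after some index \<open>c \<psi>\<close>. Finitely many of these neighbourhoods
  cover \<open>C\<close>, and the character at an index beyond the corresponding bounds lies in none
  of them. The conclusion looks at one point \<open>x\<close> at a time, so each neighbourhood is
  defined by a single point.\<close>

lemma compactin_dual_accumulation:
  fixes \<phi> :: "'w::linorder \<Rightarrow> 'a \<Rightarrow> complex"
  assumes C: "compactin (dual_topology G T) C" and \<phi>: "\<And>a. \<phi> a \<in> C"
    and unbounded: "\<And>A :: 'w set. finite A \<Longrightarrow> \<exists>b. \<forall>a\<in>A. a < b"
  shows "\<exists>\<psi>\<in>C. \<forall>x\<in>carrier G. \<forall>e>0. \<forall>c. \<exists>a>c. dist (\<phi> a x) (\<psi> x) < e"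
proof (rule ccontr)
  assume no: "\<not> ?thesis"
  have "\<forall>\<psi>. \<exists>x e c. \<psi> \<in> C \<longrightarrow> x \<in> carrier G \<and> e > 0 \<and> (\<forall>a>c. dist (\<phi> a x) (\<psi> x) \<ge> e)"
  proof
    fix \<psi>
    show "\<exists>x e c. \<psi> \<in> C \<longrightarrow> x \<in> carrier G \<and> e > 0 \<and> (\<forall>a>c. dist (\<phi> a x) (\<psi> x) \<ge> e)"
    proof (cases "\<psi> \<in> C")
      case True
      then have "\<not> (\<forall>x\<in>carrier G. \<forall>e>0. \<forall>c. \<exists>a>c. dist (\<phi> a x) (\<psi> x) < e)" using no by blast
      then obtain x e c where "x \<in> carrier G" "e > 0" "\<not> (\<exists>a>c. dist (\<phi> a x) (\<psi> x) < e)" by blast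
      then show ?thesis by (meson not_less)
    qed simp
  qed
  then obtain x e c where xec: "\<And>\<psi>. \<psi> \<in> C \<Longrightarrow> x \<psi> \<in> carrier G \<and> e \<psi> > 0 \<and> (\<forall>a>c \<psi>. dist (\<phi> a (x \<psi>)) (\<psi> (x \<psi>)) \<ge> e \<psi>)"
    by metis
  define U where "U = (\<lambda>\<psi>. {\<eta> \<in> characters G T. dist (\<eta> (x \<psi>)) (\<psi> (x \<psi>)) < e \<psi>})"
  have Cc: "C \<subseteq> characters G T" using C compactin_subset_topspace topspace_dual_topology by blast
  have "openin (dual_topology G T) (U \<psi>)" if "\<psi> \<in> C" for \<psi>
    unfolding openin_dual_topology
  proof (intro conjI ballI)
    fix \<eta> assume \<eta>: "\<eta> \<in> U \<psi>"
    let ?d = "e \<psi> - dist (\<eta> (x \<psi>)) (\<psi> (x \<psi>))"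
    have "dist (\<zeta> (x \<psi>)) (\<psi> (x \<psi>)) < e \<psi>" if "dist (\<zeta> (x \<psi>)) (\<eta> (x \<psi>)) < ?d" for \<zeta>
      using that dist_triangle[of "\<zeta> (x \<psi>)" "\<psi> (x \<psi>)" "\<eta> (x \<psi>)"] by linarith
    then have "{\<zeta> \<in> characters G T. \<forall>y\<in>{x \<psi>}. dist (\<zeta> y) (\<eta> y) < ?d} \<subseteq> U \<psi>"
      by (auto simp: U_def)
    moreover have "?d > 0" using \<eta> by (simp add: U_def)
    moreover have "compactin T {x \<psi>}" using xec[OF that] by (simp add: topspace_carrier)
    ultimately show "\<exists>K e. compactin T K \<and> e > 0 \<and> {\<zeta> \<in> characters G T. \<forall>y\<in>K. dist (\<zeta> y) (\<eta> y) < e} \<subseteq> U \<psi>"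
      by blast
  qed (simp add: U_def)
  then have "\<And>V. V \<in> U ` C \<Longrightarrow> openin (dual_topology G T) V" "C \<subseteq> \<Union>(U ` C)"
    using xec Cc by (auto simp: U_def)
  from compactinD[OF C this] obtain F where F: "finite F" "F \<subseteq> C" "C \<subseteq> (\<Union>\<psi>\<in>F. U \<psi>)"
    by (metis finite_subset_image)
  obtain a where a: "\<forall>\<psi>\<in>F. c \<psi> < a" using unbounded[of "c ` F"] F(1) by auto
  obtain \<psi> where "\<psi> \<in> F" "\<phi> a \<in> U \<psi>" using F(3) \<phi> by blast
  then show False using xec[of \<psi>] F(2) a by (force simp: U_def)
qed

text \<open>If no base subgroup annihilates \<open>C\<close>, recursion along \<open>omega1\<close> gives \<open>\<phi> a \<in> C\<close>, a decreasing
  chain \<open>N a\<close> with \<open>N a\<close> in the kernel of \<open>\<phi> a\<close>, and \<open>x a\<close> in all earlier \<open>N b\<close> with \<open>\<phi> a (x a)\<close> far from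
  1. An accumulation point \<open>\<psi>\<close> is trivial on some \<open>N c\<close>. A second recursion sums a suitable
  subfamily of the \<open>x a\<close> to a single \<open>y \<in> N c\<close> at which every \<open>\<phi> a\<close> with \<open>a > c\<close> is far from 1.\<close>

theorem compacts_equicontinuous:
  assumes chain: "\<And>(N :: omega1 \<Rightarrow> 'a set) y A.
      \<lbrakk>\<And>a. a \<in> A \<Longrightarrow> N a \<in> \<N> \<and> y a \<in> carrier G;
       \<And>a b. \<lbrakk>a \<in> A; b \<in> A; a < b\<rbrakk> \<Longrightarrow> N b \<subseteq> N a \<and> inv (y a) \<otimes> y b \<in> N a\<rbrakk>
      \<Longrightarrow> \<exists>z\<in>carrier G. \<forall>a\<in>A. inv (y a) \<otimes> z \<in> N a"
    and stable: "\<And>(N :: omega1 \<Rightarrow> 'a set) M.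
      \<lbrakk>\<And>a. N a \<in> \<N>; \<And>a b. a < b \<Longrightarrow> N b \<subseteq> N a; M \<in> \<N>\<rbrakk>
      \<Longrightarrow> \<exists>c. \<forall>x\<in>N c. \<exists>m\<in>M. \<exists>n. (\<forall>a. n \<in> N a) \<and> x = m \<otimes> n"
    and C: "compactin (dual_topology G T) C"
  shows "\<exists>N\<in>\<N>. \<forall>\<phi>\<in>C. \<forall>n\<in>N. \<phi> n = 1"
proof (rule ccontr)
  assume no: "\<not> ?thesis"
  have Cc: "C \<subseteq> characters G T" using C compactin_subset_topspace topspace_dual_topology by blast
  define P where "P = (\<lambda>(f :: omega1 \<Rightarrow> 'a set \<times> ('a \<Rightarrow> complex) \<times> 'a) a (N, \<phi>, x). N \<in> \<N> \<and> \<phi> \<in> C \<and> x \<in> carrier G \<and>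
      (\<forall>b<a. N \<subseteq> fst (f b) \<and> x \<in> fst (f b)) \<and> (\<forall>n\<in>N. \<phi> n = 1) \<and> norm (\<phi> x - 1) \<ge> 1)"
  have "\<exists>f. \<forall>a. P f a (f a)"
  proof (rule wellorder_dependent_choice)
    fix f g :: "omega1 \<Rightarrow> 'a set \<times> ('a \<Rightarrow> complex) \<times> 'a" and a r
    assume "\<And>z. z < a \<Longrightarrow> f z = g z"
    then show "P f a r = P g a r" by (cases r) (simp add: P_def)
  next
    fix a and f :: "omega1 \<Rightarrow> 'a set \<times> ('a \<Rightarrow> complex) \<times> 'a"
    assume IH: "\<And>b. b < a \<Longrightarrow> P f b (f b)"
    have "fst (f b) \<in> \<N>" if "b < a" for b
      using IH[OF that] by (cases "f b") (simp add: P_def)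
    moreover have "countable ((\<lambda>b. fst (f b)) ` {..<a})" using countable_lessThan_omega1 by simp
    ultimately have "\<exists>W\<in>\<N>. \<forall>M\<in>(\<lambda>b. fst (f b)) ` {..<a}. W \<subseteq> M"
      by (intro countable_lower) auto
    then obtain W where W: "W \<in> \<N>" "\<And>b. b < a \<Longrightarrow> W \<subseteq> fst (f b)" by auto
    obtain \<phi> n where \<phi>: "\<phi> \<in> C" "n \<in> W" "\<phi> n \<noteq> 1" using no W(1) by blast
    have hom: "\<phi> \<in> hom G circle_group" using character_hom Cc \<phi>(1) by blast
    have n: "n \<in> carrier G" using base_mem(1)[OF W(1)] \<phi>(2) by blast
    \<comment> \<open>A power achieves a distance that is the same at all stages and still lies in
      the subgroup \<open>W\<close>. Distance 1 leaves room for the loss of 1/2 in the second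
      recursion.\<close>
    obtain k :: nat where k: "norm (\<phi> n ^ k - 1) \<ge> 1"
      using unit_circle_no_small_subgroups[of "\<phi> n"] hom_circleD(2)[OF hom n] \<phi>(3) by (metis not_le)
    have x: "n [^] k \<in> W" using \<phi>(2) base_mem[OF W(1)] by (induction k) auto
    obtain M where M: "M \<in> \<N>" "\<forall>n\<in>M. \<phi> n = 1" using character_trivial_on_base \<phi>(1) Cc by blast
    obtain N where N: "N \<in> \<N>" "N \<subseteq> W" "N \<subseteq> M" using base_lower2[OF W(1) M(1)] by blast
    have "N \<subseteq> fst (f b) \<and> n [^] k \<in> fst (f b)" if "b < a" for b
      using W(2)[OF that] N(2) x by blast
    then have "P f a (N, \<phi>, n [^] k)"
      using N M \<phi>(1) n k hom_circle_pow[OF is_group hom n] by (auto simp: P_def)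
    then show "\<exists>r. P f a r" by blast
  qed
  then obtain f where f: "\<And>a. P f a (f a)" by blast
  define N where "N = (\<lambda>a. fst (f a))"
  define \<phi> where "\<phi> = (\<lambda>a. fst (snd (f a)))"
  define x where "x = (\<lambda>a. snd (snd (f a)))"
  have N: "N a \<in> \<N>" "b < a \<Longrightarrow> N a \<subseteq> N b" and \<phi>: "\<phi> a \<in> C" "n \<in> N a \<Longrightarrow> \<phi> a n = 1"
    and x: "x a \<in> carrier G" "b < a \<Longrightarrow> x a \<in> N b" "norm (\<phi> a (x a) - 1) \<ge> 1" for a b n
    using f[of a] by (auto simp: P_def N_def \<phi>_def x_def split: prod.splits)
  have hom: "\<phi> a \<in> hom G circle_group" for a using character_hom Cc \<phi>(1) by blast
  obtain \<psi> where \<psi>: "\<psi> \<in> C" and acc: "\<And>x e c. x \<in> carrier G \<Longrightarrow> e > 0 \<Longrightarrow> \<exists>a>c. dist (\<phi> a x) (\<psi> x) < e"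
    using compactin_dual_accumulation[where \<phi> = \<phi>, OF C \<phi>(1) countable_bounded_omega1[OF countable_finite]]
    by blast
  have hom\<psi>: "\<psi> \<in> hom G circle_group" using character_hom Cc \<psi> by blast
  obtain M where M: "M \<in> \<N>" "\<forall>n\<in>M. \<psi> n = 1" using character_trivial_on_base \<psi> Cc by blast
  obtain c where c: "\<forall>x\<in>N c. \<exists>m\<in>M. \<exists>n. (\<forall>a. n \<in> N a) \<and> x = m \<otimes> n"
    using stable[of N M] N M(1) by blast
  \<comment> \<open>The factor in \<open>M\<close> is annihilated by \<open>\<psi>\<close> itself.
    The other factor lies in every \<open>N a\<close>, so each \<open>\<phi> a\<close> is 1 there,
    and so is the accumulation point.\<close>
  have \<psi>c: "\<psi> z = 1" if z: "z \<in> N c" for z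
  proof -
    obtain m n where mn: "m \<in> M" "\<And>a. n \<in> N a" "z = m \<otimes> n" using c z by blast
    have nc: "n \<in> carrier G" using mn(2)[of c] base_mem(1)[OF N(1)] by blast
    have "dist 1 (\<psi> n) < e" if "e > 0" for e
      using acc[OF nc that] \<phi>(2)[OF mn(2)] by auto
    then have "\<psi> n = 1" by (metis dist_pos_lt less_irrefl)
    then show ?thesis
      using mn M(2) hom_circleD(1)[OF hom\<psi>, of m n] nc base_mem(1)[OF M(1)] by auto
  qed
  \<comment> \<open>Agreement with \<open>g b\<close> modulo \<open>N b\<close> for all earlier
    \<open>b\<close> makes the cosets of the \<open>g b\<close> a decreasing chain, whose common
    point continues the recursion. Keeping the value \<one> up to \<open>c\<close> places the final
    point in \<open>N c\<close>.\<close>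
  define Q where "Q = (\<lambda>g a y. y \<in> carrier G \<and> (a \<le> c \<longrightarrow> y = \<one>) \<and> (a > c \<longrightarrow> norm (\<phi> a y - 1) \<ge> 1 / 2)
     \<and> (\<forall>b<a. inv (g b) \<otimes> y \<in> N b))"
  have "\<exists>g. \<forall>a. Q g a (g a)"
  proof (rule wellorder_dependent_choice)
    fix f g :: "omega1 \<Rightarrow> 'a" and a r
    assume "\<And>z. z < a \<Longrightarrow> f z = g z"
    then show "Q f a r = Q g a r" by (simp add: Q_def)
  next
    fix a and g :: "omega1 \<Rightarrow> 'a"
    assume IH: "\<And>b. b < a \<Longrightarrow> Q g b (g b)"
    have "\<exists>z\<in>carrier G. \<forall>b\<in>{..<a}. inv (g b) \<otimes> z \<in> N b"
    proof (rule chain)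
      show "N b \<in> \<N> \<and> g b \<in> carrier G" if "b \<in> {..<a}" for b
        using IH[of b] that N(1) by (simp add: Q_def)
      show "N d \<subseteq> N b \<and> inv (g b) \<otimes> g d \<in> N b" if "b \<in> {..<a}" "d \<in> {..<a}" "b < d" for b d
        using IH[of d] that N(2) by (simp add: Q_def)
    qed
    then obtain z where z: "z \<in> carrier G" "\<And>b. b < a \<Longrightarrow> inv (g b) \<otimes> z \<in> N b" by blast
    consider "a \<le> c" | "c < a" "norm (\<phi> a z - 1) \<ge> 1 / 2" | "c < a" "norm (\<phi> a z - 1) < 1 / 2"
      by (meson not_le)
    then show "\<exists>y. Q g a y"
    proof cases
      case 1
      have "inv (g b) \<otimes> \<one> \<in> N b" if "b < a" for b
        using IH[OF that] that 1 base_mem(2)[OF N(1)] by (simp add: Q_def)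
      then have "Q g a \<one>" using 1 by (simp add: Q_def)
      then show ?thesis by blast
    next
      case 2
      then have "Q g a z" using z by (auto simp: Q_def)
      then show ?thesis by blast
    next
      case 3
      \<comment> \<open>When \<open>\<phi> a z\<close> is too close to 1, the factor
        \<open>x a\<close> repairs it: it lies in all earlier \<open>N b\<close> and leaves the
        cosets unchanged, while moving the value to a distance of at least 1 - 1/2 from 1.\<close>
      have "inv (g b) \<otimes> (z \<otimes> x a) \<in> N b" if "b < a" for b
      proof -
        have "g b \<in> carrier G" using IH[OF that] by (simp add: Q_def)
        then have "inv (g b) \<otimes> (z \<otimes> x a) = (inv (g b) \<otimes> z) \<otimes> x a" using z x(1) by (simp add: m_assoc)
        then show ?thesis using base_mem(3)[OF N(1) z(2) x(2)] that by simp
      qed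
      moreover have "norm (\<phi> a (z \<otimes> x a) - 1) \<ge> 1 / 2"
      proof -
        have eq: "\<phi> a (z \<otimes> x a) - 1 = (\<phi> a (x a) - 1) - \<phi> a (x a) * (1 - \<phi> a z)"
          using hom_circleD(1)[OF hom z(1) x(1)] by (simp add: algebra_simps)
        have "norm (\<phi> a (x a) * (1 - \<phi> a z)) < 1 / 2"
          using 3(2) hom_circleD(2)[OF hom x(1)] by (simp add: norm_mult norm_minus_commute)
        then show ?thesis
          unfolding eq using x(3)[of a] norm_triangle_ineq2[of "\<phi> a (x a) - 1" "\<phi> a (x a) * (1 - \<phi> a z)"]
          by linarith
      qed
      ultimately have "Q g a (z \<otimes> x a)" using 3 z x(1) by (auto simp: Q_def)
      then show ?thesis by blast
    qed
  qed
  then obtain g where g: "\<And>a. Q g a (g a)" by blast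
  have "\<exists>y\<in>carrier G. \<forall>a\<in>UNIV. inv (g a) \<otimes> y \<in> N a"
    by (rule chain) (use g N in \<open>auto simp: Q_def\<close>)
  then obtain y where y: "y \<in> carrier G" "\<And>a. inv (g a) \<otimes> y \<in> N a" by blast
  have "g c = \<one>" using g[of c] by (simp add: Q_def)
  then have "y \<in> N c" using y(2)[of c] y(1) by simp
  then have \<psi>y: "\<psi> y = 1" by (rule \<psi>c)
  obtain a where a: "a > c" "dist (\<phi> a y) (\<psi> y) < 1 / 2" using acc[OF y(1), of "1/2"] by auto
  have ga: "g a \<in> carrier G" "norm (\<phi> a (g a) - 1) \<ge> 1 / 2" using g[of a] a(1) by (simp_all add: Q_def)
  \<comment> \<open>Since \<open>\<phi> a\<close> is trivial on \<open>N a\<close>, the final point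
    keeps the value fixed at stage \<open>a\<close>. It is at distance at least 1/2 from
    \<open>\<psi> y = 1\<close>, against the choice of \<open>a\<close>.\<close>
  have "\<phi> a y = \<phi> a (g a) * \<phi> a (inv (g a) \<otimes> y)"
    using hom_circleD(1)[OF hom ga(1), of "inv (g a) \<otimes> y"] ga(1) y(1) by (simp flip: m_assoc)
  then have "\<phi> a y = \<phi> a (g a)" using \<phi>(2)[OF y(2)] by simp
  then show False using a(2) ga(2) \<psi>y by (simp add: dist_norm)
qed

end

section \<open>Compact subgroups of feathered groups\<close>

text \<open>In a chain a finite intersection is its last member, which is nonempty. The finite
  intersection property is applied inside the compact member \<open>S a0\<close>.\<close>

lemma compactin_chain_nonempty:
  fixes S :: "'w::linorder \<Rightarrow> 'a set"
  assumes a0: "a0 \<in> A" "compactin X (S a0)"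
    and S: "\<And>a. a \<in> A \<Longrightarrow> closedin X (S a)" "\<And>a. a \<in> A \<Longrightarrow> S a \<noteq> {}"
    and decr: "\<And>a b. a \<in> A \<Longrightarrow> b \<in> A \<Longrightarrow> a < b \<Longrightarrow> S b \<subseteq> S a"
  shows "\<exists>x. \<forall>a\<in>A. x \<in> S a"
proof -
  have "S a0 \<inter> \<Inter>(S ` A) \<noteq> {}"
  proof (rule a0(2)[unfolded compactin_fip, THEN conjunct2, rule_format], intro conjI ballI allI impI)
    fix \<F> assume "finite \<F> \<and> \<F> \<subseteq> S ` A"
    then obtain B where B: "finite B" "B \<subseteq> A" "\<F> = S ` B" by (meson finite_subset_image)
    define m where "m = Max (insert a0 B)"
    have m: "m \<in> insert a0 B" "\<And>b. b \<in> insert a0 B \<Longrightarrow> b \<le> m"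
      unfolding m_def using B(1) Max_in[of "insert a0 B"] Max_ge[of "insert a0 B"] by blast+
    have mA: "m \<in> A" using m(1) B(2) a0(1) by blast
    have "S m \<subseteq> S b" if "b \<in> insert a0 B" for b
    proof (cases "b = m")
      case False
      then have "b < m" using m(2)[OF that] by simp
      then show ?thesis using decr[of b m] mA that B(2) a0(1) by blast
    qed simp
    then have "S m \<subseteq> S a0 \<inter> \<Inter>\<F>" using B(3) by blast
    then show "S a0 \<inter> \<Inter>\<F> \<noteq> {}" using S(2)[OF mA] by blast
  qed (use S(1) in blast)
  then show ?thesis by blast
qed

text \<open>Each step gives up one index to form a quotient. In the intersection this loss
  disappears, which leaves a closed subgroup; using quotients treats products and inverses
  together.\<close>

definition square_root_chain :: "'a monoid \<Rightarrow> 'a topology \<Rightarrow> (nat \<Rightarrow> 'a set) \<Rightarrow> bool" where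
  "square_root_chain G T V \<longleftrightarrow> (\<forall>n. openin T (V n) \<and> \<one>\<^bsub>G\<^esub> \<in> V n \<and>
     (\<forall>a\<in>V (Suc n). \<forall>b\<in>V (Suc n). a \<otimes>\<^bsub>G\<^esub> inv\<^bsub>G\<^esub> b \<in> V n))"

text \<open>A compact G-delta subgroup, together with the sequence that defines it: the open sets of
  that sequence are needed again for cosets of boxes and for the stabilization of chains. That
  \<open>N\<close> is a subgroup is a consequence.\<close>

definition admissible_subgroup :: "'a monoid \<Rightarrow> 'a topology \<Rightarrow> 'a set \<Rightarrow> bool" where
  "admissible_subgroup G T N \<longleftrightarrow> compactin T N \<and> (\<exists>V. square_root_chain G T V \<and> N = (\<Inter>n. V n))"

locale topological_comm_group = comm_group G for G :: "'a monoid" (structure) +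
  fixes T :: "'a topology"
  assumes top_group: "topological_group G T"
begin

section \<open>Translations and neighbourhoods of the identity\<close>

lemma topspace_eq: "topspace T = carrier G" and Hausdorff: "Hausdorff_space T"
  using top_group by (auto simp: topological_group_def)

lemma open_subset: "openin T U \<Longrightarrow> U \<subseteq> carrier G"
  using openin_subset topspace_eq by metis

lemma continuous_mult:
  "continuous_map X T f \<Longrightarrow> continuous_map X T g \<Longrightarrow> continuous_map X T (\<lambda>x. f x \<otimes> g x)"
proof -
  assume "continuous_map X T f" "continuous_map X T g"
  then have "continuous_map X (prod_topology T T) (\<lambda>x. (f x, g x))" by (rule continuous_map_pairedI)
  then have "continuous_map X T ((\<lambda>(x, y). x \<otimes> y) \<circ> (\<lambda>x. (f x, g x)))"
    by (rule continuous_map_compose) (use top_group in \<open>simp add: topological_group_def\<close>)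
  then show ?thesis by (simp add: o_def)
qed

lemma continuous_inv: "continuous_map X T f \<Longrightarrow> continuous_map X T (\<lambda>x. inv (f x))"
  using continuous_map_compose[of X T f T "\<lambda>x. inv x"] top_group by (simp add: topological_group_def o_def)

lemma continuous_const: "x \<in> carrier G \<Longrightarrow> continuous_map X T (\<lambda>_. x)"
  by (simp add: topspace_eq)

lemma continuous_translation:
  assumes "x \<in> carrier G"
  shows "continuous_map T T (\<lambda>y. x \<otimes> y)" "continuous_map T T (\<lambda>y. inv y \<otimes> x)"
proof -
  show "continuous_map T T (\<lambda>y. x \<otimes> y)"
    by (rule continuous_mult[OF continuous_const[OF assms] continuous_map_id[unfolded id_def]])
  show "continuous_map T T (\<lambda>y. inv y \<otimes> x)"
    by (rule continuous_mult[OF continuous_inv[OF continuous_map_id[unfolded id_def]] continuous_const[OF assms]])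
qed

lemma open_translate:
  assumes "openin T U" "x \<in> carrier G"
  shows "openin T {y \<in> carrier G. x \<otimes> y \<in> U}" "openin T {y \<in> carrier G. inv y \<otimes> x \<in> U}"
  using openin_continuous_map_preimage[OF continuous_translation(1) assms(1)]
    openin_continuous_map_preimage[OF continuous_translation(2) assms(1)] assms(2)
  by (simp_all add: topspace_eq)

lemma square_root_nbhd:
  assumes "openin T U" "\<one> \<in> U"
  shows "\<exists>V. openin T V \<and> \<one> \<in> V \<and> (\<forall>a\<in>V. \<forall>b\<in>V. a \<otimes> inv b \<in> U)"
proof -
  have "continuous_map (prod_topology T T) T (\<lambda>p. fst p \<otimes> inv (snd p))"
    by (intro continuous_mult continuous_inv continuous_map_fst continuous_map_snd)
  then have "openin (prod_topology T T) {p \<in> topspace (prod_topology T T). fst p \<otimes> inv (snd p) \<in> U}"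
    using openin_continuous_map_preimage assms(1) by blast
  moreover have "(\<one>, \<one>) \<in> {p \<in> topspace (prod_topology T T). fst p \<otimes> inv (snd p) \<in> U}"
    using assms(2) by (simp add: topspace_eq)
  ultimately obtain V W where VW: "openin T V" "openin T W" "\<one> \<in> V" "\<one> \<in> W"
    "V \<times> W \<subseteq> {p \<in> topspace (prod_topology T T). fst p \<otimes> inv (snd p) \<in> U}"
    unfolding openin_prod_topology_alt by meson
  then have "\<forall>a\<in>V \<inter> W. \<forall>b\<in>V \<inter> W. a \<otimes> inv b \<in> U" by auto
  then show ?thesis using VW by (intro exI[of _ "V \<inter> W"]) auto
qed

lemma square_root_chain_inside:
  assumes "\<And>n. openin T (W n)" "\<And>n. \<one> \<in> W n"
  obtains V where "square_root_chain G T V" "\<And>n. V n \<subseteq> W n"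
proof -
  have "\<exists>V. \<forall>n. (openin T (V n) \<and> \<one> \<in> V n \<and> V n \<subseteq> W n) \<and> (\<forall>a\<in>V (Suc n). \<forall>b\<in>V (Suc n). a \<otimes> inv b \<in> V n)"
  proof (rule dependent_nat_choice)
    show "\<exists>V. openin T V \<and> \<one> \<in> V \<and> V \<subseteq> W 0" using assms by blast
    fix V n assume V: "openin T V \<and> \<one> \<in> V \<and> V \<subseteq> W n"
    then obtain U where "openin T U" "\<one> \<in> U" "\<forall>a\<in>U. \<forall>b\<in>U. a \<otimes> inv b \<in> V"
      using square_root_nbhd[of V] V by blast
    then show "\<exists>V'. (openin T V' \<and> \<one> \<in> V' \<and> V' \<subseteq> W (Suc n)) \<and> (\<forall>a\<in>V'. \<forall>b\<in>V'. a \<otimes> inv b \<in> V)"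
      using assms(1)[of "Suc n"] assms(2)[of "Suc n"] by (intro exI[of _ "U \<inter> W (Suc n)"]) (simp add: openin_Int)
  qed
  then obtain V where V: "\<forall>n. (openin T (V n) \<and> \<one> \<in> V n \<and> V n \<subseteq> W n) \<and> (\<forall>a\<in>V (Suc n). \<forall>b\<in>V (Suc n). a \<otimes> inv b \<in> V n)"
    by blast
  show thesis
    by (rule that[of V]) (use V in \<open>auto simp: square_root_chain_def\<close>)
qed

section \<open>Intersections of square root chains\<close>

context
  fixes V assumes V: "square_root_chain G T V"
begin

lemma chain_open: "openin T (V n)" and chain_one: "\<one> \<in> V n"
  and chain_div: "a \<in> V (Suc n) \<Longrightarrow> b \<in> V (Suc n) \<Longrightarrow> a \<otimes> inv b \<in> V n"
  using V by (auto simp: square_root_chain_def)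

lemma chain_decreasing: "m \<le> n \<Longrightarrow> V n \<subseteq> V m"
proof (induction n rule: dec_induct)
  case (step n)
  have "V (Suc n) \<subseteq> V n"
    using chain_div[of _ n \<one>] chain_one[of "Suc n"] open_subset[OF chain_open[of "Suc n"]] by force
  with step show ?case by blast
qed simp

lemma chain_Inter_subgroup: "subgroup (\<Inter>n. V n) G"
proof (rule subgroupI)
  show "(\<Inter>n. V n) \<subseteq> carrier G" using open_subset[OF chain_open] by blast
  show "(\<Inter>n. V n) \<noteq> {}" using chain_one by blast
  have inv: "inv a \<in> (\<Inter>n. V n)" if "a \<in> (\<Inter>n. V n)" for a
  proof
    fix n
    have "a \<in> carrier G" using that open_subset[OF chain_open] by blast
    then show "inv a \<in> V n" using chain_div[of \<one> n a] that chain_one by simp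
  qed
  then show "inv a \<in> (\<Inter>n. V n)" if "a \<in> (\<Inter>n. V n)" for a using that .
  show "a \<otimes> b \<in> (\<Inter>n. V n)" if "a \<in> (\<Inter>n. V n)" "b \<in> (\<Inter>n. V n)" for a b
  proof
    fix n
    have "b \<in> carrier G" using that open_subset[OF chain_open] by blast
    then show "a \<otimes> b \<in> V n" using chain_div[of a n "inv b"] that(1) inv[OF that(2)] by simp
  qed
qed

text \<open>If \<open>x\<close> is outside \<open>V n\<close>, its translate of
  \<open>V (Suc n)\<close> misses \<open>V (Suc n)\<close>: a common point \<open>y\<close> would
  give \<open>x = y \<otimes> inv (inv x \<otimes> y)\<close>, an element of
  \<open>V n\<close>.\<close>

lemma chain_Inter_closed: "closedin T (\<Inter>n. V n)"
  unfolding closedin_def topspace_eq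
proof
  show "(\<Inter>n. V n) \<subseteq> carrier G" using open_subset[OF chain_open] by blast
  show "openin T (carrier G - (\<Inter>n. V n))"
  proof (subst openin_subopen, intro ballI)
    fix x assume "x \<in> carrier G - (\<Inter>n. V n)"
    then obtain n where x: "x \<in> carrier G" "x \<notin> V n" by blast
    let ?U = "{y \<in> carrier G. inv x \<otimes> y \<in> V (Suc n)}"
    have "y \<notin> V (Suc n)" if "y \<in> ?U" for y
    proof
      assume "y \<in> V (Suc n)"
      then have "y \<otimes> inv (inv x \<otimes> y) \<in> V n" using chain_div that by blast
      moreover have "y \<otimes> inv (inv x \<otimes> y) = x" using x(1) that by (simp add: inv_mult_group flip: m_assoc)
      ultimately show False using x(2) by simp
    qed
    then have "?U \<subseteq> carrier G - (\<Inter>n. V n)" by blast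
    moreover have "openin T ?U" using open_translate(1)[OF chain_open] x(1) by simp
    moreover have "x \<in> ?U" using x(1) chain_one by simp
    ultimately show "\<exists>U. openin T U \<and> x \<in> U \<and> U \<subseteq> carrier G - (\<Inter>n. V n)" by blast
  qed
qed

end

lemma admissible_subgroupD:
  assumes "admissible_subgroup G T N"
  shows "subgroup N G" "compactin T N" "closedin T N"
  using assms chain_Inter_subgroup chain_Inter_closed by (auto simp: admissible_subgroup_def)

text \<open>Since points are closed, the neighbourhood base of \<open>K\<close> intersects to
  \<open>K\<close>. Translation by some \<open>k\<close> in \<open>K\<close> turns its members into
  neighbourhoods of the identity; a square root chain inside these and the \<open>W n\<close>
  intersects to a closed subgroup lying in a translate of \<open>K\<close>, which is
  compact.\<close>

lemma feathered_admissible_inside: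
  assumes F: "feathered_group G T" and W: "\<And>n::nat. openin T (W n)" "\<And>n. \<one> \<in> W n"
  obtains N where "admissible_subgroup G T N" "\<And>n. N \<subseteq> W n"
proof -
  obtain K \<B> where K: "compactin T K" "K \<noteq> {}" and \<B>: "countable \<B>" "\<forall>U\<in>\<B>. openin T U \<and> K \<subseteq> U"
    "\<forall>V. openin T V \<and> K \<subseteq> V \<longrightarrow> (\<exists>U\<in>\<B>. U \<subseteq> V)"
    using F unfolding feathered_group_def by meson
  have Kc: "K \<subseteq> carrier G" using K(1) compactin_subset_topspace topspace_eq by blast
  have "\<B> \<noteq> {}" using \<B>(3)[rule_format, of "carrier G"] Kc openin_topspace[of T] topspace_eq by auto
  define B where "B = from_nat_into \<B>"
  have B: "range B = \<B>" using \<open>\<B> \<noteq> {}\<close> \<B>(1) by (simp add: B_def range_from_nat_into)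
  have Bn: "openin T (B n)" "K \<subseteq> B n" for n using \<B>(2) B by blast+
  have B_Inter: "(\<Inter>n. B n) \<subseteq> K"
  proof
    fix x assume x: "x \<in> (\<Inter>n. B n)"
    show "x \<in> K"
    proof (rule ccontr)
      assume "x \<notin> K"
      have "x \<in> carrier G" using x B \<B>(2) open_subset by blast
      then have "closedin T {x}"
        using Hausdorff topspace_eq closedin_Hausdorff_singleton by metis
      then have "openin T (carrier G - {x})" by (simp add: closedin_def topspace_eq)
      then obtain U where "U \<in> \<B>" "U \<subseteq> carrier G - {x}" using \<B>(3) \<open>x \<notin> K\<close> Kc by blast
      then show False using x B by blast
    qed
  qed
  obtain k where k: "k \<in> K" using K(2) by blast
  then have kc: "k \<in> carrier G" using Kc by blast
  define W' where "W' = (\<lambda>n. W n \<inter> {y \<in> carrier G. k \<otimes> y \<in> B n})"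
  have "openin T (W' n)" for n
    unfolding W'_def using W(1) open_translate(1)[OF Bn(1) kc] by (rule openin_Int)
  moreover have "\<one> \<in> W' n" for n
    using W(2) k kc Bn(2) by (auto simp: W'_def)
  ultimately obtain V where V: "square_root_chain G T V" "\<And>n. V n \<subseteq> W' n"
    using square_root_chain_inside by metis
  have "(\<Inter>n. V n) \<subseteq> (\<lambda>y. inv k \<otimes> y) ` K"
  proof
    fix y assume y: "y \<in> (\<Inter>n. V n)"
    then have "y \<in> carrier G" "k \<otimes> y \<in> (\<Inter>n. B n)" using V(2) by (auto simp: W'_def)
    then show "y \<in> (\<lambda>y. inv k \<otimes> y) ` K"
      using B_Inter kc by (intro image_eqI[of _ _ "k \<otimes> y"]) (auto simp flip: m_assoc)
  qed
  moreover have "compactin T ((\<lambda>y. inv k \<otimes> y) ` K)"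
    using image_compactin[OF K(1) continuous_translation(1)] kc by simp
  ultimately have "compactin T (\<Inter>n. V n)"
    using chain_Inter_closed[OF V(1)] closed_compactin by blast
  then have "admissible_subgroup G T (\<Inter>n. V n)" using V(1) by (auto simp: admissible_subgroup_def)
  moreover have "(\<Inter>n. V n) \<subseteq> W n" for n using V(2)[of n] by (auto simp: W'_def)
  ultimately show thesis using that by blast
qed

lemma whole_or_admissibleD:
  assumes "N = carrier G \<or> admissible_subgroup G T N"
  shows "subgroup N G" "closedin T N"
  using assms admissible_subgroupD subgroup_self closedin_topspace[of T] topspace_eq by auto

text \<open>A coset of the whole group imposes no condition. Once some \<open>N a0\<close> is
  compact, the cosets are a decreasing chain of nonempty closed sets with a compact member.\<close>

lemma coset_chain_common_point:
  fixes N :: "'w::linorder \<Rightarrow> 'a set"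
  assumes N: "\<And>a. a \<in> A \<Longrightarrow> N a = carrier G \<or> admissible_subgroup G T (N a)"
    and y: "\<And>a. a \<in> A \<Longrightarrow> y a \<in> carrier G"
    and decr: "\<And>a b. \<lbrakk>a \<in> A; b \<in> A; a < b\<rbrakk> \<Longrightarrow> N b \<subseteq> N a \<and> inv (y a) \<otimes> y b \<in> N a"
  shows "\<exists>z\<in>carrier G. \<forall>a\<in>A. inv (y a) \<otimes> z \<in> N a"
proof (cases "\<forall>a\<in>A. N a = carrier G")
  case True
  then show ?thesis using y by (intro bexI[of _ \<one>]) auto
next
  case False
  then obtain a0 where a0: "a0 \<in> A" "admissible_subgroup G T (N a0)" using N by blast
  define S where "S = (\<lambda>a. {z \<in> carrier G. inv (y a) \<otimes> z \<in> N a})"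
  have sub: "subgroup (N a) G" "closedin T (N a)" if "a \<in> A" for a
    using whole_or_admissibleD[OF N[OF that]] .
  have "\<exists>z. \<forall>a\<in>A. z \<in> S a"
  proof (rule compactin_chain_nonempty[OF a0(1)])
    show closed: "closedin T (S a)" if "a \<in> A" for a
      using closedin_continuous_map_preimage[OF continuous_translation(1) sub(2)[OF that]] y[OF that]
      by (simp add: S_def topspace_eq)
    show "S a \<noteq> {}" if "a \<in> A" for a
      using y[OF that] subgroup.one_closed[OF sub(1)[OF that]] by (auto simp: S_def intro!: exI[of _ "y a"])
    have "S a0 \<subseteq> (\<lambda>z. y a0 \<otimes> z) ` N a0"
    proof
      fix z assume "z \<in> S a0"
      then show "z \<in> (\<lambda>z. y a0 \<otimes> z) ` N a0"
        using y[OF a0(1)] by (intro image_eqI[of _ _ "inv (y a0) \<otimes> z"]) (auto simp: S_def simp flip: m_assoc)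
    qed
    moreover have "compactin T ((\<lambda>z. y a0 \<otimes> z) ` N a0)"
      using image_compactin[OF admissible_subgroupD(2)[OF a0(2)] continuous_translation(1)] y[OF a0(1)] by simp
    ultimately show "compactin T (S a0)" using closed[OF a0(1)] closed_compactin by blast
    show "S b \<subseteq> S a" if ab: "a \<in> A" "b \<in> A" "a < b" for a b
    proof
      fix z assume "z \<in> S b"
      then have z: "z \<in> carrier G" "inv (y b) \<otimes> z \<in> N a" using decr[OF ab] by (auto simp: S_def)
      have "(inv (y a) \<otimes> y b) \<otimes> (inv (y b) \<otimes> z) \<in> N a"
        using subgroup.m_closed[OF sub(1)[OF ab(1)]] z(2) decr[OF ab] by blast
      moreover have "(inv (y a) \<otimes> y b) \<otimes> (inv (y b) \<otimes> z) = inv (y a) \<otimes> z"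
        using y[OF ab(1)] y[OF ab(2)] z(1) by (simp add: m_assoc) (simp flip: m_assoc)
      ultimately show "z \<in> S a" using z(1) by (simp add: S_def)
    qed
  qed
  then show ?thesis using a0(1) by (auto simp: S_def)
qed

text \<open>Let \<open>L\<close> be the product of \<open>M\<close> and the intersection of the
  chain, a compact set in the main case. For each \<open>V k\<close> in a sequence defining
  \<open>M\<close>, some member of the chain lies in \<open>L\<close> multiplied by
  \<open>V k\<close>. These countably many indices have a common bound \<open>b\<close>, and
  compactness of \<open>L\<close> yields, for \<open>x\<close> in \<open>N b\<close>, one
  \<open>l\<close> in \<open>L\<close> with \<open>inv l \<otimes> x\<close> in \<open>M\<close>. As
  \<open>M\<close> is a subgroup and the group is commutative, \<open>x\<close> lies in
  \<open>L\<close>.\<close>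

lemma chain_stabilizes_modulo:
  fixes N :: "'w::linorder \<Rightarrow> 'a set"
  assumes N: "\<And>a. N a = carrier G \<or> admissible_subgroup G T (N a)"
    and decr: "\<And>a b. a < b \<Longrightarrow> N b \<subseteq> N a"
    and M: "M = carrier G \<or> admissible_subgroup G T M"
    and bounded: "\<And>A :: 'w set. countable A \<Longrightarrow> \<exists>b. \<forall>a\<in>A. a < b"
  shows "\<exists>c. \<forall>x\<in>N c. \<exists>m\<in>M. \<exists>n. (\<forall>a. n \<in> N a) \<and> x = m \<otimes> n"
proof -
  have sub: "subgroup (N a) G" "closedin T (N a)" for a using whole_or_admissibleD[OF N] .
  have Msub: "subgroup M G" using whole_or_admissibleD[OF M] by blast
  have Nc: "N a \<subseteq> carrier G" for a using subgroup.subset[OF sub(1)] .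
  have one: "\<one> \<in> N a" "\<one> \<in> M" for a using subgroup.one_closed sub(1) Msub by auto
  consider "M = carrier G" | "\<forall>a. N a = carrier G"
    | "admissible_subgroup G T M" "\<exists>a. admissible_subgroup G T (N a)"
    using M N by blast
  then show ?thesis
  proof cases
    case 1
    then show ?thesis using one Nc by (metis r_one subsetD)
  next
    case 2
    then show ?thesis using one by (metis l_one)
  next
    case 3
    then obtain a0 V where a0: "admissible_subgroup G T (N a0)" and V: "square_root_chain G T V" "M = (\<Inter>n. V n)"
      by (auto simp: admissible_subgroup_def)
    define N' where "N' = (\<Inter>a. N a)"
    have N': "compactin T N'"
    proof (rule closed_compactin[OF admissible_subgroupD(2)[OF a0]])
      show "closedin T N'" unfolding N'_def using sub(2) by (intro closedin_Inter) auto
    qed (auto simp: N'_def)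
    define L where "L = (\<lambda>p. fst p \<otimes> snd p) ` (M \<times> N')"
    have "compactin (prod_topology T T) (M \<times> N')"
      using N' admissible_subgroupD(2)[OF 3(1)] by (simp add: compactin_Times)
    then have L: "compactin T L"
      unfolding L_def by (rule image_compactin) (intro continuous_mult continuous_map_fst continuous_map_snd)
    have Lc: "L \<subseteq> carrier G" using L compactin_subset_topspace topspace_eq by blast
    \<comment> \<open>Otherwise the sets \<open>N a - ?O\<close> form a decreasing chain of nonempty
      closed sets, compact at \<open>a0\<close>. A common point would lie in the intersection of the
      chain, hence in \<open>L\<close>, which \<open>?O\<close> covers.\<close>
    have "\<exists>c. N c \<subseteq> (\<Union>l\<in>L. {x \<in> carrier G. inv l \<otimes> x \<in> V k})" for k
    proof (rule ccontr)
      let ?O = "\<Union>l\<in>L. {x \<in> carrier G. inv l \<otimes> x \<in> V k}"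
      assume no: "\<nexists>c. N c \<subseteq> ?O"
      have "openin T ?O" using open_translate(1)[OF chain_open[OF V(1)]] Lc by (intro openin_Union) auto
      then have cl: "closedin T (N a - ?O)" for a using sub(2) by (rule closedin_diff[rotated])
      have "\<exists>x. \<forall>a\<in>UNIV. x \<in> N a - ?O"
      proof (rule compactin_chain_nonempty[of a0])
        show "compactin T (N a0 - ?O)"
          using closed_compactin[OF admissible_subgroupD(2)[OF a0] _ cl] by blast
        show "N b - ?O \<subseteq> N a - ?O" if "a < b" for a b using decr[OF that] by blast
      qed (use no cl in auto)
      then obtain x where x: "\<And>a. x \<in> N a" "x \<notin> ?O" by blast
      have "x \<in> carrier G" using x(1) Nc by blast
      moreover from this have "x \<in> L"
        using x(1) one(2) by (auto simp: L_def N'_def intro!: image_eqI[of _ _ "(\<one>, x)"])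
      ultimately have "x \<in> ?O" using chain_one[OF V(1), of k] by (intro UN_I[of x]) simp_all
      then show False using x(2) by blast
    qed
    then have "\<forall>k. \<exists>c. N c \<subseteq> (\<Union>l\<in>L. {x \<in> carrier G. inv l \<otimes> x \<in> V k})" by blast
    from choice[OF this] obtain c where c: "\<And>k. N (c k) \<subseteq> (\<Union>l\<in>L. {x \<in> carrier G. inv l \<otimes> x \<in> V k})" by blast
    obtain b where b: "\<And>k. c k < b" using bounded[of "range c"] by auto
    have "\<exists>m\<in>M. \<exists>n. (\<forall>a. n \<in> N a) \<and> x = m \<otimes> n" if xb: "x \<in> N b" for x
    proof -
      have xc: "x \<in> carrier G" using xb Nc by blast
      have ex: "\<exists>l\<in>L. inv l \<otimes> x \<in> V k" for k
        using c[of k] decr[OF b[of k]] xb by blast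
      have "\<exists>l\<in>L. \<forall>k. inv l \<otimes> x \<in> V k"
      proof (rule ccontr)
        assume "\<not> ?thesis"
        then obtain k where k: "\<And>l. l \<in> L \<Longrightarrow> inv l \<otimes> x \<notin> V (k l)" by metis
        \<comment> \<open>The extra index pays for a quotient: if \<open>inv l' \<otimes> x\<close>
          and \<open>inv l' \<otimes> l\<close> lie in \<open>V (Suc (k l))\<close>, then
          \<open>inv l \<otimes> x\<close> lies in \<open>V (k l)\<close>, against the choice of
          \<open>k l\<close>.\<close>
        define O' where "O' = (\<lambda>l. {l' \<in> carrier G. inv l' \<otimes> l \<in> V (Suc (k l))})"
        have "\<And>U. U \<in> O' ` L \<Longrightarrow> openin T U" "L \<subseteq> \<Union>(O' ` L)"
        proof -
          show "openin T U" if "U \<in> O' ` L" for U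
            using that open_translate(2)[OF chain_open[OF V(1)]] Lc by (auto simp: O'_def)
          have "l \<in> O' l" if "l \<in> L" for l
            using that Lc chain_one[OF V(1)] by (auto simp: O'_def subset_iff)
          then show "L \<subseteq> \<Union>(O' ` L)" by blast
        qed
        from compactinD[OF L this] obtain F where F: "finite F" "F \<subseteq> L" "L \<subseteq> (\<Union>l\<in>F. O' l)"
          by (metis finite_subset_image)
        define K where "K = Max ((\<lambda>l. Suc (k l)) ` F)"
        obtain l' where l': "l' \<in> L" "inv l' \<otimes> x \<in> V K" using ex by blast
        then obtain l where l: "l \<in> F" "l' \<in> carrier G" "inv l' \<otimes> l \<in> V (Suc (k l))"
          using F(3) by (auto simp: O'_def)
        have "Suc (k l) \<le> K" unfolding K_def using l(1) F(1) by (intro Max_ge) auto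
        then have "inv l' \<otimes> x \<in> V (Suc (k l))" using chain_decreasing[OF V(1)] l'(2) by blast
        then have "(inv l' \<otimes> x) \<otimes> inv (inv l' \<otimes> l) \<in> V (k l)" using chain_div[OF V(1)] l(3) by blast
        moreover have "(inv l' \<otimes> x) \<otimes> inv (inv l' \<otimes> l) = inv l \<otimes> x"
        proof -
          have lc: "l \<in> carrier G" using l(1) F(2) Lc by blast
          have "(inv l' \<otimes> x) \<otimes> inv (inv l' \<otimes> l) = (x \<otimes> inv l') \<otimes> (l' \<otimes> inv l)"
            using lc l(2) xc by (simp add: inv_mult_group m_comm)
          also have "\<dots> = x \<otimes> (inv l' \<otimes> (l' \<otimes> inv l))" using lc l(2) xc by (simp add: m_assoc)
          also have "inv l' \<otimes> (l' \<otimes> inv l) = inv l" using lc l(2) by (simp flip: m_assoc)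
          finally show ?thesis using lc xc by (simp add: m_comm)
        qed
        ultimately show False using k[of l] l(1) F(2) by auto
      qed
      then obtain l where l: "l \<in> L" "inv l \<otimes> x \<in> M" using V(2) by auto
      then obtain m n where mn: "m \<in> M" "n \<in> N'" "l = m \<otimes> n" by (auto simp: L_def)
      have cs: "m \<in> carrier G" "n \<in> carrier G" "l \<in> carrier G"
        using mn subgroup.subset[OF Msub] Nc l(1) Lc by (auto simp: N'_def)
      have "x = l \<otimes> (inv l \<otimes> x)" using cs xc by (simp flip: m_assoc)
      also have "\<dots> = (m \<otimes> (inv l \<otimes> x)) \<otimes> n"
      proof -
        have "l \<otimes> w = (m \<otimes> w) \<otimes> n" if "w \<in> carrier G" for w
          using cs(1,2) that by (simp add: mn(3) m_ac)
        then show ?thesis using cs xc by simp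
      qed
      finally show ?thesis
        using subgroup.m_closed[OF Msub mn(1) l(2)] mn(2) by (auto simp: N'_def)
    qed
    then show ?thesis by blast
  qed
qed

end

section \<open>Products of feathered groups\<close>

lemma comm_group_product_group:
  assumes "\<And>i. i \<in> I \<Longrightarrow> comm_group (D i)"
  shows "comm_group (product_group I D)"
proof -
  have "group (D i)" if "i \<in> I" for i using assms[OF that] by (simp add: comm_group_def)
  then interpret group "product_group I D" by simp
  show ?thesis
  proof (rule group_comm_groupI)
    fix x y assume "x \<in> carrier (product_group I D)" "y \<in> carrier (product_group I D)"
    then show "x \<otimes>\<^bsub>product_group I D\<^esub> y = y \<otimes>\<^bsub>product_group I D\<^esub> x"
      using assms by (auto simp: comm_group_def comm_monoid.m_comm PiE_iff intro!: restrict_ext)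
  qed
qed

text \<open>Countably many proper factors are allowed because a countable intersection of basic open
  sets can restrict that many coordinates. Whole factors form a separate alternative, as a factor
  need not be compact and so need not be admissible in itself.\<close>

definition basic_box :: "'i set \<Rightarrow> ('i \<Rightarrow> 'a monoid) \<Rightarrow> ('i \<Rightarrow> 'a topology) \<Rightarrow> ('i \<Rightarrow> 'a set) \<Rightarrow> bool" where
  "basic_box I D T F \<longleftrightarrow> countable {i \<in> I. F i \<noteq> carrier (D i)} \<and>
     (\<forall>i\<in>I. F i = carrier (D i) \<or> admissible_subgroup (D i) (T i) (F i))"

locale feathered_family =
  fixes I :: "'i set" and D :: "'i \<Rightarrow> 'a monoid" and T :: "'i \<Rightarrow> 'a topology"
  assumes topological: "\<And>i. i \<in> I \<Longrightarrow> topological_abelian_group (D i) (T i)"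
    and feathered: "\<And>i. i \<in> I \<Longrightarrow> feathered_group (D i) (T i)"
begin

abbreviation "G \<equiv> product_group I D"
abbreviation "X \<equiv> product_topology T I"
abbreviation "\<N> \<equiv> {Pi\<^sub>E I F |F. basic_box I D T F}"

lemma factor: "i \<in> I \<Longrightarrow> topological_comm_group (D i) (T i)"
  using topological[of i]
  by (simp add: topological_comm_group_def topological_comm_group_axioms_def topological_abelian_group_def)

lemma factor_comm: "i \<in> I \<Longrightarrow> comm_group (D i)"
  and factor_group: "i \<in> I \<Longrightarrow> group (D i)"
  and factor_topspace: "i \<in> I \<Longrightarrow> topspace (T i) = carrier (D i)"
  using factor[of i] topological_comm_group.topspace_eq[of "D i" "T i"]
  by (simp_all add: topological_comm_group_def comm_group_def)

lemma topspace_X: "topspace X = carrier G"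
  by (auto simp: factor_topspace intro!: PiE_cong)

section \<open>Boxes as a base of the P-modification\<close>

lemma box_subgroup:
  assumes "basic_box I D T F" "i \<in> I"
  shows "subgroup (F i) (D i)"
proof -
  interpret topological_comm_group "D i" "T i" by (rule factor[OF assms(2)])
  show ?thesis by (rule whole_or_admissibleD(1)) (use assms in \<open>auto simp: basic_box_def\<close>)
qed

lemma box_subset: "basic_box I D T F \<Longrightarrow> i \<in> I \<Longrightarrow> F i \<subseteq> carrier (D i)"
  using box_subgroup subgroup.subset by blast

lemma box_one: "basic_box I D T F \<Longrightarrow> i \<in> I \<Longrightarrow> \<one>\<^bsub>D i\<^esub> \<in> F i"
  using box_subgroup subgroup.one_closed by blast

text \<open>Membership in a coset of a box amounts to countably many open conditions, one for each
  pair of a proper factor and an index in its defining sequence.\<close>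

lemma gdelta_translate:
  assumes F: "basic_box I D T F" and x: "x \<in> carrier G"
  shows "gdelta_in X {y \<in> carrier G. \<forall>i\<in>I. inv\<^bsub>D i\<^esub> x i \<otimes>\<^bsub>D i\<^esub> y i \<in> F i}"
proof -
  define J where "J = {i \<in> I. F i \<noteq> carrier (D i)}"
  have J: "countable J" using F by (simp add: J_def basic_box_def)
  have "\<exists>V. square_root_chain (D i) (T i) V \<and> F i = (\<Inter>n. V n)" if "i \<in> J" for i
    using that F by (auto simp: J_def basic_box_def admissible_subgroup_def)
  then obtain V where V: "\<And>i. i \<in> J \<Longrightarrow> square_root_chain (D i) (T i) (V i) \<and> F i = (\<Inter>n. V i n)"
    by metis
  define O' where "O' = (\<lambda>(i, n). {y \<in> topspace X. y i \<in> {z \<in> carrier (D i). inv\<^bsub>D i\<^esub> x i \<otimes>\<^bsub>D i\<^esub> z \<in> V i n}})"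
  have "openin X (O' (i, n))" if "i \<in> J" for i and n :: nat
  proof -
    have i: "i \<in> I" using that by (simp add: J_def)
    interpret topological_comm_group "D i" "T i" by (rule factor[OF i])
    have "openin (T i) {z \<in> carrier (D i). inv\<^bsub>D i\<^esub> x i \<otimes>\<^bsub>D i\<^esub> z \<in> V i n}"
      by (rule open_translate(1)) (use V[OF that] x i in \<open>auto simp: square_root_chain_def\<close>)
    then show ?thesis
      unfolding O'_def split by (rule openin_continuous_map_preimage[OF continuous_map_product_projection[OF i]])
  qed
  \<comment> \<open>Inserting the whole space gives the right intersection also when there is no
    proper factor.\<close>
  then have "gdelta_in X (\<Inter>(insert (topspace X) (O' ` (J \<times> UNIV))))"
    using J by (intro gdelta_in_Inter) (auto simp: open_imp_gdelta_in simp del: topspace_product_topology)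
  moreover have "\<Inter>(insert (topspace X) (O' ` (J \<times> UNIV))) = {y \<in> carrier G. \<forall>i\<in>I. inv\<^bsub>D i\<^esub> x i \<otimes>\<^bsub>D i\<^esub> y i \<in> F i}"
  proof (intro equalityI subsetI)
    fix y assume y: "y \<in> \<Inter>(insert (topspace X) (O' ` (J \<times> UNIV)))"
    then have yc: "y \<in> carrier G" using topspace_X by auto
    have "inv\<^bsub>D i\<^esub> x i \<otimes>\<^bsub>D i\<^esub> y i \<in> F i" if i: "i \<in> I" for i
    proof (cases "i \<in> J")
      case True
      then have "O' (i, n) \<in> insert (topspace X) (O' ` (J \<times> UNIV))" for n by simp
      then have "y \<in> O' (i, n)" for n by (rule InterD[OF y])
      then have "inv\<^bsub>D i\<^esub> x i \<otimes>\<^bsub>D i\<^esub> y i \<in> V i n" for n by (simp add: O'_def)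
      then show ?thesis using V[OF True] by simp
    next
      case False
      then have "F i = carrier (D i)" using i by (simp add: J_def)
      moreover have "x i \<in> carrier (D i)" "y i \<in> carrier (D i)" using x yc i by auto
      ultimately show ?thesis
        using factor_group[OF i] by (simp add: group.is_monoid monoid.m_closed)
    qed
    with yc show "y \<in> {y \<in> carrier G. \<forall>i\<in>I. inv\<^bsub>D i\<^esub> x i \<otimes>\<^bsub>D i\<^esub> y i \<in> F i}" by blast
  next
    fix y assume y: "y \<in> {y \<in> carrier G. \<forall>i\<in>I. inv\<^bsub>D i\<^esub> x i \<otimes>\<^bsub>D i\<^esub> y i \<in> F i}"
    then have "y \<in> topspace X" using topspace_X by blast
    moreover have "y \<in> O' (i, n)" if "i \<in> J" for i n
    proof -
      have i: "i \<in> I" using that by (simp add: J_def)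
      then have "inv\<^bsub>D i\<^esub> x i \<otimes>\<^bsub>D i\<^esub> y i \<in> F i" "y i \<in> carrier (D i)" using y by auto
      then show ?thesis using V[OF that] \<open>y \<in> topspace X\<close> by (auto simp: O'_def)
    qed
    ultimately show "y \<in> \<Inter>(insert (topspace X) (O' ` (J \<times> UNIV)))" by blast
  qed
  ultimately show ?thesis by metis
qed

text \<open>Countably many basic open sets around \<open>x\<close> restrict only a countable set
  \<open>J\<close> of coordinates. In each of these one admissible subgroup serves all the open sets
  at once, because \<open>feathered_admissible_inside\<close> accepts a whole sequence of
  neighbourhoods.\<close>

lemma box_inside_gdelta:
  assumes W: "gdelta_in X W" and x: "x \<in> W"
  shows "\<exists>N\<in>\<N>. \<forall>h\<in>N. x \<otimes>\<^bsub>G\<^esub> h \<in> W"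
proof -
  obtain C where C: "\<And>n::nat. openin X (C n)" "\<Inter>(range C) = W"
    using W unfolding gdelta_in_descending by blast
  have xc: "x \<in> carrier G" using W x gdelta_in_subset topspace_X by blast
  have "\<forall>n. \<exists>U. finite {i \<in> I. U i \<noteq> topspace (T i)} \<and> (\<forall>i\<in>I. openin (T i) (U i)) \<and> x \<in> Pi\<^sub>E I U \<and> Pi\<^sub>E I U \<subseteq> C n"
    using C x unfolding openin_product_topology_alt by blast
  from choice[OF this] obtain U where "\<forall>n. finite {i \<in> I. U n i \<noteq> topspace (T i)} \<and>
      (\<forall>i\<in>I. openin (T i) (U n i)) \<and> x \<in> Pi\<^sub>E I (U n) \<and> Pi\<^sub>E I (U n) \<subseteq> C n"
    by (rule exE)
  then have U: "finite {i \<in> I. U n i \<noteq> topspace (T i)}" "i \<in> I \<Longrightarrow> openin (T i) (U n i)"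
    "x \<in> Pi\<^sub>E I (U n)" "Pi\<^sub>E I (U n) \<subseteq> C n" for n i
    by blast+
  define J where "J = (\<Union>n. {i \<in> I. U n i \<noteq> topspace (T i)})"
  have "countable J" unfolding J_def using U(1) by (intro countable_UN) (auto intro: countable_finite)
  have "\<exists>N. admissible_subgroup (D i) (T i) N \<and> (\<forall>n. \<forall>h\<in>N. x i \<otimes>\<^bsub>D i\<^esub> h \<in> U n i)" if i: "i \<in> I" for i
  proof -
    interpret topological_comm_group "D i" "T i" by (rule factor[OF i])
    have xi: "x i \<in> carrier (D i)" using xc i by auto
    have "openin (T i) {y \<in> carrier (D i). x i \<otimes>\<^bsub>D i\<^esub> y \<in> U n i}" for n
      by (rule open_translate(1)[OF U(2)[OF i] xi])
    moreover have "\<one>\<^bsub>D i\<^esub> \<in> {y \<in> carrier (D i). x i \<otimes>\<^bsub>D i\<^esub> y \<in> U n i}" for n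
      using U(3)[of n] i xi by (simp add: PiE_iff)
    ultimately obtain N where "admissible_subgroup (D i) (T i) N"
      "\<And>n. N \<subseteq> {y \<in> carrier (D i). x i \<otimes>\<^bsub>D i\<^esub> y \<in> U n i}"
      using feathered_admissible_inside[OF feathered[OF i], of "\<lambda>n. {y \<in> carrier (D i). x i \<otimes>\<^bsub>D i\<^esub> y \<in> U n i}"]
      by blast
    then show ?thesis by blast
  qed
  then obtain N where N: "\<And>i. i \<in> I \<Longrightarrow> admissible_subgroup (D i) (T i) (N i) \<and> (\<forall>n. \<forall>h\<in>N i. x i \<otimes>\<^bsub>D i\<^esub> h \<in> U n i)"
    by metis
  define F where "F = (\<lambda>i. if i \<in> J then N i else carrier (D i))"
  have "{i \<in> I. F i \<noteq> carrier (D i)} \<subseteq> J" by (auto simp: F_def)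
  then have "countable {i \<in> I. F i \<noteq> carrier (D i)}" using \<open>countable J\<close> by (rule countable_subset)
  then have "basic_box I D T F" using N by (auto simp: basic_box_def F_def)
  moreover have "x \<otimes>\<^bsub>G\<^esub> h \<in> W" if h: "h \<in> Pi\<^sub>E I F" for h
  proof -
    have "x \<otimes>\<^bsub>G\<^esub> h \<in> Pi\<^sub>E I (U n)" for n
    proof -
      have "x i \<otimes>\<^bsub>D i\<^esub> h i \<in> U n i" if i: "i \<in> I" for i
      proof (cases "i \<in> J")
        case True
        then have "h i \<in> N i" using h i by (auto simp: F_def PiE_iff)
        then show ?thesis using N[OF i] by blast
      next
        case False
        then have "U n i = carrier (D i)" using i factor_topspace by (auto simp: J_def)
        moreover have "h i \<in> carrier (D i)" "x i \<in> carrier (D i)" using h i False xc by (auto simp: F_def PiE_iff)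
        ultimately show ?thesis using factor_group[OF i] by (simp add: group.is_monoid monoid.m_closed)
      qed
      then show ?thesis by simp
    qed
    then show ?thesis using U(4) C(2) by blast
  qed
  ultimately show ?thesis by blast
qed

lemma openin_P_iff:
  "openin (P_modification X) U \<longleftrightarrow> U \<subseteq> carrier G \<and> (\<forall>x\<in>U. \<exists>N\<in>\<N>. \<forall>h\<in>N. x \<otimes>\<^bsub>G\<^esub> h \<in> U)"
proof (intro iffI conjI ballI)
  assume U: "openin (P_modification X) U"
  then show Uc: "U \<subseteq> carrier G" using openin_subset topspace_P_modification topspace_X by metis
  fix x assume "x \<in> U"
  then obtain W where "gdelta_in X W" "x \<in> W" "W \<subseteq> U"
    using U unfolding openin_P_modification arbitrary_union_of_alt by blast
  then show "\<exists>N\<in>\<N>. \<forall>h\<in>N. x \<otimes>\<^bsub>G\<^esub> h \<in> U" using box_inside_gdelta[of W x] by (meson subsetD)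
next
  assume R: "U \<subseteq> carrier G \<and> (\<forall>x\<in>U. \<exists>N\<in>\<N>. \<forall>h\<in>N. x \<otimes>\<^bsub>G\<^esub> h \<in> U)"
  show "openin (P_modification X) U"
    unfolding openin_P_modification arbitrary_union_of_alt
  proof (intro ballI)
    fix x assume x: "x \<in> U"
    then have xc: "x \<in> carrier G" using R by blast
    obtain F where F: "basic_box I D T F" "\<And>h. h \<in> Pi\<^sub>E I F \<Longrightarrow> x \<otimes>\<^bsub>G\<^esub> h \<in> U" using R x by blast
    let ?W = "{y \<in> carrier G. \<forall>i\<in>I. inv\<^bsub>D i\<^esub> x i \<otimes>\<^bsub>D i\<^esub> y i \<in> F i}"
    have xi: "x i \<in> carrier (D i)" if "i \<in> I" for i using xc that by auto
    have "x \<in> ?W"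
      using xc xi box_one[OF F(1)] factor_group by (auto simp: group.l_inv)
    moreover have "?W \<subseteq> U"
    proof
      fix y assume y: "y \<in> ?W"
      define h where "h = (\<lambda>i\<in>I. inv\<^bsub>D i\<^esub> x i \<otimes>\<^bsub>D i\<^esub> y i)"
      have "h \<in> Pi\<^sub>E I F" using y by (auto simp: h_def)
      moreover have "x \<otimes>\<^bsub>G\<^esub> h = y"
      proof
        fix i
        show "(x \<otimes>\<^bsub>G\<^esub> h) i = y i"
        proof (cases "i \<in> I")
          case True
          interpret group "D i" by (rule factor_group[OF True])
          have "y i \<in> carrier (D i)" using y True by auto
          then show ?thesis using True xi[OF True] by (simp add: h_def flip: m_assoc)
        next
          case False
          then show ?thesis using y by (auto simp: PiE_iff extensional_def)
        qed
      qed
      ultimately show "y \<in> U" using F(2) by metis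
    qed
    ultimately show "\<exists>W. gdelta_in X W \<and> x \<in> W \<and> W \<subseteq> U" using gdelta_translate[OF F(1) xc] by blast
  qed
qed

lemma box_is_gdelta:
  assumes "N \<in> \<N>"
  shows "gdelta_in X N"
proof -
  obtain F where F: "N = Pi\<^sub>E I F" "basic_box I D T F" using assms by blast
  let ?one = "\<lambda>i\<in>I. \<one>\<^bsub>D i\<^esub>"
  have one: "?one \<in> carrier G" using factor_group by (auto simp: group.is_monoid monoid.one_closed)
  have eq: "inv\<^bsub>D i\<^esub> \<one>\<^bsub>D i\<^esub> \<otimes>\<^bsub>D i\<^esub> z = z" if "i \<in> I" "z \<in> carrier (D i)" for i z
  proof -
    interpret group "D i" by (rule factor_group[OF that(1)])
    show ?thesis using that by simp
  qed
  have "{y \<in> carrier G. \<forall>i\<in>I. inv\<^bsub>D i\<^esub> ?one i \<otimes>\<^bsub>D i\<^esub> y i \<in> F i} = N"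
    unfolding F(1) using box_subset[OF F(2)] eq by (auto simp: PiE_iff subset_iff extensional_def)
  then show ?thesis using gdelta_translate[OF F(2) one] by simp
qed

lemma linear_P_group: "linear_P_group G (P_modification X) \<N>"
proof -
  interpret comm_group G by (rule comm_group_product_group) (rule factor_comm)
  show ?thesis
  proof (intro linear_P_group.intro comm_group_axioms linear_P_group_axioms.intro)
    fix N assume "N \<in> \<N>"
    then show "subgroup N G" using PiE_subgroup_product_group[of I D] factor_group box_subgroup by blast
  next
    show "openin (P_modification X) U \<longleftrightarrow> U \<subseteq> carrier G \<and> (\<forall>x\<in>U. \<exists>N\<in>\<N>. \<forall>h\<in>N. x \<otimes>\<^bsub>G\<^esub> h \<in> U)" for U
      by (rule openin_P_iff)
  next
    fix \<A> assume \<A>: "countable \<A>" "\<A> \<subseteq> \<N>"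
    have one: "\<one>\<^bsub>G\<^esub> \<in> N" if "N \<in> \<N>" for N using that box_one by auto
    \<comment> \<open>Instead of intersecting boxes factor by factor, the intersection is taken as a
      G-delta set containing the identity, and such a set contains a box.\<close>
    have gd: "gdelta_in X (\<Inter>(insert (topspace X) \<A>))"
      using \<A> box_is_gdelta by (intro gdelta_in_Inter) (auto simp del: topspace_product_topology)
    have oneX: "\<one>\<^bsub>G\<^esub> \<in> topspace X" unfolding topspace_X by (rule one_closed)
    have "\<one>\<^bsub>G\<^esub> \<in> \<Inter>(insert (topspace X) \<A>)"
    proof (rule InterI)
      fix M assume "M \<in> insert (topspace X) \<A>"
      then consider "M = topspace X" | "M \<in> \<A>" by (rule insertE)
      then show "\<one>\<^bsub>G\<^esub> \<in> M" by cases (use oneX one[OF subsetD[OF \<A>(2)]] in \<open>simp_all only:\<close>)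
    qed
    with gd have "\<exists>N\<in>\<N>. \<forall>h\<in>N. \<one>\<^bsub>G\<^esub> \<otimes>\<^bsub>G\<^esub> h \<in> \<Inter>(insert (topspace X) \<A>)"
      by (rule box_inside_gdelta)
    then obtain N where N: "N \<in> \<N>" "\<forall>h\<in>N. \<one>\<^bsub>G\<^esub> \<otimes>\<^bsub>G\<^esub> h \<in> \<Inter>(insert (topspace X) \<A>)"
      by (rule bexE)
    have Nc: "N \<subseteq> carrier G" using gdelta_in_subset[OF box_is_gdelta[OF N(1)]] topspace_X by simp
    have "N \<subseteq> M" if "M \<in> \<A>" for M
    proof
      fix h assume h: "h \<in> N"
      then have "\<one>\<^bsub>G\<^esub> \<otimes>\<^bsub>G\<^esub> h \<in> \<Inter>(insert (topspace X) \<A>)" by (rule N(2)[rule_format])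
      then have "\<one>\<^bsub>G\<^esub> \<otimes>\<^bsub>G\<^esub> h \<in> M" using that by blast
      moreover have "\<one>\<^bsub>G\<^esub> \<otimes>\<^bsub>G\<^esub> h = h" using h Nc by (intro l_one) blast
      ultimately show "h \<in> M" by (simp only:)
    qed
    then show "\<exists>N\<in>\<N>. \<forall>M\<in>\<A>. N \<subseteq> M" using N(1) by blast
  next
    fix x assume x: "x \<in> carrier G" "\<And>N. N \<in> \<N> \<Longrightarrow> x \<in> N"
    have "x i = \<one>\<^bsub>D i\<^esub>" if i: "i \<in> I" for i
    proof (rule ccontr)
      assume ne: "x i \<noteq> \<one>\<^bsub>D i\<^esub>"
      interpret Di: topological_comm_group "D i" "T i" by (rule factor[OF i])
      have "closedin (T i) {x i}"
        using closedin_Hausdorff_singleton[OF Di.Hausdorff, of "x i"] x(1) i Di.topspace_eq by auto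
      then have "openin (T i) (carrier (D i) - {x i})" by (simp add: closedin_def Di.topspace_eq)
      then obtain N where N: "admissible_subgroup (D i) (T i) N" "N \<subseteq> carrier (D i) - {x i}"
        using Di.feathered_admissible_inside[OF feathered[OF i], of "\<lambda>_. carrier (D i) - {x i}"] ne by auto
      \<comment> \<open>The box whose only possibly proper factor is the one at \<open>i\<close>
        excludes \<open>x\<close>, since that factor avoids \<open>x i\<close>.\<close>
      define F where "F = (\<lambda>j. if j = i then N else carrier (D j))"
      have "{j \<in> I. F j \<noteq> carrier (D j)} \<subseteq> {i}" by (auto simp: F_def)
      then have "countable {j \<in> I. F j \<noteq> carrier (D j)}" by (rule countable_subset) simp
      then have "basic_box I D T F" using N(1) by (auto simp: basic_box_def F_def)
      then have "x \<in> Pi\<^sub>E I F" using x(2) by blast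
      then have "x i \<in> N" using i by (auto simp: F_def PiE_iff)
      then show False using N(2) by blast
    qed
    then show "x = \<one>\<^bsub>G\<^esub>" using x(1) by (auto simp: PiE_iff extensional_def fun_eq_iff)
  qed
qed

section \<open>Chains of boxes, coordinate by coordinate\<close>

lemma decreasing_factors:
  assumes "basic_box I D T F" "basic_box I D T F'" "Pi\<^sub>E I F' \<subseteq> Pi\<^sub>E I F" "i \<in> I"
  shows "F' i \<subseteq> F i"
proof -
  have "Pi\<^sub>E I F' \<noteq> {}" using box_one[OF assms(2)] by (auto simp: PiE_eq_empty_iff)
  then show ?thesis using assms(3,4) by (simp add: subset_PiE)
qed

text \<open>Decreasing boxes have decreasing factors, so each coordinate is a chain of cosets in one
  factor. Common points chosen there independently assemble to a point of the product.\<close>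

lemma box_chain_complete:
  fixes N :: "'w::linorder \<Rightarrow> ('i \<Rightarrow> 'a) set"
  assumes N: "\<And>a. a \<in> A \<Longrightarrow> N a \<in> \<N> \<and> y a \<in> carrier G"
    and decr: "\<And>a b. \<lbrakk>a \<in> A; b \<in> A; a < b\<rbrakk> \<Longrightarrow> N b \<subseteq> N a \<and> inv\<^bsub>G\<^esub> (y a) \<otimes>\<^bsub>G\<^esub> y b \<in> N a"
  shows "\<exists>z\<in>carrier G. \<forall>a\<in>A. inv\<^bsub>G\<^esub> (y a) \<otimes>\<^bsub>G\<^esub> z \<in> N a"
proof -
  have "\<forall>a. \<exists>F. a \<in> A \<longrightarrow> N a = Pi\<^sub>E I F \<and> basic_box I D T F" using N by blast
  from choice[OF this] obtain F where F: "\<And>a. a \<in> A \<Longrightarrow> N a = Pi\<^sub>E I (F a)" "\<And>a. a \<in> A \<Longrightarrow> basic_box I D T (F a)"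
    by blast
  have inv: "inv\<^bsub>G\<^esub> (y a) = (\<lambda>i\<in>I. inv\<^bsub>D i\<^esub> y a i)" if "a \<in> A" for a
    using N[OF that] factor_group by simp
  have "\<exists>z\<in>carrier (D i). \<forall>a\<in>A. inv\<^bsub>D i\<^esub> (y a i) \<otimes>\<^bsub>D i\<^esub> z \<in> F a i" if i: "i \<in> I" for i
  proof -
    interpret topological_comm_group "D i" "T i" by (rule factor[OF i])
    show ?thesis
    proof (rule coset_chain_common_point)
      show "F a i = carrier (D i) \<or> admissible_subgroup (D i) (T i) (F a i)" if "a \<in> A" for a
        using F(2)[OF that] i by (simp add: basic_box_def)
      show "y a i \<in> carrier (D i)" if "a \<in> A" for a using N[OF that] i by auto
      fix a b assume ab: "a \<in> A" "b \<in> A" "a < b"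
      have "(inv\<^bsub>G\<^esub> (y a) \<otimes>\<^bsub>G\<^esub> y b) i \<in> F a i"
        using decr[OF ab] F(1)[OF ab(1)] i by (metis PiE_mem)
      then show "F b i \<subseteq> F a i \<and> inv\<^bsub>D i\<^esub> (y a i) \<otimes>\<^bsub>D i\<^esub> y b i \<in> F a i"
        using decreasing_factors[OF F(2)[OF ab(1)] F(2)[OF ab(2)] _ i] decr[OF ab] F(1) ab i inv[OF ab(1)] by simp
    qed
  qed
  then obtain z where z: "\<And>i. i \<in> I \<Longrightarrow> z i \<in> carrier (D i) \<and> (\<forall>a\<in>A. inv\<^bsub>D i\<^esub> (y a i) \<otimes>\<^bsub>D i\<^esub> z i \<in> F a i)"
    by metis
  have "inv\<^bsub>G\<^esub> (y a) \<otimes>\<^bsub>G\<^esub> restrict z I \<in> N a" if "a \<in> A" for a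
    using z that by (auto simp: inv[OF that] F(1)[OF that])
  moreover have "restrict z I \<in> carrier G" using z by auto
  ultimately show ?thesis by blast
qed

text \<open>The stabilizing index depends on the coordinate, and uncountably many such indices may
  have no common bound. A bound is needed only for the countably many proper factors of
  \<open>M\<close>; in any other coordinate \<open>x i\<close> itself lies in the factor of
  \<open>M\<close>.\<close>

lemma box_chain_stabilizes:
  fixes N :: "'w::linorder \<Rightarrow> ('i \<Rightarrow> 'a) set"
  assumes N: "\<And>a. N a \<in> \<N>" and decr: "\<And>a b. a < b \<Longrightarrow> N b \<subseteq> N a" and M: "M \<in> \<N>"
    and bounded: "\<And>A :: 'w set. countable A \<Longrightarrow> \<exists>b. \<forall>a\<in>A. a < b"
  shows "\<exists>c. \<forall>x\<in>N c. \<exists>m\<in>M. \<exists>n. (\<forall>a. n \<in> N a) \<and> x = m \<otimes>\<^bsub>G\<^esub> n"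
proof -
  have "\<forall>a. \<exists>F. N a = Pi\<^sub>E I F \<and> basic_box I D T F" using N by blast
  from choice[OF this] obtain F where F: "\<And>a. N a = Pi\<^sub>E I (F a)" "\<And>a. basic_box I D T (F a)" by blast
  obtain H where H: "M = Pi\<^sub>E I H" "basic_box I D T H" using M by blast
  have Fdecr: "F b i \<subseteq> F a i" if "a < b" "i \<in> I" for a b i
    using decreasing_factors[OF F(2) F(2) _ that(2)] decr[OF that(1)] F(1) by metis
  have "\<exists>c. \<forall>x\<in>F c i. \<exists>m\<in>H i. \<exists>n. (\<forall>a. n \<in> F a i) \<and> x = m \<otimes>\<^bsub>D i\<^esub> n" if i: "i \<in> I" for i
  proof -
    interpret topological_comm_group "D i" "T i" by (rule factor[OF i])
    show ?thesis
      by (rule chain_stabilizes_modulo[OF _ Fdecr[OF _ i] _ bounded])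
         (use F(2) H(2) i in \<open>auto simp: basic_box_def\<close>)
  qed
  then obtain c where c: "\<And>i. i \<in> I \<Longrightarrow> \<forall>x\<in>F (c i) i. \<exists>m\<in>H i. \<exists>n. (\<forall>a. n \<in> F a i) \<and> x = m \<otimes>\<^bsub>D i\<^esub> n"
    by metis
  define J where "J = {i \<in> I. H i \<noteq> carrier (D i)}"
  have "countable (c ` J)" using H(2) by (simp add: J_def basic_box_def)
  from bounded[OF this] obtain b where b: "\<And>i. i \<in> J \<Longrightarrow> c i < b" by blast
  have "\<exists>m\<in>M. \<exists>n. (\<forall>a. n \<in> N a) \<and> x = m \<otimes>\<^bsub>G\<^esub> n" if x: "x \<in> N b" for x
  proof -
    have xF: "x i \<in> F b i" if "i \<in> I" for i using x F(1) that by (metis PiE_mem)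
    have "\<exists>m\<in>H i. \<exists>n. (\<forall>a. n \<in> F a i) \<and> x i = m \<otimes>\<^bsub>D i\<^esub> n" if i: "i \<in> I" for i
    proof (cases "i \<in> J")
      case True
      then have "x i \<in> F (c i) i" using Fdecr[OF b i] xF[OF i] by blast
      then show ?thesis using c[OF i] by blast
    next
      case False
      interpret group "D i" by (rule factor_group[OF i])
      have "x i \<in> carrier (D i)" using xF[OF i] box_subset[OF F(2) i] by blast
      moreover have "H i = carrier (D i)" using False i by (simp add: J_def)
      ultimately show ?thesis using box_one[OF F(2) i] by (intro bexI[of _ "x i"] exI[of _ "\<one>\<^bsub>D i\<^esub>"]) auto
    qed
    then obtain m n where mn: "\<And>i. i \<in> I \<Longrightarrow> m i \<in> H i \<and> (\<forall>a. n i \<in> F a i) \<and> x i = m i \<otimes>\<^bsub>D i\<^esub> n i"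
      by metis
    have "x = restrict m I \<otimes>\<^bsub>G\<^esub> restrict n I"
    proof
      fix i
      show "x i = (restrict m I \<otimes>\<^bsub>G\<^esub> restrict n I) i"
        using mn[of i] x F(1)[of b] by (cases "i \<in> I") (auto simp: PiE_iff extensional_def)
    qed
    moreover have "restrict m I \<in> M" "\<forall>a. restrict n I \<in> N a" using mn F(1) H(1) by auto
    ultimately show ?thesis by blast
  qed
  then show ?thesis by blast
qed

theorem reflexive: "reflexive_group G (P_modification X)"
proof -
  interpret P: linear_P_group G "P_modification X" \<N> by (rule linear_P_group)
  show ?thesis
  proof (rule P.reflexive_if_compacts_equicontinuous)
    show "\<exists>N\<in>\<N>. \<forall>\<phi>\<in>C. \<forall>n\<in>N. \<phi> n = 1" if "compactin (dual_topology G (P_modification X)) C" for C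
      using box_chain_complete box_chain_stabilizes[OF _ _ _ countable_bounded_omega1] that
      by (rule P.compacts_equicontinuous)
  qed
qed

end

theorem theorem4:
  fixes I :: "'i set"
    and D :: "'i \<Rightarrow> 'a monoid"
    and T :: "'i \<Rightarrow> 'a topology"
  assumes "\<And>i. i \<in> I \<Longrightarrow> topological_abelian_group (D i) (T i)"
    and "\<And>i. i \<in> I \<Longrightarrow> feathered_group (D i) (T i)"
  shows "reflexive_group (product_group I D) (P_modification (product_topology T I))"
  by (rule feathered_family.reflexive) (use assms in \<open>simp add: feathered_family_def\<close>)

end
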